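(* Let $K$ be a unital commutative ring and let $\mathfrak g$ be a Lie $K$-algebra which is a free $K$-module. Then the Poincaré–Birkhoff–Witt theorem holds for $\mathfrak g$: for every $n\ge 0$ the natural map $\boldsymbol m^{(n)}:\bigodot^n\mathfrak g\to\mathcal U^n\mathfrak g/\mathcal U^{n-1}\mathfrak g$ is an isomorphism of $K$-modules.
   Context: A Lie $K$-algebra is a $K$-module with a $K$-bilinear bracket satisfying $[x,x]=0$ and the Jacobi identity. All tensor products are over $K$. The universal enveloping algebra $\mathcal U\mathfrak g$ is the tensor algebra $\bigotimes\mathfrak g=\bigoplus_{n\ge0}\mathfrak g^{\otimes n}$ modulo the two-sided ideal generated by the elements $X\otimes Y-Y\otimes X-[X,Y]$ ($X,Y\in\mathfrak g$); $\boldsymbol m:\bigotimes\mathfrak g\to\mathcal U\mathfrak g$ is the quotient map. $\mathcal U^n\mathfrak g=\boldsymbol m\bigl(\bigoplus_{j\le n}\mathfrak g^{\otimes j}\bigr)$, with $\mathcal U^{-1}\mathfrak g=0$. $\bigodot^n\mathfrak g$ is the $n$-th symmetric power of $\mathfrak g$ over $K$ (quotient of $\mathfrak g^{\otimes n}$ by permutations). The surjection $\boldsymbol m^{(n)}$ sends $x_1\odot\cdots\odot x_n$ to the class of $\boldsymbol m(x_1\otimes\cdots\otimes x_n)$. *)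

theory Defs
  imports "HOL-Library.Multiset" "HOL-Algebra.QuotRing" "HOL-Algebra.Module"
begin

section \<open>Modules: homomorphisms, generated submodules, quotients, free modules\<close>

definition module_iso ::
    "('k, 'm) ring_scheme \<Rightarrow> ('k, 'a, 'c) module_scheme \<Rightarrow> ('k, 'b, 'd) module_scheme \<Rightarrow> ('a \<Rightarrow> 'b) set"
  where "module_iso K M N =
    {h. bij_betw h (carrier M) (carrier N) \<and>
        (\<forall>x\<in>carrier M. \<forall>y\<in>carrier M. h (x \<oplus>\<^bsub>M\<^esub> y) = h x \<oplus>\<^bsub>N\<^esub> h y) \<and>
        (\<forall>a\<in>carrier K. \<forall>x\<in>carrier M. h (a \<odot>\<^bsub>M\<^esub> x) = a \<odot>\<^bsub>N\<^esub> h x)}"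

definition gen_submodule ::
    "('k, 'm) ring_scheme \<Rightarrow> ('k, 'a, 'c) module_scheme \<Rightarrow> 'a set \<Rightarrow> 'a set"
  where "gen_submodule K M S = \<Inter>{N. submodule N K M \<and> S \<subseteq> N}"

text \<open>The library quotient \<^const>\<open>FactRing\<close>, which forgets scalars, extended by the induced scalar
  multiplication. It serves both for quotients of modules (where only the additive part and the
  scalars matter, the multiplication fields being irrelevant) and for quotients of algebras.\<close>

definition quot_module :: "('k, 'a, 'c) module_scheme \<Rightarrow> 'a set \<Rightarrow> ('k, 'a set) module"
  where "quot_module M N =
    ring.extend (M Quot N) (module.fields (\<lambda>a A. \<Union>x\<in>A. N +>\<^bsub>M\<^esub> (a \<odot>\<^bsub>M\<^esub> x)))"

text \<open>The module of finitely supported functions \<open>S \<rightarrow> K\<close> (extended by zero outside \<open>S\<close>). As it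
  is only used as a module, its multiplication fields are left unspecified.\<close>

definition free_module :: "('k, 'm) ring_scheme \<Rightarrow> 'a set \<Rightarrow> ('k, 'a \<Rightarrow> 'k) module"
  where "free_module K S =
    \<lparr>carrier = {f. (\<forall>x. f x \<in> carrier K) \<and> (\<forall>x. x \<notin> S \<longrightarrow> f x = \<zero>\<^bsub>K\<^esub>) \<and> finite {x. f x \<noteq> \<zero>\<^bsub>K\<^esub>}},
     mult = undefined, one = undefined,
     zero = (\<lambda>_. \<zero>\<^bsub>K\<^esub>), add = (\<lambda>f g x. f x \<oplus>\<^bsub>K\<^esub> g x),
     smult = (\<lambda>a f x. a \<otimes>\<^bsub>K\<^esub> f x)\<rparr>"

definition delta :: "('k, 'm) ring_scheme \<Rightarrow> 'a \<Rightarrow> 'a \<Rightarrow> 'k"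
  where "delta K x = (\<lambda>y. if y = x then \<one>\<^bsub>K\<^esub> else \<zero>\<^bsub>K\<^esub>)"

definition is_basis :: "('k, 'm) ring_scheme \<Rightarrow> ('k, 'a, 'c) module_scheme \<Rightarrow> 'a set \<Rightarrow> bool"
  where "is_basis K M B \<longleftrightarrow> B \<subseteq> carrier M \<and>
    (\<forall>x\<in>carrier M. \<exists>!c. c \<in> carrier (free_module K B) \<and>
       x = (\<Oplus>\<^bsub>M\<^esub>b\<in>{b\<in>B. c b \<noteq> \<zero>\<^bsub>K\<^esub>}. c b \<odot>\<^bsub>M\<^esub> b))"

definition is_free :: "('k, 'm) ring_scheme \<Rightarrow> ('k, 'a, 'c) module_scheme \<Rightarrow> bool"
  where "is_free K M \<longleftrightarrow> (\<exists>B. is_basis K M B)"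


section \<open>Lie algebras over a commutative ring\<close>

text \<open>The locale \<^locale>\<open>module\<close> includes \<^term>\<open>cring K\<close>; the zero ring is allowed.\<close>

locale lie_algebra = module K g for K (structure) and g (structure) +
  fixes br :: "'b \<Rightarrow> 'b \<Rightarrow> 'b"
  assumes br_closed: "\<lbrakk>x \<in> carrier g; y \<in> carrier g\<rbrakk> \<Longrightarrow> br x y \<in> carrier g"
    and br_add_left: "\<lbrakk>x \<in> carrier g; y \<in> carrier g; z \<in> carrier g\<rbrakk>
      \<Longrightarrow> br (x \<oplus>\<^bsub>g\<^esub> y) z = br x z \<oplus>\<^bsub>g\<^esub> br y z"
    and br_add_right: "\<lbrakk>x \<in> carrier g; y \<in> carrier g; z \<in> carrier g\<rbrakk>
      \<Longrightarrow> br x (y \<oplus>\<^bsub>g\<^esub> z) = br x y \<oplus>\<^bsub>g\<^esub> br x z"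
    and br_smult_left: "\<lbrakk>a \<in> carrier K; x \<in> carrier g; y \<in> carrier g\<rbrakk>
      \<Longrightarrow> br (a \<odot>\<^bsub>g\<^esub> x) y = a \<odot>\<^bsub>g\<^esub> br x y"
    and br_smult_right: "\<lbrakk>a \<in> carrier K; x \<in> carrier g; y \<in> carrier g\<rbrakk>
      \<Longrightarrow> br x (a \<odot>\<^bsub>g\<^esub> y) = a \<odot>\<^bsub>g\<^esub> br x y"
    and br_self: "x \<in> carrier g \<Longrightarrow> br x x = \<zero>\<^bsub>g\<^esub>"
    and jacobi: "\<lbrakk>x \<in> carrier g; y \<in> carrier g; z \<in> carrier g\<rbrakk>
      \<Longrightarrow> br x (br y z) \<oplus>\<^bsub>g\<^esub> br y (br z x) \<oplus>\<^bsub>g\<^esub> br z (br x y) = \<zero>\<^bsub>g\<^esub>"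


section \<open>Tensor powers and the tensor algebra\<close>

text \<open>The \<open>n\<close>-th tensor power over \<open>K\<close> is the free module on \<open>n\<close>-tuples (lists of length \<open>n\<close>)
  modulo the relations of \<open>K\<close>-linearity in each slot.\<close>

definition tuples :: "('k, 'a, 'c) module_scheme \<Rightarrow> nat \<Rightarrow> 'a list set"
  where "tuples M n = {xs. length xs = n \<and> set xs \<subseteq> carrier M}"

abbreviation free_tuples ::
    "('k, 'm) ring_scheme \<Rightarrow> ('k, 'a, 'c) module_scheme \<Rightarrow> nat \<Rightarrow> ('k, 'a list \<Rightarrow> 'k) module"
  where "free_tuples K M n \<equiv> free_module K (tuples M n)"

definition multilinear_rels ::
    "('k, 'm) ring_scheme \<Rightarrow> ('k, 'a, 'c) module_scheme \<Rightarrow> nat \<Rightarrow> ('a list \<Rightarrow> 'k) set"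
  where "multilinear_rels K M n =
    {delta K (us @ (x \<oplus>\<^bsub>M\<^esub> y) # vs)
       \<ominus>\<^bsub>free_tuples K M n\<^esub> delta K (us @ x # vs) \<ominus>\<^bsub>free_tuples K M n\<^esub> delta K (us @ y # vs) | us x y vs.
       us @ x # vs \<in> tuples M n \<and> y \<in> carrier M}
    \<union> {delta K (us @ (a \<odot>\<^bsub>M\<^esub> x) # vs)
       \<ominus>\<^bsub>free_tuples K M n\<^esub> (a \<odot>\<^bsub>free_tuples K M n\<^esub> delta K (us @ x # vs)) | us a x vs.
       us @ x # vs \<in> tuples M n \<and> a \<in> carrier K}"

definition multilinear_submodule ::
    "('k, 'm) ring_scheme \<Rightarrow> ('k, 'a, 'c) module_scheme \<Rightarrow> nat \<Rightarrow> ('a list \<Rightarrow> 'k) set"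
  where "multilinear_submodule K M n = gen_submodule K (free_tuples K M n) (multilinear_rels K M n)"

definition tensor_power ::
    "('k, 'm) ring_scheme \<Rightarrow> ('k, 'a, 'c) module_scheme \<Rightarrow> nat \<Rightarrow> ('k, ('a list \<Rightarrow> 'k) set) module"
  where "tensor_power K M n = quot_module (free_tuples K M n) (multilinear_submodule K M n)"

text \<open>The pure tensor \<open>x\<^sub>1 \<otimes> \<dots> \<otimes> x\<^sub>n\<close> of the list \<open>[x\<^sub>1, \<dots>, x\<^sub>n]\<close>.\<close>

definition pure_tensor ::
    "('k, 'm) ring_scheme \<Rightarrow> ('k, 'a, 'c) module_scheme \<Rightarrow> 'a list \<Rightarrow> ('a list \<Rightarrow> 'k) set"
  where "pure_tensor K M xs =
    multilinear_submodule K M (length xs) +>\<^bsub>free_tuples K M (length xs)\<^esub> delta K xs"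

text \<open>The product \<open>M\<^sup>\<otimes>\<^sup>i \<times> M\<^sup>\<otimes>\<^sup>j \<rightarrow> M\<^sup>\<otimes>\<^sup>(\<^sup>i\<^sup>+\<^sup>j\<^sup>)\<close> induced by concatenation of tuples. On representatives
  it is the bilinear extension of concatenation, whose value at a tuple \<open>ws\<close> of length \<open>i + j\<close> only
  involves the splitting of \<open>ws\<close> after position \<open>i\<close>.\<close>

definition tensor_mult ::
    "('k, 'm) ring_scheme \<Rightarrow> ('k, 'a, 'c) module_scheme \<Rightarrow> nat \<Rightarrow> nat \<Rightarrow>
     ('a list \<Rightarrow> 'k) set \<Rightarrow> ('a list \<Rightarrow> 'k) set \<Rightarrow> ('a list \<Rightarrow> 'k) set"
  where "tensor_mult K M i j A B =
    (\<Union>f\<in>A. \<Union>h\<in>B. multilinear_submodule K M (i + j) +>\<^bsub>free_tuples K M (i + j)\<^esub>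
       (\<lambda>ws. f (take i ws) \<otimes>\<^bsub>K\<^esub> h (drop i ws)))"

text \<open>The direct sum of all tensor powers, with its graded product.\<close>

definition tensor_algebra ::
    "('k, 'm) ring_scheme \<Rightarrow> ('k, 'a, 'c) module_scheme \<Rightarrow> ('k, nat \<Rightarrow> ('a list \<Rightarrow> 'k) set) module"
  where "tensor_algebra K M =
    \<lparr>carrier = {t. (\<forall>n. t n \<in> carrier (tensor_power K M n)) \<and>
                   finite {n. t n \<noteq> \<zero>\<^bsub>tensor_power K M n\<^esub>}},
     mult = (\<lambda>s t n. \<Oplus>\<^bsub>tensor_power K M n\<^esub>i\<in>{..n}. tensor_mult K M i (n - i) (s i) (t (n - i))),
     one = (\<lambda>n. if n = 0 then pure_tensor K M [] else \<zero>\<^bsub>tensor_power K M n\<^esub>),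
     zero = (\<lambda>n. \<zero>\<^bsub>tensor_power K M n\<^esub>),
     add = (\<lambda>s t n. s n \<oplus>\<^bsub>tensor_power K M n\<^esub> t n),
     smult = (\<lambda>a t n. a \<odot>\<^bsub>tensor_power K M n\<^esub> t n)\<rparr>"

definition tensor_incl ::
    "('k, 'm) ring_scheme \<Rightarrow> ('k, 'a, 'c) module_scheme \<Rightarrow> nat \<Rightarrow> ('a list \<Rightarrow> 'k) set \<Rightarrow>
     nat \<Rightarrow> ('a list \<Rightarrow> 'k) set"
  where "tensor_incl K M n A = (\<lambda>j. if j = n then A else \<zero>\<^bsub>tensor_power K M j\<^esub>)"


section \<open>Symmetric powers\<close>

definition sym_submodule ::
    "('k, 'm) ring_scheme \<Rightarrow> ('k, 'a, 'c) module_scheme \<Rightarrow> nat \<Rightarrow> ('a list \<Rightarrow> 'k) set set"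
  where "sym_submodule K M n = gen_submodule K (tensor_power K M n)
    {pure_tensor K M xs \<ominus>\<^bsub>tensor_power K M n\<^esub> pure_tensor K M ys | xs ys.
       xs \<in> tuples M n \<and> mset ys = mset xs}"

definition sym_power ::
    "('k, 'm) ring_scheme \<Rightarrow> ('k, 'a, 'c) module_scheme \<Rightarrow> nat \<Rightarrow> ('k, ('a list \<Rightarrow> 'k) set set) module"
  where "sym_power K M n = quot_module (tensor_power K M n) (sym_submodule K M n)"


section \<open>The universal enveloping algebra, its filtration, and the natural map\<close>

definition lie_gen ::
    "('k, 'm) ring_scheme \<Rightarrow> ('k, 'a, 'c) module_scheme \<Rightarrow> 'a \<Rightarrow> nat \<Rightarrow> ('a list \<Rightarrow> 'k) set"
  where "lie_gen K g X = tensor_incl K g 1 (pure_tensor K g [X])"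

definition lie_ideal ::
    "('k, 'm) ring_scheme \<Rightarrow> ('k, 'a, 'c) module_scheme \<Rightarrow> ('a \<Rightarrow> 'a \<Rightarrow> 'a) \<Rightarrow>
     (nat \<Rightarrow> ('a list \<Rightarrow> 'k) set) set"
  where "lie_ideal K g br = (let T = tensor_algebra K g; \<iota> = lie_gen K g in
    Idl\<^bsub>T\<^esub> {\<iota> X \<otimes>\<^bsub>T\<^esub> \<iota> Y \<ominus>\<^bsub>T\<^esub> \<iota> Y \<otimes>\<^bsub>T\<^esub> \<iota> X \<ominus>\<^bsub>T\<^esub> \<iota> (br X Y) | X Y.
           X \<in> carrier g \<and> Y \<in> carrier g})"

definition env_algebra ::
    "('k, 'm) ring_scheme \<Rightarrow> ('k, 'a, 'c) module_scheme \<Rightarrow> ('a \<Rightarrow> 'a \<Rightarrow> 'a) \<Rightarrow>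
     ('k, (nat \<Rightarrow> ('a list \<Rightarrow> 'k) set) set) module"
  where "env_algebra K g br = quot_module (tensor_algebra K g) (lie_ideal K g br)"

definition env_proj ::
    "('k, 'm) ring_scheme \<Rightarrow> ('k, 'a, 'c) module_scheme \<Rightarrow> ('a \<Rightarrow> 'a \<Rightarrow> 'a) \<Rightarrow>
     (nat \<Rightarrow> ('a list \<Rightarrow> 'k) set) \<Rightarrow> (nat \<Rightarrow> ('a list \<Rightarrow> 'k) set) set"
  where "env_proj K g br t = lie_ideal K g br +>\<^bsub>tensor_algebra K g\<^esub> t"

text \<open>The filtration is indexed by integers: in degree \<open>-1\<close> only \<open>t = 0\<close> qualifies, so that this
  filtration step is zero.\<close>

definition env_filt ::
    "('k, 'm) ring_scheme \<Rightarrow> ('k, 'a, 'c) module_scheme \<Rightarrow> ('a \<Rightarrow> 'a \<Rightarrow> 'a) \<Rightarrow> int \<Rightarrow>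
     (nat \<Rightarrow> ('a list \<Rightarrow> 'k) set) set set"
  where "env_filt K g br n = env_proj K g br `
    {t \<in> carrier (tensor_algebra K g). \<forall>j. int j > n \<longrightarrow> t j = \<zero>\<^bsub>tensor_power K g j\<^esub>}"

definition env_gr ::
    "('k, 'm) ring_scheme \<Rightarrow> ('k, 'a, 'c) module_scheme \<Rightarrow> ('a \<Rightarrow> 'a \<Rightarrow> 'a) \<Rightarrow> nat \<Rightarrow>
     ('k, (nat \<Rightarrow> ('a list \<Rightarrow> 'k) set) set set) module"
  where "env_gr K g br n = quot_module
    ((env_algebra K g br)\<lparr>carrier := env_filt K g br (int n)\<rparr>) (env_filt K g br (int n - 1))"

text \<open>The map induced on the \<open>n\<close>-th symmetric power: an element \<open>Z\<close> is a coset of tensors, and all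
  \<open>A \<in> Z\<close> have the same class in the quotient of filtration steps, which is therefore the union
  below (the library's convention for induced operations, as in \<^const>\<open>rcoset_mult\<close>). In
  particular the class of \<open>x\<^sub>1 \<otimes> \<dots> \<otimes> x\<^sub>n\<close> goes to the class of its image in the enveloping algebra.
  Were the choice of \<open>A\<close> to matter, the union would not be a single coset.\<close>

definition pbw_map ::
    "('k, 'm) ring_scheme \<Rightarrow> ('k, 'a, 'c) module_scheme \<Rightarrow> ('a \<Rightarrow> 'a \<Rightarrow> 'a) \<Rightarrow> nat \<Rightarrow>
     ('a list \<Rightarrow> 'k) set set \<Rightarrow> (nat \<Rightarrow> ('a list \<Rightarrow> 'k) set) set set"
  where "pbw_map K g br n Z =
    (\<Union>A\<in>Z. env_filt K g br (int n - 1) +>\<^bsub>env_algebra K g br\<^esub> env_proj K g br (tensor_incl K g n A))"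

end

theory Submission
  imports Defs
begin

text \<open>The map is well defined because permuting the factors of a tensor changes its image in the
  enveloping algebra only by terms of lower degree. For injectivity, order a basis of \<open>g\<close> and let \<open>P\<close>
  be the free module on the monomials \<open>z\<^sub>S\<close> indexed by finite multisets \<open>S\<close> of basis elements. There is
  a representation of \<open>g\<close> on \<open>P\<close> raising degrees by at most one with \<open>x \<cdot> z\<^sub>S = z\<^bsub>x+S\<^esub>\<close> whenever \<open>x\<close> is
  at most every element of \<open>S\<close>. It extends to the tensor algebra and kills the ideal defining the
  enveloping algebra, while a sorted tensor applied to \<open>z\<^bsub>0\<^esub>\<close> gives the corresponding monomial. Modulo
  the symmetric relations every tensor \<open>A\<close> of degree \<open>n\<close> is a combination of sorted basis tensors; if
  the class of \<open>A\<close> has filtration degree less than \<open>n\<close>, then that combination applied to \<open>z\<^bsub>0\<^esub>\<close> is both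
  homogeneous of degree \<open>n\<close> and of degree less than \<open>n\<close>, hence zero.\<close>

section \<open>Linear maps, submodules and quotients\<close>

text \<open>On that module the action is forced: the relation x y = y x + [x, y] with y < x
  determines the product of x with a monomial that contains y. Two obstacles shape the proof. First,
  in y acting on the product of x with T, monomials as large as S = y + T occur, so the recursion is
  not visibly well founded. Second, the relation is imposed only when y is at most x and every
  element of the monomial; for all other pairs it has to be derived, and there the Jacobi identity
  enters (\<open>comm_delta\<close>). The comparison of kernels takes place in the tensor algebra
  rather than in iterated quotients: \<open>JL n\<close> is the preimage there of the filtration
  step below degree n, and the core of the theorem is that \<open>incl n A\<close> lies in
  \<open>JL n\<close> exactly when \<open>A\<close> lies in \<open>Sym n\<close>.\<close>

definition linmap ::
    "('k, 'm) ring_scheme \<Rightarrow> ('k, 'a, 'c) module_scheme \<Rightarrow> ('k, 'b, 'd) module_scheme \<Rightarrow> ('a \<Rightarrow> 'b) set"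
  where "linmap K M N =
    {h. (\<forall>x\<in>carrier M. h x \<in> carrier N) \<and>
        (\<forall>x\<in>carrier M. \<forall>y\<in>carrier M. h (x \<oplus>\<^bsub>M\<^esub> y) = h x \<oplus>\<^bsub>N\<^esub> h y) \<and>
        (\<forall>a\<in>carrier K. \<forall>x\<in>carrier M. h (a \<odot>\<^bsub>M\<^esub> x) = a \<odot>\<^bsub>N\<^esub> h x)}"

lemma linmapI:
  assumes "\<And>x. x \<in> carrier M \<Longrightarrow> h x \<in> carrier N"
    and "\<And>x y. \<lbrakk>x \<in> carrier M; y \<in> carrier M\<rbrakk> \<Longrightarrow> h (x \<oplus>\<^bsub>M\<^esub> y) = h x \<oplus>\<^bsub>N\<^esub> h y"
    and "\<And>a x. \<lbrakk>a \<in> carrier K; x \<in> carrier M\<rbrakk> \<Longrightarrow> h (a \<odot>\<^bsub>M\<^esub> x) = a \<odot>\<^bsub>N\<^esub> h x"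
  shows "h \<in> linmap K M N"
  using assms by (simp add: linmap_def)

lemma linmap_closed: "\<lbrakk>h \<in> linmap K M N; x \<in> carrier M\<rbrakk> \<Longrightarrow> h x \<in> carrier N"
  and linmap_add: "\<lbrakk>h \<in> linmap K M N; x \<in> carrier M; y \<in> carrier M\<rbrakk>
    \<Longrightarrow> h (x \<oplus>\<^bsub>M\<^esub> y) = h x \<oplus>\<^bsub>N\<^esub> h y"
  and linmap_smult: "\<lbrakk>h \<in> linmap K M N; a \<in> carrier K; x \<in> carrier M\<rbrakk>
    \<Longrightarrow> h (a \<odot>\<^bsub>M\<^esub> x) = a \<odot>\<^bsub>N\<^esub> h x"
  by (simp_all add: linmap_def)

lemma linmap_comp: "\<lbrakk>h \<in> linmap K L M; k \<in> linmap K M N\<rbrakk> \<Longrightarrow> (\<lambda>x. k (h x)) \<in> linmap K L N"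
  by (simp add: linmap_def)

lemma linmap_zero:
  assumes "module K M" "module K N" "h \<in> linmap K M N"
  shows "h \<zero>\<^bsub>M\<^esub> = \<zero>\<^bsub>N\<^esub>"
proof -
  interpret M: module K M by fact
  interpret N: module K N by fact
  have "h (\<zero>\<^bsub>K\<^esub> \<odot>\<^bsub>M\<^esub> \<zero>\<^bsub>M\<^esub>) = \<zero>\<^bsub>K\<^esub> \<odot>\<^bsub>N\<^esub> h \<zero>\<^bsub>M\<^esub>"
    using assms(3) by (intro linmap_smult) auto
  then show ?thesis using linmap_closed[OF assms(3)] by simp
qed

lemma (in abelian_group) diff_eq_zero_iff:
  assumes "x \<in> carrier G" "y \<in> carrier G"
  shows "x \<ominus> y = \<zero> \<longleftrightarrow> x = y"
  using assms add.inv_solve_right[of "\<zero>" x y] by (auto simp: a_minus_def)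

lemma (in abelian_group) diff_zero: "x \<in> carrier G \<Longrightarrow> x \<ominus> \<zero> = x"
  by (simp add: a_minus_def)

lemma (in abelian_group) diff_self: "x \<in> carrier G \<Longrightarrow> x \<ominus> x = \<zero>"
  by (simp add: a_minus_def r_neg)

lemma (in abelian_group) add_diff_self:
  "\<lbrakk>x \<in> carrier G; y \<in> carrier G\<rbrakk> \<Longrightarrow> x \<oplus> (y \<ominus> x) = y"
  by (simp add: a_minus_def a_lcomm[of x y] r_neg)

lemma (in abelian_group) add_diff_diff:
  "\<lbrakk>x \<in> carrier G; y \<in> carrier G\<rbrakk> \<Longrightarrow> x \<oplus> y \<ominus> x \<ominus> y = \<zero>"
  by (simp add: a_minus_def a_assoc r_neg1 r_neg a_comm[of x y])

text \<open>Negatives become scalar multiples, so maps and subsets that respect sums and scalars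
  respect differences without a separate condition.\<close>

lemma (in module) neg_eq_smult: "x \<in> carrier M \<Longrightarrow> \<ominus>\<^bsub>M\<^esub> x = (\<ominus> \<one>) \<odot>\<^bsub>M\<^esub> x"
  by (simp add: smult_l_minus)

lemma linmap_neg:
  assumes "module K M" "module K N" "h \<in> linmap K M N" "x \<in> carrier M"
  shows "h (\<ominus>\<^bsub>M\<^esub> x) = \<ominus>\<^bsub>N\<^esub> h x"
proof -
  interpret M: module K M by fact
  interpret N: module K N by fact
  show ?thesis
    using assms(3,4) linmap_closed[OF assms(3,4)]
    by (simp add: M.neg_eq_smult N.neg_eq_smult linmap_smult del: N.a_inv_closed)
qed

lemma linmap_diff:
  assumes "module K M" "module K N" "h \<in> linmap K M N" "x \<in> carrier M" "y \<in> carrier M"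
  shows "h (x \<ominus>\<^bsub>M\<^esub> y) = h x \<ominus>\<^bsub>N\<^esub> h y"
proof -
  interpret M: module K M by fact
  show ?thesis
    using assms by (simp add: a_minus_def linmap_add linmap_neg)
qed

lemma (in module) submoduleI':
  assumes "N \<subseteq> carrier M" "\<zero>\<^bsub>M\<^esub> \<in> N"
    and "\<And>x y. \<lbrakk>x \<in> N; y \<in> N\<rbrakk> \<Longrightarrow> x \<oplus>\<^bsub>M\<^esub> y \<in> N"
    and "\<And>a x. \<lbrakk>a \<in> carrier R; x \<in> N\<rbrakk> \<Longrightarrow> a \<odot>\<^bsub>M\<^esub> x \<in> N"
  shows "submodule N R M"
proof (rule submoduleI)
  fix x assume "x \<in> N"
  then show "\<ominus>\<^bsub>M\<^esub> x \<in> N"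
    using assms(1) assms(4)[of "\<ominus> \<one>" x] by (auto simp: neg_eq_smult)
qed (use assms in auto)

lemma (in module) submodule_facts:
  assumes "submodule N R M"
  shows "\<zero>\<^bsub>M\<^esub> \<in> N"
    and "x \<in> N \<Longrightarrow> x \<in> carrier M"
    and "\<lbrakk>x \<in> N; y \<in> N\<rbrakk> \<Longrightarrow> x \<oplus>\<^bsub>M\<^esub> y \<in> N"
    and "\<lbrakk>x \<in> N; y \<in> N\<rbrakk> \<Longrightarrow> x \<ominus>\<^bsub>M\<^esub> y \<in> N"
    and "x \<in> N \<Longrightarrow> \<ominus>\<^bsub>M\<^esub> x \<in> N"
    and "\<lbrakk>a \<in> carrier R; x \<in> N\<rbrakk> \<Longrightarrow> a \<odot>\<^bsub>M\<^esub> x \<in> N"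
  using submoduleE[OF assms] subgroup.one_closed[OF submodule.axioms(1)[OF assms]]
  by (auto simp: a_minus_def)

lemma (in module) submodule_Inter:
  assumes "\<And>N. N \<in> \<N> \<Longrightarrow> submodule N R M" "\<N> \<noteq> {}"
  shows "submodule (\<Inter>\<N>) R M"
proof (rule submoduleI')
  obtain N where "N \<in> \<N>" using assms(2) by blast
  then show "\<Inter>\<N> \<subseteq> carrier M" using submodule_facts(2)[OF assms(1)] by blast
qed (use submodule_facts[OF assms(1)] in auto)

lemma (in module) gen_submodule_submodule:
  assumes "S \<subseteq> carrier M" shows "submodule (gen_submodule R M S) R M"
  unfolding gen_submodule_def
  by (rule submodule_Inter) (use assms carrier_is_submodule in auto)

lemma gen_submodule_incl: "x \<in> S \<Longrightarrow> x \<in> gen_submodule K M S"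
  by (auto simp: gen_submodule_def)

lemma gen_submodule_minimal: "\<lbrakk>submodule N K M; S \<subseteq> N\<rbrakk> \<Longrightarrow> gen_submodule K M S \<subseteq> N"
  by (auto simp: gen_submodule_def)

lemma submodule_vimage:
  assumes "module K M" "module K N" "h \<in> linmap K M N" "submodule S K N"
  shows "submodule {x \<in> carrier M. h x \<in> S} K M"
proof -
  interpret M: module K M by fact
  interpret N: module K N by fact
  note S = N.submodule_facts[OF assms(4)]
  show ?thesis
    by (rule M.submoduleI')
      (use S linmap_zero[OF assms(1,2,3)] assms(3) in \<open>auto simp: linmap_add linmap_smult\<close>)
qed

lemma submodule_image:
  assumes "module K M" "module K N" "h \<in> linmap K M N" "submodule S K M"
  shows "submodule (h ` S) K N"
proof -
  interpret M: module K M by fact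
  interpret N: module K N by fact
  note S = M.submodule_facts[OF assms(4)]
  show ?thesis
  proof (rule N.submoduleI')
    show "h ` S \<subseteq> carrier N" using S assms(3) by (auto simp: linmap_closed)
    show "\<zero>\<^bsub>N\<^esub> \<in> h ` S" using S linmap_zero[OF assms(1,2,3)] by force
  next
    fix x y assume "x \<in> h ` S" "y \<in> h ` S"
    then obtain u v where "u \<in> S" "v \<in> S" "x = h u" "y = h v" by auto
    then show "x \<oplus>\<^bsub>N\<^esub> y \<in> h ` S"
      using S(2,3) by (intro image_eqI[of _ h "u \<oplus>\<^bsub>M\<^esub> v"]) (simp_all add: linmap_add[OF assms(3)])
  next
    fix a x assume "a \<in> carrier K" "x \<in> h ` S"
    then obtain u where "a \<in> carrier K" "u \<in> S" "x = h u" by auto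
    then show "a \<odot>\<^bsub>N\<^esub> x \<in> h ` S"
      using S(2,6) by (intro image_eqI[of _ h "a \<odot>\<^bsub>M\<^esub> u"]) (simp_all add: linmap_smult[OF assms(3)])
  qed
qed

lemma (in module) zero_submodule: "submodule {\<zero>\<^bsub>M\<^esub>} R M"
  by (rule submoduleI') auto

text \<open>Gives access to the library's additive coset calculus, on which \<open>FactRing\<close>
  rests.\<close>

lemma (in module) abelian_subgroup_of_submodule:
  "submodule N R M \<Longrightarrow> abelian_subgroup N M"
  using submodule.axioms(1) abelian_subgroupI3 additive_subgroupI M.abelian_group_axioms
  by metis

section \<open>Cosets and quotient modules\<close>

context module
begin

context
  fixes N assumes N: "submodule N R M"
begin

interpretation NN: abelian_subgroup N M
  using N by (rule abelian_subgroup_of_submodule)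

lemma coset_eq_iff:
  assumes "x \<in> carrier M" "y \<in> carrier M"
  shows "N +>\<^bsub>M\<^esub> x = N +>\<^bsub>M\<^esub> y \<longleftrightarrow> x \<ominus>\<^bsub>M\<^esub> y \<in> N"
proof -
  have "N +>\<^bsub>M\<^esub> x = N +>\<^bsub>M\<^esub> y \<longleftrightarrow> x \<in> N +>\<^bsub>M\<^esub> y"
    using NN.a_repr_independence'[OF _ assms(2)] NN.a_repr_independenceD[OF assms(1)] by blast
  then show ?thesis
    using assms by (simp add: NN.a_rcos_module a_minus_def)
qed

lemma mem_coset_iff:
  assumes "x \<in> carrier M"
  shows "y \<in> N +>\<^bsub>M\<^esub> x \<longleftrightarrow> y \<in> carrier M \<and> N +>\<^bsub>M\<^esub> y = N +>\<^bsub>M\<^esub> x"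
proof
  assume y: "y \<in> N +>\<^bsub>M\<^esub> x"
  show "y \<in> carrier M \<and> N +>\<^bsub>M\<^esub> y = N +>\<^bsub>M\<^esub> x"
    using NN.a_elemrcos_carrier[OF assms y] NN.a_repr_independence'[OF y assms] by simp
next
  assume y: "y \<in> carrier M \<and> N +>\<^bsub>M\<^esub> y = N +>\<^bsub>M\<^esub> x"
  show "y \<in> N +>\<^bsub>M\<^esub> x"
    by (rule NN.a_repr_independenceD[OF conjunct1[OF y] conjunct2[OF y, symmetric]])
qed

lemma coset_self: "x \<in> carrier M \<Longrightarrow> x \<in> N +>\<^bsub>M\<^esub> x"
  by (rule NN.a_rcos_self)

lemma quot_carrier: "carrier (quot_module M N) = (\<lambda>x. N +>\<^bsub>M\<^esub> x) ` carrier M"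
  by (auto simp: quot_module_def ring.defs module.defs FactRing_def A_RCOSETS_def' a_r_coset_def')

lemma quot_carrierE:
  assumes "X \<in> carrier (quot_module M N)"
  obtains x where "x \<in> carrier M" "X = N +>\<^bsub>M\<^esub> x"
  using assms by (auto simp: quot_carrier)

lemma quot_zero: "\<zero>\<^bsub>quot_module M N\<^esub> = N"
  by (simp add: quot_module_def ring.defs module.defs FactRing_def)

lemma quot_add:
  assumes "x \<in> carrier M" "y \<in> carrier M"
  shows "(N +>\<^bsub>M\<^esub> x) \<oplus>\<^bsub>quot_module M N\<^esub> (N +>\<^bsub>M\<^esub> y) = N +>\<^bsub>M\<^esub> (x \<oplus>\<^bsub>M\<^esub> y)"
  using assms by (simp add: quot_module_def ring.defs module.defs FactRing_def NN.a_rcos_sum)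

lemma quot_smult:
  assumes "a \<in> carrier R" "x \<in> carrier M"
  shows "a \<odot>\<^bsub>quot_module M N\<^esub> (N +>\<^bsub>M\<^esub> x) = N +>\<^bsub>M\<^esub> (a \<odot>\<^bsub>M\<^esub> x)"
proof -
  have *: "N +>\<^bsub>M\<^esub> (a \<odot>\<^bsub>M\<^esub> y) = N +>\<^bsub>M\<^esub> (a \<odot>\<^bsub>M\<^esub> x)" if "y \<in> N +>\<^bsub>M\<^esub> x" for y
  proof -
    from that have y: "y \<in> carrier M" "y \<ominus>\<^bsub>M\<^esub> x \<in> N"
      using mem_coset_iff[OF assms(2)] coset_eq_iff[OF _ assms(2)] by auto
    then have "a \<odot>\<^bsub>M\<^esub> (y \<ominus>\<^bsub>M\<^esub> x) \<in> N" using N assms submodule_facts(6) by blast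
    then show ?thesis
      using assms y by (simp add: coset_eq_iff a_minus_def smult_r_distr smult_r_minus)
  qed
  have "a \<odot>\<^bsub>quot_module M N\<^esub> (N +>\<^bsub>M\<^esub> x) = (\<Union>y\<in>N +>\<^bsub>M\<^esub> x. N +>\<^bsub>M\<^esub> (a \<odot>\<^bsub>M\<^esub> y))"
    by (simp add: quot_module_def ring.defs module.defs)
  \<comment> \<open>The induced scalar multiplication is a union over representatives; by
    \<open>*\<close> all its members are one and the same coset, and the index set contains
    \<open>x\<close>.\<close>
  also have "\<dots> = N +>\<^bsub>M\<^esub> (a \<odot>\<^bsub>M\<^esub> x)"
    using coset_self[OF assms(2)] by (intro SUP_eq_const[OF _ *]) auto
  finally show ?thesis .
qed

lemma coset_zero_iff: "x \<in> carrier M \<Longrightarrow> N +>\<^bsub>M\<^esub> x = \<zero>\<^bsub>quot_module M N\<^esub> \<longleftrightarrow> x \<in> N"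
  using coset_eq_iff[of x "\<zero>\<^bsub>M\<^esub>"] M.a_coset_add_zero[of N] submoduleE(1)[OF N]
  by (simp add: quot_zero M.diff_zero)

lemma quot_is_module: "module R (quot_module M N)"
proof -
  let ?Q = "quot_module M N"
  have c: "N +>\<^bsub>M\<^esub> x \<in> carrier ?Q" if "x \<in> carrier M" for x
    using that by (simp add: quot_carrier)
  have z: "\<zero>\<^bsub>?Q\<^esub> = N +>\<^bsub>M\<^esub> \<zero>\<^bsub>M\<^esub>"
    using coset_zero_iff[of "\<zero>\<^bsub>M\<^esub>"] by simp
  have "abelian_group ?Q"
  proof (rule abelian_groupI)
    fix X assume "X \<in> carrier ?Q"
    then obtain x where x: "x \<in> carrier M" "X = N +>\<^bsub>M\<^esub> x" by (rule quot_carrierE)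
    then have "(N +>\<^bsub>M\<^esub> (\<ominus>\<^bsub>M\<^esub> x)) \<oplus>\<^bsub>?Q\<^esub> X = \<zero>\<^bsub>?Q\<^esub>"
      by (simp add: quot_add z M.l_neg)
    with c x show "\<exists>Y\<in>carrier ?Q. Y \<oplus>\<^bsub>?Q\<^esub> X = \<zero>\<^bsub>?Q\<^esub>" by blast
  next
    fix X Y assume "X \<in> carrier ?Q" "Y \<in> carrier ?Q"
    then show "X \<oplus>\<^bsub>?Q\<^esub> Y = Y \<oplus>\<^bsub>?Q\<^esub> X"
      by (elim quot_carrierE) (simp add: quot_add M.a_comm)
  qed (auto elim!: quot_carrierE simp: quot_add c z M.a_assoc)
  then show ?thesis
    by (intro moduleI)
      (auto elim!: quot_carrierE simp: quot_add quot_smult c smult_l_distr smult_r_distr smult_assoc1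
        R.is_cring)
qed

lemma proj_linmap: "(\<lambda>x. N +>\<^bsub>M\<^esub> x) \<in> linmap R M (quot_module M N)"
  by (rule linmapI) (auto simp: quot_carrier quot_add quot_smult)

lemma quot_lift:
  assumes "module R L" "h \<in> linmap R M L" "\<And>x. x \<in> N \<Longrightarrow> h x = \<zero>\<^bsub>L\<^esub>"
  obtains h' where "h' \<in> linmap R (quot_module M N) L"
    "\<And>x. x \<in> carrier M \<Longrightarrow> h' (N +>\<^bsub>M\<^esub> x) = h x"
proof -
  interpret L: module R L by fact
  \<comment> \<open>Any member of the coset will do: two members differ by an element of
    \<open>N\<close>, where \<open>h\<close> vanishes.\<close>
  define h' where "h' X = h (SOME x. x \<in> X)" for X
  have h': "h' (N +>\<^bsub>M\<^esub> x) = h x" if x: "x \<in> carrier M" for x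
  proof -
    have "(SOME y. y \<in> N +>\<^bsub>M\<^esub> x) \<in> N +>\<^bsub>M\<^esub> x" (is "?y \<in> _")
      using coset_self[OF x] by (rule someI)
    then have y: "?y \<in> carrier M" "?y \<ominus>\<^bsub>M\<^esub> x \<in> N"
      using mem_coset_iff[OF x] coset_eq_iff[OF _ x] by auto
    then have "h ?y \<ominus>\<^bsub>L\<^esub> h x = \<zero>\<^bsub>L\<^esub>"
      using assms(3) linmap_diff[OF module_axioms assms(1,2) y(1) x] by simp
    then show ?thesis
      unfolding h'_def using y x by (simp add: L.diff_eq_zero_iff linmap_closed[OF assms(2)])
  qed
  have "h' \<in> linmap R (quot_module M N) L"
    by (rule linmapI)
      (auto elim!: quot_carrierE simp: quot_add quot_smult h' linmap_closed[OF assms(2)]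
        linmap_add[OF assms(2)] linmap_smult[OF assms(2)])
  with h' that show thesis by blast
qed

end

end

lemma linmap_plus:
  assumes "module K M" "module K N" "h \<in> linmap K M N" "k \<in> linmap K M N"
  shows "(\<lambda>x. h x \<oplus>\<^bsub>N\<^esub> k x) \<in> linmap K M N"
proof -
  interpret N: module K N by fact
  show ?thesis
    by (rule linmapI)
      (simp_all add: linmap_closed[OF assms(3)] linmap_closed[OF assms(4)] linmap_add[OF assms(3)]
        linmap_add[OF assms(4)] linmap_smult[OF assms(3)] linmap_smult[OF assms(4)]
        N.smult_r_distr N.a_ac)
qed

lemma linmap_scale:
  assumes "module K N" "h \<in> linmap K M N" "a \<in> carrier K"
  shows "(\<lambda>x. a \<odot>\<^bsub>N\<^esub> h x) \<in> linmap K M N"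
proof -
  interpret N: module K N by fact
  have "a \<odot>\<^bsub>N\<^esub> (b \<odot>\<^bsub>N\<^esub> x) = b \<odot>\<^bsub>N\<^esub> (a \<odot>\<^bsub>N\<^esub> x)" if "b \<in> carrier K" "x \<in> carrier N" for b x
    using that assms(3) by (simp flip: N.smult_assoc1 add: N.R.m_comm)
  then show ?thesis
    using assms(3) by (intro linmapI)
      (simp_all add: linmap_closed[OF assms(2)] linmap_add[OF assms(2)] linmap_smult[OF assms(2)]
        N.smult_r_distr)
qed

text \<open>The candidate \<open>k\<close> is kept apart from \<open>h\<close> because
  \<open>pbw_map\<close> is given as a union over a coset. Only its values on cosets are prescribed,
  which is all that \<open>module_iso\<close> looks at.\<close>

lemma first_isomorphism:
  assumes "module K M" "module K N" "submodule S K M" "h \<in> linmap K M N"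
    and ker: "\<And>x. x \<in> carrier M \<Longrightarrow> h x = \<zero>\<^bsub>N\<^esub> \<longleftrightarrow> x \<in> S"
    and surj: "h ` carrier M = carrier N"
    and k: "\<And>x. x \<in> carrier M \<Longrightarrow> k (S +>\<^bsub>M\<^esub> x) = h x"
  shows "k \<in> module_iso K (quot_module M S) N"
proof -
  interpret M: module K M by fact
  interpret N: module K N by fact
  note S = assms(3) and h = assms(4)
  note qE = M.quot_carrierE[OF S]
  have "inj_on k (carrier (quot_module M S))"
  proof (rule inj_onI)
    fix X Y assume "X \<in> carrier (quot_module M S)" "Y \<in> carrier (quot_module M S)" and eq: "k X = k Y"
    then obtain x y where x: "x \<in> carrier M" "X = S +>\<^bsub>M\<^esub> x" and y: "y \<in> carrier M" "Y = S +>\<^bsub>M\<^esub> y"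
      by (elim qE)
    then have "h (x \<ominus>\<^bsub>M\<^esub> y) = \<zero>\<^bsub>N\<^esub>"
      using eq by (simp add: k linmap_diff[OF assms(1,2) h] N.M.diff_self linmap_closed[OF h])
    then show "X = Y" using x y ker by (simp add: M.coset_eq_iff[OF S])
  qed
  moreover have "k ` carrier (quot_module M S) = carrier N"
    using k surj by (auto simp: M.quot_carrier[OF S] image_image)
  ultimately show ?thesis
    unfolding module_iso_def bij_betw_def
    by (auto elim!: qE simp: M.quot_add[OF S] M.quot_smult[OF S] k linmap_add[OF h] linmap_smult[OF h])
qed

section \<open>Direct sums and free modules\<close>

lemma (in abelian_monoid) finsum_superset:
  assumes "finite A" "B \<subseteq> A" "\<And>i. i \<in> A - B \<Longrightarrow> f i = \<zero>" "f \<in> B \<rightarrow> carrier G"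
  shows "finsum G f A = finsum G f B"
  by (rule add.finprod_mono_neutral_cong_right) (use assms in auto)

lemma (in abelian_monoid) finsum_single:
  assumes "finite A" "i \<in> A" "\<And>j. \<lbrakk>j \<in> A; j \<noteq> i\<rbrakk> \<Longrightarrow> f j = \<zero>" "f i \<in> carrier G"
  shows "finsum G f A = f i"
  using finsum_superset[of A "{i}" f] assms by (auto simp: finsum_insert[of "{}" i f, simplified])

text \<open>One locale covers both the tensor algebra, with summands \<open>TP n\<close>, and free
  modules, with summands \<open>K\<close> or zero. Only the additive and scalar structure of
  \<open>X\<close> is prescribed, so the multiplication of the tensor algebra can be treated
  afterwards.\<close>

locale direct_sum =
  fixes K :: "('k, 'm) ring_scheme" and D :: "'i \<Rightarrow> ('k, 'x, 'd) module_scheme"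
    and X :: "('k, 'i \<Rightarrow> 'x, 'e) module_scheme"
  assumes D_module: "module K (D i)"
    and carrier_X: "carrier X =
      {t. (\<forall>i. t i \<in> carrier (D i)) \<and> finite {i. t i \<noteq> \<zero>\<^bsub>D i\<^esub>}}"
    and zero_X: "\<zero>\<^bsub>X\<^esub> = (\<lambda>i. \<zero>\<^bsub>D i\<^esub>)"
    and add_X: "s \<oplus>\<^bsub>X\<^esub> t = (\<lambda>i. s i \<oplus>\<^bsub>D i\<^esub> t i)"
    and smult_X: "a \<odot>\<^bsub>X\<^esub> t = (\<lambda>i. a \<odot>\<^bsub>D i\<^esub> t i)"
begin

sublocale D: module K "D i" for i
  by (rule D_module)

lemma add_closed: "\<lbrakk>s \<in> carrier X; t \<in> carrier X\<rbrakk> \<Longrightarrow> s \<oplus>\<^bsub>X\<^esub> t \<in> carrier X"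
  unfolding carrier_X add_X
  by (auto intro: finite_subset[of _ "{i. s i \<noteq> \<zero>\<^bsub>D i\<^esub>} \<union> {i. t i \<noteq> \<zero>\<^bsub>D i\<^esub>}"])

lemma smult_closed: "\<lbrakk>a \<in> carrier K; t \<in> carrier X\<rbrakk> \<Longrightarrow> a \<odot>\<^bsub>X\<^esub> t \<in> carrier X"
  unfolding carrier_X smult_X by (auto intro: finite_subset[of _ "{i. t i \<noteq> \<zero>\<^bsub>D i\<^esub>}"])

lemma zero_closed: "\<zero>\<^bsub>X\<^esub> \<in> carrier X"
  by (simp add: carrier_X zero_X)

sublocale X: module K X
proof (rule moduleI)
  show "cring K" by (rule D.R.is_cring)
  show "abelian_group X"
  proof (rule abelian_groupI)
    fix t assume t: "t \<in> carrier X"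
    then have "(\<ominus>\<^bsub>K\<^esub> \<one>\<^bsub>K\<^esub>) \<odot>\<^bsub>X\<^esub> t \<oplus>\<^bsub>X\<^esub> t = \<zero>\<^bsub>X\<^esub>"
      by (auto simp: add_X smult_X zero_X carrier_X D.smult_l_minus D.l_neg)
    with t show "\<exists>y\<in>carrier X. y \<oplus>\<^bsub>X\<^esub> t = \<zero>\<^bsub>X\<^esub>"
      by (meson D.R.a_inv_closed D.R.one_closed smult_closed)
  qed (auto simp: add_closed zero_closed,
      auto simp: carrier_X add_X zero_X D.M.a_ac)
qed (auto simp: smult_closed, auto simp: carrier_X add_X smult_X D.smult_l_distr D.smult_r_distr D.smult_assoc1)

definition single :: "'i \<Rightarrow> 'x \<Rightarrow> 'i \<Rightarrow> 'x"
  where "single i a = (\<lambda>j. if j = i then a else \<zero>\<^bsub>D j\<^esub>)"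

lemma single_linmap: "single i \<in> linmap K (D i) X"
  by (rule linmapI) (auto simp: carrier_X add_X smult_X single_def)

lemma single_closed: "a \<in> carrier (D i) \<Longrightarrow> single i a \<in> carrier X"
  using single_linmap by (rule linmap_closed)

text \<open>The vector is rebuilt from its components one index at a time. The last case remembers
  that \<open>a\<close> is the actual component \<open>t i\<close>, which is what later allows
  degree bounds to be read off from the support of \<open>t\<close>.\<close>

lemma direct_sum_induct [consumes 1, case_names zero add single]:
  assumes "t \<in> carrier X"
    and zero: "Q \<zero>\<^bsub>X\<^esub>"
    and add: "\<And>s t. \<lbrakk>s \<in> carrier X; t \<in> carrier X; Q s; Q t\<rbrakk> \<Longrightarrow> Q (s \<oplus>\<^bsub>X\<^esub> t)"
    and single: "\<And>i a. \<lbrakk>a \<in> carrier (D i); t i = a\<rbrakk> \<Longrightarrow> Q (single i a)"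
  shows "Q t"
proof -
  have "Q (\<lambda>i. if i \<in> A then t i else \<zero>\<^bsub>D i\<^esub>) \<and> (\<lambda>i. if i \<in> A then t i else \<zero>\<^bsub>D i\<^esub>) \<in> carrier X"
    if "finite A" for A
    using that
  proof induction
    case empty
    then show ?case using zero zero_closed by (simp add: zero_X)
  next
    case (insert i A)
    have t: "t j \<in> carrier (D j)" for j using assms(1) by (simp add: carrier_X)
    have *: "(\<lambda>j. if j \<in> insert i A then t j else \<zero>\<^bsub>D j\<^esub>)
        = single i (t i) \<oplus>\<^bsub>X\<^esub> (\<lambda>j. if j \<in> A then t j else \<zero>\<^bsub>D j\<^esub>)"
      using insert.hyps t by (auto simp: add_X single_def)
    show ?case
      unfolding * using insert.IH t by (auto intro: add single single_closed add_closed)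
  qed
  moreover have "(\<lambda>i. if i \<in> {i. t i \<noteq> \<zero>\<^bsub>D i\<^esub>} then t i else \<zero>\<^bsub>D i\<^esub>) = t" by auto
  moreover have "finite {i. t i \<noteq> \<zero>\<^bsub>D i\<^esub>}" using assms(1) by (simp add: carrier_X)
  ultimately show ?thesis by metis
qed

lemma direct_sum_ext:
  fixes M :: "('k, 'b, 'e2) module_scheme"
  assumes "module K M" and \<phi>: "\<And>i. \<phi> i \<in> linmap K (D i) M"
  shows "(\<lambda>t. \<Oplus>\<^bsub>M\<^esub>i\<in>{i. t i \<noteq> \<zero>\<^bsub>D i\<^esub>}. \<phi> i (t i)) \<in> linmap K X M" (is "?h \<in> _")
    and "a \<in> carrier (D i) \<Longrightarrow> (\<Oplus>\<^bsub>M\<^esub>j\<in>{j. single i a j \<noteq> \<zero>\<^bsub>D j\<^esub>}. \<phi> j (single i a j)) = \<phi> i a"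
proof -
  interpret M: module K M by fact
  have z: "\<phi> i \<zero>\<^bsub>D i\<^esub> = \<zero>\<^bsub>M\<^esub>" for i
    by (rule linmap_zero[OF D_module assms(1) \<phi>])
  have c: "\<phi> i (t i) \<in> carrier M" if "t \<in> carrier X" for t i
    using that linmap_closed[OF \<phi>] by (simp add: carrier_X)
  \<comment> \<open>The support of a sum may be smaller than the union of the supports, and scalars
    may shrink a support. All sums are therefore moved to a common finite superset before they are
    compared.\<close>
  have sup: "?h t = (\<Oplus>\<^bsub>M\<^esub>i\<in>A. \<phi> i (t i))"
    if "t \<in> carrier X" "finite A" "{i. t i \<noteq> \<zero>\<^bsub>D i\<^esub>} \<subseteq> A" for t A
    by (rule M.finsum_superset[symmetric]) (use that z c in auto)
  show "?h \<in> linmap K X M"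
  proof (rule linmapI)
    fix t assume "t \<in> carrier X"
    then show "?h t \<in> carrier M" using c by (intro M.finsum_closed) auto
  next
    fix s t assume st: "s \<in> carrier X" "t \<in> carrier X"
    define A where "A = {i. s i \<noteq> \<zero>\<^bsub>D i\<^esub>} \<union> {i. t i \<noteq> \<zero>\<^bsub>D i\<^esub>}"
    have A: "finite A" using st by (auto simp: A_def carrier_X)
    have sA: "{i. s i \<noteq> \<zero>\<^bsub>D i\<^esub>} \<subseteq> A" and tA: "{i. t i \<noteq> \<zero>\<^bsub>D i\<^esub>} \<subseteq> A"
      and stA: "{i. (s \<oplus>\<^bsub>X\<^esub> t) i \<noteq> \<zero>\<^bsub>D i\<^esub>} \<subseteq> A"
      by (auto simp: A_def add_X)
    have "(\<Oplus>\<^bsub>M\<^esub>i\<in>A. \<phi> i ((s \<oplus>\<^bsub>X\<^esub> t) i)) = (\<Oplus>\<^bsub>M\<^esub>i\<in>A. \<phi> i (s i) \<oplus>\<^bsub>M\<^esub> \<phi> i (t i))"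
      using st by (intro M.finsum_cong') (auto simp: add_X carrier_X linmap_add[OF \<phi>] linmap_closed[OF \<phi>])
    also have "\<dots> = (\<Oplus>\<^bsub>M\<^esub>i\<in>A. \<phi> i (s i)) \<oplus>\<^bsub>M\<^esub> (\<Oplus>\<^bsub>M\<^esub>i\<in>A. \<phi> i (t i))"
      using st c by (intro M.finsum_addf) auto
    finally show "?h (s \<oplus>\<^bsub>X\<^esub> t) = ?h s \<oplus>\<^bsub>M\<^esub> ?h t"
      unfolding sup[OF add_closed[OF st] A stA] sup[OF st(1) A sA] sup[OF st(2) A tA] .
  next
    fix a t assume a: "a \<in> carrier K" and t: "t \<in> carrier X"
    define A where "A = {i. t i \<noteq> \<zero>\<^bsub>D i\<^esub>}"
    have A: "finite A" using t by (auto simp: A_def carrier_X)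
    have tA: "{i. t i \<noteq> \<zero>\<^bsub>D i\<^esub>} \<subseteq> A" and atA: "{i. (a \<odot>\<^bsub>X\<^esub> t) i \<noteq> \<zero>\<^bsub>D i\<^esub>} \<subseteq> A"
      using a by (auto simp: A_def smult_X)
    have "(\<Oplus>\<^bsub>M\<^esub>i\<in>A. \<phi> i ((a \<odot>\<^bsub>X\<^esub> t) i)) = (\<Oplus>\<^bsub>M\<^esub>i\<in>A. a \<odot>\<^bsub>M\<^esub> \<phi> i (t i))"
      using a t by (intro M.finsum_cong') (auto simp: smult_X carrier_X linmap_smult[OF \<phi>] linmap_closed[OF \<phi>])
    also have "\<dots> = a \<odot>\<^bsub>M\<^esub> (\<Oplus>\<^bsub>M\<^esub>i\<in>A. \<phi> i (t i))"
      using a t c A by (intro M.finsum_smult_ldistr[symmetric]) auto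
    finally show "?h (a \<odot>\<^bsub>X\<^esub> t) = a \<odot>\<^bsub>M\<^esub> ?h t"
      unfolding sup[OF smult_closed[OF a t] A atA] sup[OF t A tA] .
  qed
  assume a: "a \<in> carrier (D i)"
  have "?h (single i a) = (\<Oplus>\<^bsub>M\<^esub>j\<in>{i}. \<phi> j (single i a j))"
    by (rule sup) (use a single_closed in \<open>auto simp: single_def\<close>)
  also have "\<dots> = \<phi> i a"
    using a linmap_closed[OF \<phi>] by (subst M.finsum_insert) (auto simp: single_def)
  finally show "?h (single i a) = \<phi> i a" .
qed

end

section \<open>Free modules and linear extension\<close>

definition lext ::
    "('k, 'm) ring_scheme \<Rightarrow> ('k, 'b, 'd) module_scheme \<Rightarrow> ('a \<Rightarrow> 'b) \<Rightarrow> ('a \<Rightarrow> 'k) \<Rightarrow> 'b"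
  where "lext K M f v = (\<Oplus>\<^bsub>M\<^esub>x\<in>{x. v x \<noteq> \<zero>\<^bsub>K\<^esub>}. v x \<odot>\<^bsub>M\<^esub> f x)"

lemma free_module_ops:
  "\<zero>\<^bsub>free_module K S\<^esub> = (\<lambda>_. \<zero>\<^bsub>K\<^esub>)"
  "f \<oplus>\<^bsub>free_module K S\<^esub> h = (\<lambda>x. f x \<oplus>\<^bsub>K\<^esub> h x)"
  "a \<odot>\<^bsub>free_module K S\<^esub> f = (\<lambda>x. a \<otimes>\<^bsub>K\<^esub> f x)"
  by (simp_all add: free_module_def)

lemma free_module_carrier: "carrier (free_module K S) =
    {f. (\<forall>x. f x \<in> carrier K) \<and> (\<forall>x. x \<notin> S \<longrightarrow> f x = \<zero>\<^bsub>K\<^esub>) \<and> finite {x. f x \<noteq> \<zero>\<^bsub>K\<^esub>}}"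
  by (simp add: free_module_def)

context cring
begin

text \<open>Functions vanishing outside \<open>S\<close> form the direct sum, over the whole index
  type, of copies of the ring at the indices in \<open>S\<close> and of zero modules elsewhere; the
  Boolean makes the choice. The support condition thus sits in the carriers of the summands, and
  \<open>free_module\<close> becomes an instance of \<open>direct_sum\<close>.\<close>

definition slot :: "bool \<Rightarrow> ('a, 'a) module"
  where "slot b = \<lparr>carrier = (if b then carrier R else {\<zero>}), mult = undefined, one = undefined,
    zero = \<zero>, add = (\<oplus>), smult = (\<otimes>)\<rparr>"

lemma slot_simps:
  "carrier (slot b) = (if b then carrier R else {\<zero>})"
  "\<zero>\<^bsub>slot b\<^esub> = \<zero>"
  "x \<oplus>\<^bsub>slot b\<^esub> y = x \<oplus> y"
  "a \<odot>\<^bsub>slot b\<^esub> x = a \<otimes> x"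
  by (simp_all add: slot_def)

lemma slot_module: "module R (slot b)"
proof (rule moduleI)
  show "abelian_group (slot b)"
  proof (rule abelian_groupI)
    fix x assume "x \<in> carrier (slot b)"
    then show "\<exists>y\<in>carrier (slot b). y \<oplus>\<^bsub>slot b\<^esub> x = \<zero>\<^bsub>slot b\<^esub>"
      by (cases b) (auto simp: slot_simps intro!: bexI[of _ "\<ominus> x"] l_neg)
  qed (auto simp: slot_simps a_ac split: if_splits)
qed (auto simp: slot_simps l_distr r_distr m_assoc is_cring split: if_splits)

lemma free_direct_sum: "direct_sum R (\<lambda>x. slot (x \<in> S)) (free_module R S)"
proof (rule direct_sum.intro)
  show "carrier (free_module R S) =
      {t. (\<forall>i. t i \<in> carrier (slot (i \<in> S))) \<and> finite {i. t i \<noteq> \<zero>\<^bsub>slot (i \<in> S)\<^esub>}}"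
    by (auto simp: free_module_carrier slot_simps split: if_splits) (metis singletonD empty_iff insert_iff zero_closed)+
qed (simp_all add: slot_module free_module_ops slot_simps)

lemma free_is_module: "module R (free_module R S)"
proof -
  interpret direct_sum R "\<lambda>x. slot (x \<in> S)" "free_module R S" by (rule free_direct_sum)
  show ?thesis by (rule X.module_axioms)
qed

lemma delta_closed: "x \<in> S \<Longrightarrow> delta R x \<in> carrier (free_module R S)"
  by (auto simp: free_module_carrier delta_def)

lemma free_induct [consumes 1, case_names zero add smult delta]:
  assumes "v \<in> carrier (free_module R S)"
    and zero: "Q (\<lambda>_. \<zero>)"
    and add: "\<And>v w. \<lbrakk>v \<in> carrier (free_module R S); w \<in> carrier (free_module R S); Q v; Q w\<rbrakk>
      \<Longrightarrow> Q (v \<oplus>\<^bsub>free_module R S\<^esub> w)"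
    and smult: "\<And>a v. \<lbrakk>a \<in> carrier R; v \<in> carrier (free_module R S); Q v\<rbrakk>
      \<Longrightarrow> Q (a \<odot>\<^bsub>free_module R S\<^esub> v)"
    and delta: "\<And>x. x \<in> S \<Longrightarrow> Q (delta R x)"
  shows "Q v"
proof -
  interpret direct_sum R "\<lambda>x. slot (x \<in> S)" "free_module R S" by (rule free_direct_sum)
  from assms(1) show ?thesis
  proof (induction rule: direct_sum_induct)
    case zero
    then show ?case using assms(2) by (simp add: free_module_ops)
  next
    case (add s t)
    then show ?case by (rule assms(3))
  next
    case (single x a)
    show ?case
    proof (cases "x \<in> S")
      case True
      then have "a \<in> carrier R" using single by (simp add: slot_simps)
      moreover from this have "single x a = a \<odot>\<^bsub>free_module R S\<^esub> delta R x"
        by (auto simp: single_def free_module_ops delta_def slot_simps)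
      ultimately show ?thesis
        using assms(4)[OF _ delta_closed[OF True] assms(5)[OF True]] by simp
    next
      case False
      then have "single x a = (\<lambda>_. \<zero>)" using single(1) by (auto simp: single_def slot_simps)
      then show ?thesis using assms(2) by simp
    qed
  qed
qed

lemma lext_linmap:
  assumes "module R M" "\<And>x. x \<in> S \<Longrightarrow> f x \<in> carrier M"
  shows "lext R M f \<in> linmap R (free_module R S) M"
proof -
  interpret M: module R M by fact
  interpret direct_sum R "\<lambda>x. slot (x \<in> S)" "free_module R S" by (rule free_direct_sum)
  define \<phi> where "\<phi> x a = (if x \<in> S then a \<odot>\<^bsub>M\<^esub> f x else \<zero>\<^bsub>M\<^esub>)" for x a
  have \<phi>: "\<phi> x \<in> linmap R (slot (x \<in> S)) M" for x
    by (rule linmapI) (auto simp: \<phi>_def slot_simps assms(2) M.smult_l_distr M.smult_assoc1)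
  have eq: "(\<Oplus>\<^bsub>M\<^esub>x\<in>{x. v x \<noteq> \<zero>\<^bsub>slot (x \<in> S)\<^esub>}. \<phi> x (v x)) = lext R M f v"
    if "v \<in> carrier (free_module R S)" for v
    unfolding lext_def using that assms(2)
    by (intro M.finsum_cong') (auto simp: slot_simps \<phi>_def free_module_carrier)
  show ?thesis
    using direct_sum_ext(1)[OF assms(1) \<phi>] X.M.add.m_closed X.smult_closed
    by (simp add: linmap_def eq)
qed

lemma lext_delta:
  assumes "module R M" "f x \<in> carrier M"
  shows "lext R M f (delta R x) = f x"
proof -
  interpret M: module R M by fact
  \<comment> \<open>In the zero ring \<open>delta\<close> is the zero function and the sum defining
    \<open>lext\<close> is empty; there \<open>f x\<close> is zero as well.\<close>
  have triv: "f x = \<zero>\<^bsub>M\<^esub>" if "\<one> = \<zero>"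
    using that M.smult_one[OF assms(2)] M.smult_l_null[OF assms(2)] by metis
  have "lext R M f (delta R x) = (\<Oplus>\<^bsub>M\<^esub>y\<in>{x}. delta R x y \<odot>\<^bsub>M\<^esub> f y)"
    unfolding lext_def
    by (rule M.finsum_superset[symmetric]) (use assms(2) triv in \<open>auto simp: delta_def\<close>)
  also have "\<dots> = f x"
    using assms(2) by (subst M.finsum_insert) (auto simp: delta_def)
  finally show ?thesis .
qed

lemma free_linmap_eq:
  assumes "module R M" "h \<in> linmap R (free_module R S) M" "k \<in> linmap R (free_module R S) M"
    and "\<And>x. x \<in> S \<Longrightarrow> h (delta R x) = k (delta R x)" and "v \<in> carrier (free_module R S)"
  shows "h v = k v"
  using assms(5)
proof (induction rule: free_induct)
  case zero
  show ?case
    using linmap_zero[OF free_is_module assms(1,2)] linmap_zero[OF free_is_module assms(1,3)]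
    by (simp add: free_module_ops)
qed (simp_all add: linmap_add[OF assms(2)] linmap_add[OF assms(3)] linmap_smult[OF assms(2)]
    linmap_smult[OF assms(3)] assms(4))

lemma free_subset_submodule:
  assumes "submodule N R (free_module R S)" "\<And>x. x \<in> S \<Longrightarrow> delta R x \<in> N"
  shows "carrier (free_module R S) \<subseteq> N"
proof
  interpret F: module R "free_module R S" by (rule free_is_module)
  fix v assume "v \<in> carrier (free_module R S)"
  then show "v \<in> N"
    by (induction rule: free_induct)
      (use F.submodule_facts[OF assms(1)] assms(2) in \<open>auto simp: free_module_ops(1)\<close>)
qed

end

context cring
begin

lemma free_mono: "S \<subseteq> S' \<Longrightarrow> carrier (free_module R S) \<subseteq> carrier (free_module R S')"
  by (auto simp: free_module_carrier)

lemma free_submodule: "S \<subseteq> S' \<Longrightarrow> submodule (carrier (free_module R S)) R (free_module R S')"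
proof -
  assume S: "S \<subseteq> S'"
  interpret F: module R "free_module R S" by (rule free_is_module)
  interpret F': module R "free_module R S'" by (rule free_is_module)
  show ?thesis
    using free_mono[OF S] F.M.zero_closed F.M.add.m_closed F.smult_closed
    by (intro F'.submoduleI') (simp_all add: free_module_ops)
qed

text \<open>Free modules on a set and on a superset share their operations and zero and differ only
  in the carrier, so one function, in particular one \<open>lext\<close>, serves \<open>P\<close>
  and all its graded and filtered pieces.\<close>

lemma linmap_free_mono:
  "\<lbrakk>h \<in> linmap R (free_module R S') M; S \<subseteq> S'\<rbrakk> \<Longrightarrow> h \<in> linmap R (free_module R S) M"
  using free_mono[of S S'] by (auto simp: linmap_def free_module_ops subset_iff)

text \<open>The form in which degree bounds are proved: with \<open>N\<close> a filtration step, it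
  is enough to bound the images of the monomials that may occur in \<open>v\<close>.\<close>

lemma lext_in_submodule:
  assumes "module R M" "submodule N R M" "\<And>x. x \<in> S \<Longrightarrow> f x \<in> N" "v \<in> carrier (free_module R S)"
  shows "lext R M f v \<in> N"
proof -
  interpret M: module R M by fact
  have f: "f x \<in> carrier M" if "x \<in> S" for x
    using that assms(3) M.submodule_facts(2)[OF assms(2)] by blast
  have "carrier (free_module R S) \<subseteq> {v \<in> carrier (free_module R S). lext R M f v \<in> N}"
  proof (rule free_subset_submodule)
    show "submodule {v \<in> carrier (free_module R S). lext R M f v \<in> N} R (free_module R S)"
      by (rule submodule_vimage[OF free_is_module assms(1) lext_linmap[OF assms(1) f] assms(2)])
    show "delta R x \<in> {v \<in> carrier (free_module R S). lext R M f v \<in> N}" if "x \<in> S" for x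
      using that assms(3) f by (simp add: delta_closed lext_delta[OF assms(1)])
  qed
  with assms(4) show ?thesis by blast
qed

lemma lext_cong:
  assumes "module R M" "\<And>x. x \<in> S \<Longrightarrow> f x \<in> carrier M" "\<And>x. x \<in> S \<Longrightarrow> f x = h x"
    and "v \<in> carrier (free_module R S)"
  shows "lext R M f v = lext R M h v"
proof (rule free_linmap_eq[OF assms(1) _ _ _ assms(4)])
  show "lext R M f \<in> linmap R (free_module R S) M" using assms(1,2) by (rule lext_linmap)
  show "lext R M h \<in> linmap R (free_module R S) M"
    using assms(1) by (rule lext_linmap) (use assms(2,3) in metis)
  fix x assume "x \<in> S"
  then show "lext R M f (delta R x) = lext R M h (delta R x)"
    using assms(2,3) by (metis lext_delta[OF assms(1)])
qed

end

section \<open>Tensor powers\<close>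

context module
begin

abbreviation "F n \<equiv> free_tuples R M n"
abbreviation "Rel n \<equiv> multilinear_submodule R M n"
abbreviation "TP n \<equiv> tensor_power R M n"
abbreviation "pt xs \<equiv> pure_tensor R M xs"

lemma F_module: "module R (F n)"
  by (rule free_is_module)

interpretation F: module R "F n" for n
  by (rule F_module)

lemma tuples_append: "\<lbrakk>xs \<in> tuples M i; ys \<in> tuples M j\<rbrakk> \<Longrightarrow> xs @ ys \<in> tuples M (i + j)"
  by (auto simp: tuples_def)

lemma tuples_length: "xs \<in> tuples M n \<Longrightarrow> length xs = n"
  by (simp add: tuples_def)

lemma tuples_update: "\<lbrakk>us @ x # vs \<in> tuples M n; y \<in> carrier M\<rbrakk> \<Longrightarrow> us @ y # vs \<in> tuples M n"
  by (auto simp: tuples_def)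

lemma delta_update: "\<lbrakk>us @ x # vs \<in> tuples M n; y \<in> carrier M\<rbrakk> \<Longrightarrow> delta R (us @ y # vs) \<in> carrier (F n)"
  by (rule delta_closed[OF tuples_update])

lemma tuples_mid: "us @ x # vs \<in> tuples M n \<Longrightarrow> x \<in> carrier M"
  by (auto simp: tuples_def)

lemma rels_cases [consumes 1, case_names add smult]:
  assumes "r \<in> multilinear_rels R M n"
  obtains us x y vs where "us @ x # vs \<in> tuples M n" "y \<in> carrier M"
      "r = delta R (us @ (x \<oplus>\<^bsub>M\<^esub> y) # vs) \<ominus>\<^bsub>F n\<^esub> delta R (us @ x # vs) \<ominus>\<^bsub>F n\<^esub> delta R (us @ y # vs)"
  | us a x vs where "us @ x # vs \<in> tuples M n" "a \<in> carrier R"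
      "r = delta R (us @ (a \<odot>\<^bsub>M\<^esub> x) # vs) \<ominus>\<^bsub>F n\<^esub> (a \<odot>\<^bsub>F n\<^esub> delta R (us @ x # vs))"
  using assms unfolding multilinear_rels_def by blast

lemma rels_addI:
  assumes "us @ x # vs \<in> tuples M n" "y \<in> carrier M"
  shows "delta R (us @ (x \<oplus>\<^bsub>M\<^esub> y) # vs) \<ominus>\<^bsub>F n\<^esub> delta R (us @ x # vs) \<ominus>\<^bsub>F n\<^esub> delta R (us @ y # vs)
    \<in> Rel n"
  unfolding multilinear_submodule_def
  by (rule gen_submodule_incl) (use assms in \<open>auto simp: multilinear_rels_def\<close>)

lemma rels_smultI:
  assumes "us @ x # vs \<in> tuples M n" "a \<in> carrier R"
  shows "delta R (us @ (a \<odot>\<^bsub>M\<^esub> x) # vs) \<ominus>\<^bsub>F n\<^esub> (a \<odot>\<^bsub>F n\<^esub> delta R (us @ x # vs)) \<in> Rel n"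
  unfolding multilinear_submodule_def
  by (rule gen_submodule_incl) (use assms in \<open>auto simp: multilinear_rels_def\<close>)

lemma rels_subset: "multilinear_rels R M n \<subseteq> carrier (F n)"
proof
  fix r assume "r \<in> multilinear_rels R M n"
  then show "r \<in> carrier (F n)"
  proof (cases rule: rels_cases)
    case (add us x y vs)
    then show ?thesis
      by (auto intro!: F.M.minus_closed delta_closed intro: tuples_update tuples_mid)
  next
    case (smult us a x vs)
    then show ?thesis
      by (auto intro!: F.M.minus_closed delta_closed intro: tuples_update tuples_mid)
  qed
qed

lemma Rel_submodule: "submodule (Rel n) R (F n)"
  unfolding multilinear_submodule_def by (rule F.gen_submodule_submodule[OF rels_subset])

lemma TP_module: "module R (TP n)"
  unfolding tensor_power_def by (rule F.quot_is_module[OF Rel_submodule])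

interpretation TP: module R "TP n" for n
  by (rule TP_module)

lemma TP_proj_linmap: "(\<lambda>f. Rel n +>\<^bsub>F n\<^esub> f) \<in> linmap R (F n) (TP n)"
  unfolding tensor_power_def by (rule F.proj_linmap[OF Rel_submodule])

lemma TP_carrierE:
  assumes "A \<in> carrier (TP n)"
  obtains f where "f \<in> carrier (F n)" "A = Rel n +>\<^bsub>F n\<^esub> f"
  using assms F.quot_carrierE[OF Rel_submodule] unfolding tensor_power_def by metis

lemma TP_coset_eq_iff: "\<lbrakk>f \<in> carrier (F n); h \<in> carrier (F n)\<rbrakk>
    \<Longrightarrow> Rel n +>\<^bsub>F n\<^esub> f = Rel n +>\<^bsub>F n\<^esub> h \<longleftrightarrow> f \<ominus>\<^bsub>F n\<^esub> h \<in> Rel n"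
  by (rule F.coset_eq_iff[OF Rel_submodule])

lemma pt_eq: "xs \<in> tuples M n \<Longrightarrow> pt xs = Rel n +>\<^bsub>F n\<^esub> delta R xs"
  by (simp add: pure_tensor_def tuples_length)

lemma pt_closed: "xs \<in> tuples M n \<Longrightarrow> pt xs \<in> carrier (TP n)"
  by (simp add: pt_eq linmap_closed[OF TP_proj_linmap] delta_closed)

lemma pt_add:
  assumes "us @ x # vs \<in> tuples M n" "y \<in> carrier M"
  shows "pt (us @ (x \<oplus>\<^bsub>M\<^esub> y) # vs) = pt (us @ x # vs) \<oplus>\<^bsub>TP n\<^esub> pt (us @ y # vs)"
proof -
  let ?d = "\<lambda>z. delta R (us @ z # vs)"
  have x: "x \<in> carrier M" using assms tuples_mid by blast
  have d: "us @ z # vs \<in> tuples M n" "?d z \<in> carrier (F n)" if "z \<in> carrier M" for z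
    using tuples_update[OF assms(1) that] delta_update[OF assms(1) that] by simp_all
  have "?d (x \<oplus>\<^bsub>M\<^esub> y) \<ominus>\<^bsub>F n\<^esub> (?d x \<oplus>\<^bsub>F n\<^esub> ?d y) \<in> Rel n"
    using rels_addI[OF assms] d x assms(2)
    by (simp add: a_minus_def F.M.minus_add F.M.a_assoc)
  then have "Rel n +>\<^bsub>F n\<^esub> ?d (x \<oplus>\<^bsub>M\<^esub> y) = Rel n +>\<^bsub>F n\<^esub> (?d x \<oplus>\<^bsub>F n\<^esub> ?d y)"
    using d x assms(2) by (subst TP_coset_eq_iff) auto
  then show ?thesis
    using d x assms(2) by (simp add: pt_eq[where n = n] linmap_add[OF TP_proj_linmap])
qed

lemma pt_smult:
  assumes "us @ x # vs \<in> tuples M n" "a \<in> carrier R"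
  shows "pt (us @ (a \<odot>\<^bsub>M\<^esub> x) # vs) = a \<odot>\<^bsub>TP n\<^esub> pt (us @ x # vs)"
proof -
  let ?d = "\<lambda>z. delta R (us @ z # vs)"
  have x: "x \<in> carrier M" using assms tuples_mid by blast
  have d: "us @ z # vs \<in> tuples M n" "?d z \<in> carrier (F n)" if "z \<in> carrier M" for z
    using tuples_update[OF assms(1) that] delta_update[OF assms(1) that] by simp_all
  have "Rel n +>\<^bsub>F n\<^esub> ?d (a \<odot>\<^bsub>M\<^esub> x) = Rel n +>\<^bsub>F n\<^esub> (a \<odot>\<^bsub>F n\<^esub> ?d x)"
    using d x assms(2) rels_smultI[OF assms] by (subst TP_coset_eq_iff) auto
  then show ?thesis
    using d x assms(2) by (simp add: pt_eq[where n = n] linmap_smult[OF TP_proj_linmap])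
qed

lemma TP_induct [consumes 1, case_names zero add smult pt]:
  assumes "A \<in> carrier (TP n)"
    and zero: "Q \<zero>\<^bsub>TP n\<^esub>"
    and add: "\<And>A B. \<lbrakk>A \<in> carrier (TP n); B \<in> carrier (TP n); Q A; Q B\<rbrakk> \<Longrightarrow> Q (A \<oplus>\<^bsub>TP n\<^esub> B)"
    and smult: "\<And>a A. \<lbrakk>a \<in> carrier R; A \<in> carrier (TP n); Q A\<rbrakk> \<Longrightarrow> Q (a \<odot>\<^bsub>TP n\<^esub> A)"
    and pt: "\<And>xs. xs \<in> tuples M n \<Longrightarrow> Q (pt xs)"
  shows "Q A"
proof -
  note proj = TP_proj_linmap[of n]
  obtain f where f: "f \<in> carrier (F n)" "A = Rel n +>\<^bsub>F n\<^esub> f" by (rule TP_carrierE[OF assms(1)])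
  have "Q (Rel n +>\<^bsub>F n\<^esub> f)"
    using f(1)
  proof (induction rule: free_induct)
    case zero
    then show ?case using linmap_zero[OF F_module TP_module proj] assms(2) by (simp add: free_module_ops)
  next
    case (add v w)
    then show ?case using assms(3) by (simp add: linmap_add[OF proj] linmap_closed[OF proj])
  next
    case (smult a v)
    then show ?case using assms(4) by (simp add: linmap_smult[OF proj] linmap_closed[OF proj])
  next
    case (delta xs)
    then show ?case using pt by (metis pt_eq)
  qed
  then show ?thesis using f(2) by simp
qed

lemma TP_subset_submodule:
  assumes "submodule N R (TP n)" "\<And>xs. xs \<in> tuples M n \<Longrightarrow> pt xs \<in> N"
  shows "carrier (TP n) \<subseteq> N"
proof
  fix A assume "A \<in> carrier (TP n)"
  then show "A \<in> N"
    by (induction rule: TP_induct) (use TP.submodule_facts[OF assms(1)] assms(2) in auto)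
qed

definition multilinear :: "('a, 'p, 'q) module_scheme \<Rightarrow> nat \<Rightarrow> ('c list \<Rightarrow> 'p) \<Rightarrow> bool"
  where "multilinear L n \<phi> \<longleftrightarrow>
    (\<forall>xs\<in>tuples M n. \<phi> xs \<in> carrier L) \<and>
    (\<forall>us x y vs. us @ x # vs \<in> tuples M n \<longrightarrow> y \<in> carrier M \<longrightarrow>
      \<phi> (us @ (x \<oplus>\<^bsub>M\<^esub> y) # vs) = \<phi> (us @ x # vs) \<oplus>\<^bsub>L\<^esub> \<phi> (us @ y # vs)) \<and>
    (\<forall>us a x vs. us @ x # vs \<in> tuples M n \<longrightarrow> a \<in> carrier R \<longrightarrow>
      \<phi> (us @ (a \<odot>\<^bsub>M\<^esub> x) # vs) = a \<odot>\<^bsub>L\<^esub> \<phi> (us @ x # vs))"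

text \<open>The kernel of the linear extension of \<open>\<phi>\<close> is a submodule containing
  the generating relations, hence all of \<open>Rel n\<close>, and so the extension descends to the
  quotient.\<close>

lemma TP_lift:
  fixes L :: "('a, 'p, 'q) module_scheme"
  assumes "module R L" "multilinear L n \<phi>"
  obtains h where "h \<in> linmap R (TP n) L" "\<And>xs. xs \<in> tuples M n \<Longrightarrow> h (pt xs) = \<phi> xs"
proof -
  interpret L: module R L by fact
  note m = assms(2)[unfolded multilinear_def]
  let ?h = "lext R L \<phi>"
  have h: "?h \<in> linmap R (F n) L"
    by (rule lext_linmap) (use m assms(1) in auto)
  have hd: "?h (delta R xs) = \<phi> xs" "\<phi> xs \<in> carrier L" if "xs \<in> tuples M n" for xs
    using that m lext_delta[OF assms(1), of \<phi> xs] by simp_all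
  have "Rel n \<subseteq> {f \<in> carrier (F n). ?h f \<in> {\<zero>\<^bsub>L\<^esub>}}"
    unfolding multilinear_submodule_def
  proof (rule gen_submodule_minimal)
    show "submodule {f \<in> carrier (F n). ?h f \<in> {\<zero>\<^bsub>L\<^esub>}} R (F n)"
      by (rule submodule_vimage[OF F_module assms(1) h L.zero_submodule])
    show "multilinear_rels R M n \<subseteq> {f \<in> carrier (F n). ?h f \<in> {\<zero>\<^bsub>L\<^esub>}}"
    proof
      fix r assume r: "r \<in> multilinear_rels R M n"
      then have "?h r = \<zero>\<^bsub>L\<^esub>"
      proof (cases rule: rels_cases)
        case (add us x y vs)
        let ?d = "\<lambda>z. delta R (us @ z # vs)"
        have d: "us @ z # vs \<in> tuples M n" "?d z \<in> carrier (F n)" if "z \<in> carrier M" for z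
          using tuples_update[OF add(1) that] delta_update[OF add(1) that] by simp_all
        have x: "x \<in> carrier M" using add tuples_mid by blast
        have "?h r = \<phi> (us @ (x \<oplus>\<^bsub>M\<^esub> y) # vs) \<ominus>\<^bsub>L\<^esub> \<phi> (us @ x # vs) \<ominus>\<^bsub>L\<^esub> \<phi> (us @ y # vs)"
          using add d x by (simp add: linmap_diff[OF F_module assms(1) h] hd)
        also have "\<dots> = \<zero>\<^bsub>L\<^esub>"
          using add(1,2) m hd(2)[OF d(1)[OF x]] hd(2)[OF d(1)[OF add(2)]]
          by (simp add: L.M.add_diff_diff)
        finally show ?thesis .
      next
        case (smult us a x vs)
        let ?d = "\<lambda>z. delta R (us @ z # vs)"
        have d: "us @ z # vs \<in> tuples M n" "?d z \<in> carrier (F n)" if "z \<in> carrier M" for z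
          using tuples_update[OF smult(1) that] delta_update[OF smult(1) that] by simp_all
        have x: "x \<in> carrier M" using smult tuples_mid by blast
        have "?h r = \<phi> (us @ (a \<odot>\<^bsub>M\<^esub> x) # vs) \<ominus>\<^bsub>L\<^esub> (a \<odot>\<^bsub>L\<^esub> \<phi> (us @ x # vs))"
          using smult d x by (simp add: linmap_diff[OF F_module assms(1) h] linmap_smult[OF h] hd)
        also have "\<dots> = \<zero>\<^bsub>L\<^esub>"
          using smult m hd(2)[OF d(1)[OF x]] by (simp add: L.M.diff_eq_zero_iff)
        finally show ?thesis .
      qed
      with r rels_subset show "r \<in> {f \<in> carrier (F n). ?h f \<in> {\<zero>\<^bsub>L\<^esub>}}" by auto
    qed
  qed
  then have "?h f = \<zero>\<^bsub>L\<^esub>" if "f \<in> Rel n" for f using that by auto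
  from F.quot_lift[OF Rel_submodule assms(1) h this]
  obtain h' where h': "h' \<in> linmap R (TP n) L" "\<And>f. f \<in> carrier (F n) \<Longrightarrow> h' (Rel n +>\<^bsub>F n\<^esub> f) = ?h f"
    unfolding tensor_power_def by blast
  have "h' (pt xs) = \<phi> xs" if "xs \<in> tuples M n" for xs
    using that h'(2)[OF delta_closed[OF that]] hd by (simp add: pt_eq[where n = n])
  with h' that show thesis by blast
qed

section \<open>The product of two tensor powers\<close>

definition conv :: "nat \<Rightarrow> ('c list \<Rightarrow> 'a) \<Rightarrow> ('c list \<Rightarrow> 'a) \<Rightarrow> 'c list \<Rightarrow> 'a"
  where "conv i f h = (\<lambda>ws. f (take i ws) \<otimes> h (drop i ws))"

lemma conv_closed:
  assumes "f \<in> carrier (F i)" "h \<in> carrier (F j)"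
  shows "conv i f h \<in> carrier (F (i + j))"
proof -
  \<comment> \<open>Every word in the support is a word from the support of \<open>f\<close>
    followed by one from the support of \<open>h\<close>.\<close>
  have "{ws. conv i f h ws \<noteq> \<zero>} \<subseteq> (\<lambda>(us, vs). us @ vs) ` ({us. f us \<noteq> \<zero>} \<times> {vs. h vs \<noteq> \<zero>})"
  proof
    fix ws assume "ws \<in> {ws. conv i f h ws \<noteq> \<zero>}"
    then have "f (take i ws) \<noteq> \<zero>" "h (drop i ws) \<noteq> \<zero>"
      using assms by (auto simp: conv_def free_module_carrier)
    then show "ws \<in> (\<lambda>(us, vs). us @ vs) ` ({us. f us \<noteq> \<zero>} \<times> {vs. h vs \<noteq> \<zero>})"
      by (intro image_eqI[of _ _ "(take i ws, drop i ws)"]) auto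
  qed
  then have "finite {ws. conv i f h ws \<noteq> \<zero>}"
    using assms by (auto simp: free_module_carrier intro: finite_subset)
  moreover have "conv i f h ws = \<zero>" if "ws \<notin> tuples M (i + j)" for ws
  proof (rule ccontr)
    assume "conv i f h ws \<noteq> \<zero>"
    then have "f (take i ws) \<noteq> \<zero>" "h (drop i ws) \<noteq> \<zero>"
      using assms by (auto simp: conv_def free_module_carrier)
    then have "take i ws \<in> tuples M i" "drop i ws \<in> tuples M j"
      using assms by (auto simp: free_module_carrier)
    then have "take i ws @ drop i ws \<in> tuples M (i + j)" by (rule tuples_append)
    with that show False by simp
  qed
  moreover have "\<forall>ws. conv i f h ws \<in> carrier R"
    using assms by (auto simp: free_module_carrier conv_def)
  ultimately show ?thesis by (simp add: free_module_carrier)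
qed

lemma conv_linmap_left: "h \<in> carrier (F j) \<Longrightarrow> (\<lambda>f. conv i f h) \<in> linmap R (F i) (F (i + j))"
  by (rule linmapI) (simp_all add: conv_closed, simp_all add: conv_def free_module_ops free_module_carrier l_distr m_assoc)

lemma conv_linmap_right: "f \<in> carrier (F i) \<Longrightarrow> conv i f \<in> linmap R (F j) (F (i + j))"
  by (rule linmapI) (simp_all add: conv_closed, simp_all add: conv_def free_module_ops free_module_carrier r_distr m_lcomm)

lemma conv_delta:
  assumes "xs \<in> tuples M i" "ys \<in> tuples M j"
  shows "conv i (delta R xs) (delta R ys) = delta R (xs @ ys)"
proof
  fix ws
  have "xs @ ys = ws \<longleftrightarrow> take i ws = xs \<and> drop i ws = ys"
    using append_eq_conv_conj[of xs ys ws] tuples_length[OF assms(1)] by auto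
  then show "conv i (delta R xs) (delta R ys) ws = delta R (xs @ ys) ws"
    by (auto simp: conv_def delta_def)
qed

text \<open>By linearity the right factor may be taken to be a single tuple \<open>ys\<close>.
  Appending \<open>ys\<close> to a generating relation only lengthens its right context from
  \<open>vs\<close> to \<open>vs @ ys\<close>, which gives another generating relation.\<close>

lemma conv_Rel_left:
  assumes "f \<in> Rel i" "h \<in> carrier (F j)"
  shows "conv i f h \<in> Rel (i + j)"
proof -
  have delta: "Rel i \<subseteq> {f \<in> carrier (F i). conv i f (delta R ys) \<in> Rel (i + j)}" if ys: "ys \<in> tuples M j" for ys
    unfolding multilinear_submodule_def[of _ _ i]
  proof (rule gen_submodule_minimal)
    let ?c = "\<lambda>f. conv i f (delta R ys)"
    have c: "?c \<in> linmap R (F i) (F (i + j))"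
      by (rule conv_linmap_left[OF delta_closed[OF ys]])
    show "submodule {f \<in> carrier (F i). ?c f \<in> Rel (i + j)} R (F i)"
      by (rule submodule_vimage[OF F_module F_module c Rel_submodule])
    show "multilinear_rels R M i \<subseteq> {f \<in> carrier (F i). ?c f \<in> Rel (i + j)}"
    proof
      fix r assume r: "r \<in> multilinear_rels R M i"
      then have "?c r \<in> Rel (i + j)"
      proof (cases rule: rels_cases)
        case (add us x y vs)
        have "us @ z # vs \<in> tuples M i" "delta R (us @ z # vs) \<in> carrier (F i)" if "z \<in> carrier M" for z
          using tuples_update[OF add(1) that] delta_update[OF add(1) that] by simp_all
        moreover have "x \<in> carrier M" using add tuples_mid by blast
        moreover have "us @ x # (vs @ ys) \<in> tuples M (i + j)" using tuples_append[OF add(1) ys] by simp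
        ultimately show ?thesis using rels_addI[of us x "vs @ ys"] add(2) ys unfolding add(3)
          by (simp add: linmap_diff[OF F_module F_module c] conv_delta[where j = j])
      next
        case (smult us a x vs)
        have "us @ z # vs \<in> tuples M i" "delta R (us @ z # vs) \<in> carrier (F i)" if "z \<in> carrier M" for z
          using tuples_update[OF smult(1) that] delta_update[OF smult(1) that] by simp_all
        moreover have "x \<in> carrier M" using smult tuples_mid by blast
        moreover have "us @ x # (vs @ ys) \<in> tuples M (i + j)" using tuples_append[OF smult(1) ys] by simp
        ultimately show ?thesis using rels_smultI[of us x "vs @ ys"] smult(2) ys unfolding smult(3)
          by (simp add: linmap_diff[OF F_module F_module c] linmap_smult[OF c] conv_delta[where j = j])
      qed
      with r rels_subset show "r \<in> {f \<in> carrier (F i). ?c f \<in> Rel (i + j)}" by blast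
    qed
  qed
  have f: "f \<in> carrier (F i)" using assms(1) F.submodule_facts[OF Rel_submodule] by blast
  have "carrier (F j) \<subseteq> {h \<in> carrier (F j). conv i f h \<in> Rel (i + j)}"
    by (rule free_subset_submodule[OF submodule_vimage[OF F_module F_module conv_linmap_right[OF f] Rel_submodule]])
      (use delta delta_closed assms(1) in auto)
  with assms(2) show ?thesis by blast
qed

text \<open>Mirror image: the fixed tuple is absorbed into the left context
  \<open>us\<close>.\<close>

lemma conv_Rel_right:
  assumes "f \<in> carrier (F i)" "h \<in> Rel j"
  shows "conv i f h \<in> Rel (i + j)"
proof -
  have delta: "Rel j \<subseteq> {h \<in> carrier (F j). conv i (delta R ys) h \<in> Rel (i + j)}" if ys: "ys \<in> tuples M i" for ys
    unfolding multilinear_submodule_def[of _ _ j]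
  proof (rule gen_submodule_minimal)
    let ?c = "conv i (delta R ys)"
    have c: "?c \<in> linmap R (F j) (F (i + j))"
      by (rule conv_linmap_right[OF delta_closed[OF ys]])
    show "submodule {f \<in> carrier (F j). ?c f \<in> Rel (i + j)} R (F j)"
      by (rule submodule_vimage[OF F_module F_module c Rel_submodule])
    show "multilinear_rels R M j \<subseteq> {f \<in> carrier (F j). ?c f \<in> Rel (i + j)}"
    proof
      fix r assume r: "r \<in> multilinear_rels R M j"
      then have "?c r \<in> Rel (i + j)"
      proof (cases rule: rels_cases)
        case (add us x y vs)
        have "us @ z # vs \<in> tuples M j" "delta R (us @ z # vs) \<in> carrier (F j)" if "z \<in> carrier M" for z
          using tuples_update[OF add(1) that] delta_update[OF add(1) that] by simp_all
        moreover have "x \<in> carrier M" using add tuples_mid by blast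
        moreover have "(ys @ us) @ x # vs \<in> tuples M (i + j)" using tuples_append[OF ys add(1)] by simp
        ultimately show ?thesis using rels_addI[of "ys @ us" x vs] add(2) ys unfolding add(3)
          by (simp add: linmap_diff[OF F_module F_module c] conv_delta[where j = j])
      next
        case (smult us a x vs)
        have "us @ z # vs \<in> tuples M j" "delta R (us @ z # vs) \<in> carrier (F j)" if "z \<in> carrier M" for z
          using tuples_update[OF smult(1) that] delta_update[OF smult(1) that] by simp_all
        moreover have "x \<in> carrier M" using smult tuples_mid by blast
        moreover have "(ys @ us) @ x # vs \<in> tuples M (i + j)" using tuples_append[OF ys smult(1)] by simp
        ultimately show ?thesis using rels_smultI[of "ys @ us" x vs] smult(2) ys unfolding smult(3)
          by (simp add: linmap_diff[OF F_module F_module c] linmap_smult[OF c] conv_delta[where j = j])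
      qed
      with r rels_subset show "r \<in> {f \<in> carrier (F j). ?c f \<in> Rel (i + j)}" by blast
    qed
  qed
  have h: "h \<in> carrier (F j)" using assms(2) F.submodule_facts[OF Rel_submodule] by blast
  have "carrier (F i) \<subseteq> {f \<in> carrier (F i). conv i f h \<in> Rel (i + j)}"
    by (rule free_subset_submodule[OF submodule_vimage[OF F_module F_module conv_linmap_left[OF h] Rel_submodule]])
      (use delta delta_closed assms(2) in auto)
  with assms(1) show ?thesis by blast
qed

text \<open>The definition is a union over pairs of representatives. Changing the two factors by
  relations, one after the other, does not leave the coset of the product, so the union is a single
  coset.\<close>

lemma tensor_mult_coset:
  assumes f: "f \<in> carrier (F i)" and h: "h \<in> carrier (F j)"
  shows "tensor_mult R M i j (Rel i +>\<^bsub>F i\<^esub> f) (Rel j +>\<^bsub>F j\<^esub> h) = Rel (i + j) +>\<^bsub>F (i + j)\<^esub> conv i f h"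
proof -
  have *: "Rel (i + j) +>\<^bsub>F (i + j)\<^esub> conv i f' h' = Rel (i + j) +>\<^bsub>F (i + j)\<^esub> conv i f h"
    if f': "f' \<in> Rel i +>\<^bsub>F i\<^esub> f" and h': "h' \<in> Rel j +>\<^bsub>F j\<^esub> h" for f' h'
  proof -
    have f'': "f' \<in> carrier (F i)" "f' \<ominus>\<^bsub>F i\<^esub> f \<in> Rel i"
      using f' F.mem_coset_iff[OF Rel_submodule f] F.coset_eq_iff[OF Rel_submodule _ f] by blast+
    have h'': "h' \<in> carrier (F j)" "h' \<ominus>\<^bsub>F j\<^esub> h \<in> Rel j"
      using h' F.mem_coset_iff[OF Rel_submodule h] F.coset_eq_iff[OF Rel_submodule _ h] by blast+
    have "Rel (i + j) +>\<^bsub>F (i + j)\<^esub> conv i f' h' = Rel (i + j) +>\<^bsub>F (i + j)\<^esub> conv i f h'"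
      using conv_Rel_left[OF f''(2) h''(1)] f''(1) f h''(1)
      by (simp add: TP_coset_eq_iff conv_closed
          linmap_diff[OF F_module F_module conv_linmap_left])
    also have "\<dots> = Rel (i + j) +>\<^bsub>F (i + j)\<^esub> conv i f h"
      using conv_Rel_right[OF f h''(2)] f h h''(1)
      by (simp add: TP_coset_eq_iff conv_closed
          linmap_diff[OF F_module F_module conv_linmap_right])
    finally show ?thesis .
  qed
  have ne: "Rel i +>\<^bsub>F i\<^esub> f \<noteq> {}" "Rel j +>\<^bsub>F j\<^esub> h \<noteq> {}"
    using F.coset_self[OF Rel_submodule] f h by blast+
  show ?thesis
    unfolding tensor_mult_def conv_def[symmetric]
    by (rule SUP_eq_const[OF ne(1)], rule SUP_eq_const[OF ne(2)], rule *)
qed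

lemma tensor_mult_pt:
  assumes "xs \<in> tuples M i" "ys \<in> tuples M j"
  shows "tensor_mult R M i j (pt xs) (pt ys) = pt (xs @ ys)"
  using assms
  by (simp add: pt_eq[OF assms(1)] pt_eq[OF assms(2)] pt_eq[OF tuples_append[OF assms]]
      tensor_mult_coset delta_closed conv_delta)

lemma tensor_mult_linmap_left:
  assumes "B \<in> carrier (TP j)"
  shows "(\<lambda>A. tensor_mult R M i j A B) \<in> linmap R (TP i) (TP (i + j))"
proof -
  obtain h where h: "h \<in> carrier (F j)" "B = Rel j +>\<^bsub>F j\<^esub> h" by (rule TP_carrierE[OF assms])
  note c = conv_linmap_left[OF h(1), of i] and p = TP_proj_linmap
  show ?thesis
    by (rule linmapI; elim TP_carrierE)
      (simp_all add: h tensor_mult_coset linmap_closed[OF p] conv_closed linmap_add[OF p, symmetric]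
        linmap_smult[OF p, symmetric] linmap_add[OF c] linmap_smult[OF c])
qed

lemma tensor_mult_linmap_right:
  assumes "A \<in> carrier (TP i)"
  shows "(\<lambda>B. tensor_mult R M i j A B) \<in> linmap R (TP j) (TP (i + j))"
proof -
  obtain f where f: "f \<in> carrier (F i)" "A = Rel i +>\<^bsub>F i\<^esub> f" by (rule TP_carrierE[OF assms])
  note c = conv_linmap_right[OF f(1), of j] and p = TP_proj_linmap
  show ?thesis
    by (rule linmapI; elim TP_carrierE)
      (simp_all add: f tensor_mult_coset linmap_closed[OF p] conv_closed linmap_add[OF p, symmetric]
        linmap_smult[OF p, symmetric] linmap_add[OF c] linmap_smult[OF c])
qed

end

section \<open>The tensor algebra\<close>

context module
begin

interpretation TP: module R "TP n" for n
  by (rule TP_module)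

abbreviation "T \<equiv> tensor_algebra R M"
abbreviation "incl \<equiv> tensor_incl R M"

definition pure :: "'c list \<Rightarrow> nat \<Rightarrow> ('c list \<Rightarrow> 'a) set"
  where "pure xs = incl (length xs) (pt xs)"

lemma T_simps:
  "carrier T = {t. (\<forall>n. t n \<in> carrier (TP n)) \<and> finite {n. t n \<noteq> \<zero>\<^bsub>TP n\<^esub>}}"
  "\<zero>\<^bsub>T\<^esub> = (\<lambda>n. \<zero>\<^bsub>TP n\<^esub>)"
  "s \<oplus>\<^bsub>T\<^esub> t = (\<lambda>n. s n \<oplus>\<^bsub>TP n\<^esub> t n)"
  "a \<odot>\<^bsub>T\<^esub> t = (\<lambda>n. a \<odot>\<^bsub>TP n\<^esub> t n)"
  "s \<otimes>\<^bsub>T\<^esub> t = (\<lambda>n. \<Oplus>\<^bsub>TP n\<^esub>i\<in>{..n}. tensor_mult R M i (n - i) (s i) (t (n - i)))"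
  by (simp_all add: tensor_algebra_def)

lemma T_direct_sum: "direct_sum R TP T"
  by (rule direct_sum.intro) (simp_all add: TP_module T_simps)

interpretation DS: direct_sum R TP T
  by (rule T_direct_sum)

lemma T_module: "module R T"
  by (rule DS.X.module_axioms)

lemma incl_eq_single: "incl n A = DS.single n A"
  by (auto simp: tensor_incl_def DS.single_def)

lemma incl_linmap: "incl n \<in> linmap R (TP n) T"
  using DS.single_linmap[of n] by (simp add: linmap_def incl_eq_single)

lemma component_linmap: "(\<lambda>t. t n) \<in> linmap R T (TP n)"
  by (rule linmapI) (auto simp: T_simps)

lemma pure_closed: "set xs \<subseteq> carrier M \<Longrightarrow> pure xs \<in> carrier T"
  unfolding pure_def
  by (rule linmap_closed[OF incl_linmap]) (simp add: pt_closed tuples_def)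

text \<open>The words in the last case have a length at which the original \<open>t\<close> is
  nonzero; this is what bounds degrees in \<open>Phi_low\<close>.\<close>

lemma T_induct [consumes 1, case_names zero add smult pure]:
  assumes "t \<in> carrier T"
    and zero: "Q \<zero>\<^bsub>T\<^esub>"
    and add: "\<And>s t. \<lbrakk>s \<in> carrier T; t \<in> carrier T; Q s; Q t\<rbrakk> \<Longrightarrow> Q (s \<oplus>\<^bsub>T\<^esub> t)"
    and smult: "\<And>a t. \<lbrakk>a \<in> carrier R; t \<in> carrier T; Q t\<rbrakk> \<Longrightarrow> Q (a \<odot>\<^bsub>T\<^esub> t)"
    and pure: "\<And>xs. \<lbrakk>set xs \<subseteq> carrier M; t (length xs) \<noteq> \<zero>\<^bsub>TP (length xs)\<^esub>\<rbrakk> \<Longrightarrow> Q (pure xs)"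
  shows "Q t"
  using assms(1)
proof (induction rule: DS.direct_sum_induct)
  case zero
  show ?case by (rule assms(2))
next
  case (add s t)
  then show ?case by (rule assms(3))
next
  case (single n A)
  show ?case
  proof (cases "A = \<zero>\<^bsub>TP n\<^esub>")
    case True
    then show ?thesis
      using assms(2) linmap_zero[OF TP_module T_module incl_linmap, of n] by (simp add: incl_eq_single)
  next
    case ne: False
    have "Q (incl n A)"
      using single(1)
    proof (induction rule: TP_induct)
      case zero
      then show ?case using linmap_zero[OF TP_module T_module incl_linmap] assms(2) by simp
    next
      case (add A B)
      then show ?case using assms(3) by (simp add: linmap_add[OF incl_linmap] linmap_closed[OF incl_linmap])
    next
      case (smult a A)
      then show ?case using assms(4) by (simp add: linmap_smult[OF incl_linmap] linmap_closed[OF incl_linmap])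
    next
      case (pt xs)
      then show ?case using assms(5)[of xs] ne single(2) by (auto simp: pure_def tuples_def)
    qed
    then show ?thesis by (simp add: incl_eq_single)
  qed
qed

lemma T_lift:
  fixes L :: "('a, 'p, 'q) module_scheme"
  assumes "module R L" "\<And>n. multilinear L n \<phi>"
  obtains h where "h \<in> linmap R T L" "\<And>xs. set xs \<subseteq> carrier M \<Longrightarrow> h (pure xs) = \<phi> xs"
proof -
  have "\<exists>h. h \<in> linmap R (TP n) L \<and> (\<forall>xs\<in>tuples M n. h (pt xs) = \<phi> xs)" for n
    by (rule TP_lift[OF assms(1) assms(2)[of n]]) blast
  then obtain H where H: "\<And>n. H n \<in> linmap R (TP n) L"
      "\<And>n xs. xs \<in> tuples M n \<Longrightarrow> H n (pt xs) = \<phi> xs"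
    by metis
  show thesis
  proof (rule that[OF DS.direct_sum_ext(1)[OF assms(1), of H, OF H(1)]])
    fix xs assume "set xs \<subseteq> carrier M"
    then have "xs \<in> tuples M (length xs)" by (simp add: tuples_def)
    then show "(\<Oplus>\<^bsub>L\<^esub>i\<in>{i. pure xs i \<noteq> \<zero>\<^bsub>TP i\<^esub>}. H i (pure xs i)) = \<phi> xs"
      unfolding pure_def incl_eq_single
      using DS.direct_sum_ext(2)[OF assms(1), of H, OF H(1), of "pt xs" "length xs"] pt_closed H(2)
      by simp
  qed
qed

text \<open>Words span \<open>T\<close>. The laws of its product and of its action on
  \<open>P\<close> are obtained by checking words and extending linearly in one argument at a
  time.\<close>

lemma T_linmap_eq:
  assumes "module R L" "h \<in> linmap R T L" "k \<in> linmap R T L"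
    and "\<And>xs. set xs \<subseteq> carrier M \<Longrightarrow> h (pure xs) = k (pure xs)" and "t \<in> carrier T"
  shows "h t = k t"
  using assms(5)
proof (induction rule: T_induct)
  case zero
  show ?case
    using linmap_zero[OF T_module assms(1,2)] linmap_zero[OF T_module assms(1,3)] by simp
qed (simp_all add: linmap_add[OF assms(2)] linmap_add[OF assms(3)] linmap_smult[OF assms(2)]
    linmap_smult[OF assms(3)] assms(4))

section \<open>The graded product on the direct sum\<close>

lemma tm_left: "\<lbrakk>i \<le> n; B \<in> carrier (TP (n - i))\<rbrakk>
    \<Longrightarrow> (\<lambda>A. tensor_mult R M i (n - i) A B) \<in> linmap R (TP i) (TP n)"
  using tensor_mult_linmap_left[of B "n - i" i] by simp

lemma tm_right: "\<lbrakk>i \<le> n; A \<in> carrier (TP i)\<rbrakk>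
    \<Longrightarrow> tensor_mult R M i (n - i) A \<in> linmap R (TP (n - i)) (TP n)"
  using tensor_mult_linmap_right[of A i "n - i"] by simp

lemma tm_closed: "\<lbrakk>i \<le> n; A \<in> carrier (TP i); B \<in> carrier (TP (n - i))\<rbrakk>
    \<Longrightarrow> tensor_mult R M i (n - i) A B \<in> carrier (TP n)"
  by (rule linmap_closed[OF tm_right])

lemma tm_zero_left: "\<lbrakk>i \<le> n; B \<in> carrier (TP (n - i))\<rbrakk>
    \<Longrightarrow> tensor_mult R M i (n - i) \<zero>\<^bsub>TP i\<^esub> B = \<zero>\<^bsub>TP n\<^esub>"
  by (rule linmap_zero[OF TP_module TP_module tm_left])

lemma tm_zero_right: "\<lbrakk>i \<le> n; A \<in> carrier (TP i)\<rbrakk>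
    \<Longrightarrow> tensor_mult R M i (n - i) A \<zero>\<^bsub>TP (n - i)\<^esub> = \<zero>\<^bsub>TP n\<^esub>"
  by (rule linmap_zero[OF TP_module TP_module tm_right])

lemma T_component: "t \<in> carrier T \<Longrightarrow> t n \<in> carrier (TP n)"
  by (simp add: T_simps)

lemma T_mult_component:
  "(s \<otimes>\<^bsub>T\<^esub> t) n = (\<Oplus>\<^bsub>TP n\<^esub>i\<in>{..n}. tensor_mult R M i (n - i) (s i) (t (n - i)))"
  by (simp add: T_simps)

lemma T_mult_closed:
  assumes "s \<in> carrier T" "t \<in> carrier T"
  shows "s \<otimes>\<^bsub>T\<^esub> t \<in> carrier T"
proof -
  have c: "(s \<otimes>\<^bsub>T\<^esub> t) n \<in> carrier (TP n)" for n
    unfolding T_mult_component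
    by (rule TP.finsum_closed) (simp add: Pi_def tm_closed T_component[OF assms(1)] T_component[OF assms(2)])
  have "{n. (s \<otimes>\<^bsub>T\<^esub> t) n \<noteq> \<zero>\<^bsub>TP n\<^esub>}
      \<subseteq> (\<lambda>(i, j). i + j) ` ({i. s i \<noteq> \<zero>\<^bsub>TP i\<^esub>} \<times> {j. t j \<noteq> \<zero>\<^bsub>TP j\<^esub>})"
  proof
    fix n assume "n \<in> {n. (s \<otimes>\<^bsub>T\<^esub> t) n \<noteq> \<zero>\<^bsub>TP n\<^esub>}"
    \<comment> \<open>A nonzero sum has a nonzero summand, and a product of components vanishes as
      soon as one of them does.\<close>
    then have "\<exists>i\<le>n. tensor_mult R M i (n - i) (s i) (t (n - i)) \<noteq> \<zero>\<^bsub>TP n\<^esub>"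
      using TP.M.add.finprod_one_eqI[of "{..n}" "\<lambda>i. tensor_mult R M i (n - i) (s i) (t (n - i))" n]
      unfolding mem_Collect_eq T_mult_component by auto
    then obtain i where "i \<le> n" "tensor_mult R M i (n - i) (s i) (t (n - i)) \<noteq> \<zero>\<^bsub>TP n\<^esub>" by blast
    then have "i \<le> n" "s i \<noteq> \<zero>\<^bsub>TP i\<^esub>" "t (n - i) \<noteq> \<zero>\<^bsub>TP (n - i)\<^esub>"
      using tm_zero_left[OF _ T_component[OF assms(2)], of i n]
        tm_zero_right[OF _ T_component[OF assms(1)], of i n] by auto
    then show "n \<in> (\<lambda>(i, j). i + j) ` ({i. s i \<noteq> \<zero>\<^bsub>TP i\<^esub>} \<times> {j. t j \<noteq> \<zero>\<^bsub>TP j\<^esub>})"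
      by (intro image_eqI[of _ _ "(i, n - i)"]) auto
  qed
  moreover have "finite ((\<lambda>(i, j). i + j) ` ({i. s i \<noteq> \<zero>\<^bsub>TP i\<^esub>} \<times> {j. t j \<noteq> \<zero>\<^bsub>TP j\<^esub>}))"
    using assms by (simp add: T_simps)
  ultimately show ?thesis
    using c by (simp add: T_simps(1) finite_subset)
qed

lemma T_mult_linmap_left:
  assumes t: "t \<in> carrier T"
  shows "(\<lambda>s. s \<otimes>\<^bsub>T\<^esub> t) \<in> linmap R T T"
proof (rule linmapI)
  fix s s' assume s: "s \<in> carrier T" "s' \<in> carrier T"
  show "(s \<oplus>\<^bsub>T\<^esub> s') \<otimes>\<^bsub>T\<^esub> t = s \<otimes>\<^bsub>T\<^esub> t \<oplus>\<^bsub>T\<^esub> s' \<otimes>\<^bsub>T\<^esub> t"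
  proof
    fix n
    let ?m = "\<lambda>s i. tensor_mult R M i (n - i) (s i) (t (n - i))"
    have "((s \<oplus>\<^bsub>T\<^esub> s') \<otimes>\<^bsub>T\<^esub> t) n = (\<Oplus>\<^bsub>TP n\<^esub>i\<in>{..n}. ?m s i \<oplus>\<^bsub>TP n\<^esub> ?m s' i)"
      unfolding T_mult_component T_simps(3)
      by (rule TP.M.finsum_cong')
        (simp_all add: Pi_def tm_closed T_component[OF t] T_component[OF s(1)] T_component[OF s(2)]
            linmap_add[OF tm_left])
    also have "\<dots> = (s \<otimes>\<^bsub>T\<^esub> t) n \<oplus>\<^bsub>TP n\<^esub> (s' \<otimes>\<^bsub>T\<^esub> t) n"
      unfolding T_mult_component
      by (rule TP.M.finsum_addf) (simp_all add: Pi_def tm_closed T_component[OF t] T_component[OF s(1)] T_component[OF s(2)])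
    finally show "((s \<oplus>\<^bsub>T\<^esub> s') \<otimes>\<^bsub>T\<^esub> t) n = (s \<otimes>\<^bsub>T\<^esub> t \<oplus>\<^bsub>T\<^esub> s' \<otimes>\<^bsub>T\<^esub> t) n"
      by (simp add: T_simps(3))
  qed
next
  fix a s assume a: "a \<in> carrier R" and s: "s \<in> carrier T"
  show "(a \<odot>\<^bsub>T\<^esub> s) \<otimes>\<^bsub>T\<^esub> t = a \<odot>\<^bsub>T\<^esub> (s \<otimes>\<^bsub>T\<^esub> t)"
  proof
    fix n
    let ?m = "\<lambda>s i. tensor_mult R M i (n - i) (s i) (t (n - i))"
    have "((a \<odot>\<^bsub>T\<^esub> s) \<otimes>\<^bsub>T\<^esub> t) n = (\<Oplus>\<^bsub>TP n\<^esub>i\<in>{..n}. a \<odot>\<^bsub>TP n\<^esub> ?m s i)"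
      unfolding T_mult_component T_simps(4)
      by (rule TP.M.finsum_cong')
        (simp_all add: Pi_def tm_closed T_component[OF t] T_component[OF s] a linmap_smult[OF tm_left])
    also have "\<dots> = a \<odot>\<^bsub>TP n\<^esub> (s \<otimes>\<^bsub>T\<^esub> t) n"
      unfolding T_mult_component
      by (rule TP.finsum_smult_ldistr[symmetric]) (simp_all add: Pi_def tm_closed T_component[OF t] T_component[OF s] a)
    finally show "((a \<odot>\<^bsub>T\<^esub> s) \<otimes>\<^bsub>T\<^esub> t) n = (a \<odot>\<^bsub>T\<^esub> (s \<otimes>\<^bsub>T\<^esub> t)) n"
      by (simp add: T_simps(4))
  qed
qed (rule T_mult_closed[OF _ t])

lemma T_mult_linmap_right:
  assumes t: "t \<in> carrier T"
  shows "(\<lambda>s. t \<otimes>\<^bsub>T\<^esub> s) \<in> linmap R T T"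
proof (rule linmapI)
  fix s s' assume s: "s \<in> carrier T" "s' \<in> carrier T"
  show "t \<otimes>\<^bsub>T\<^esub> (s \<oplus>\<^bsub>T\<^esub> s') = t \<otimes>\<^bsub>T\<^esub> s \<oplus>\<^bsub>T\<^esub> t \<otimes>\<^bsub>T\<^esub> s'"
  proof
    fix n
    let ?m = "\<lambda>s i. tensor_mult R M i (n - i) (t i) (s (n - i))"
    have "(t \<otimes>\<^bsub>T\<^esub> (s \<oplus>\<^bsub>T\<^esub> s')) n = (\<Oplus>\<^bsub>TP n\<^esub>i\<in>{..n}. ?m s i \<oplus>\<^bsub>TP n\<^esub> ?m s' i)"
      unfolding T_mult_component T_simps(3)
      by (rule TP.M.finsum_cong')
        (simp_all add: Pi_def tm_closed T_component[OF t] T_component[OF s(1)] T_component[OF s(2)]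
            linmap_add[OF tm_right])
    also have "\<dots> = (t \<otimes>\<^bsub>T\<^esub> s) n \<oplus>\<^bsub>TP n\<^esub> (t \<otimes>\<^bsub>T\<^esub> s') n"
      unfolding T_mult_component
      by (rule TP.M.finsum_addf) (simp_all add: Pi_def tm_closed T_component[OF t] T_component[OF s(1)] T_component[OF s(2)])
    finally show "(t \<otimes>\<^bsub>T\<^esub> (s \<oplus>\<^bsub>T\<^esub> s')) n = (t \<otimes>\<^bsub>T\<^esub> s \<oplus>\<^bsub>T\<^esub> t \<otimes>\<^bsub>T\<^esub> s') n"
      by (simp add: T_simps(3))
  qed
next
  fix a s assume a: "a \<in> carrier R" and s: "s \<in> carrier T"
  show "t \<otimes>\<^bsub>T\<^esub> (a \<odot>\<^bsub>T\<^esub> s) = a \<odot>\<^bsub>T\<^esub> (t \<otimes>\<^bsub>T\<^esub> s)"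
  proof
    fix n
    let ?m = "\<lambda>s i. tensor_mult R M i (n - i) (t i) (s (n - i))"
    have "(t \<otimes>\<^bsub>T\<^esub> (a \<odot>\<^bsub>T\<^esub> s)) n = (\<Oplus>\<^bsub>TP n\<^esub>i\<in>{..n}. a \<odot>\<^bsub>TP n\<^esub> ?m s i)"
      unfolding T_mult_component T_simps(4)
      by (rule TP.M.finsum_cong')
        (simp_all add: Pi_def tm_closed T_component[OF t] T_component[OF s] a linmap_smult[OF tm_right])
    also have "\<dots> = a \<odot>\<^bsub>TP n\<^esub> (t \<otimes>\<^bsub>T\<^esub> s) n"
      unfolding T_mult_component
      by (rule TP.finsum_smult_ldistr[symmetric]) (simp_all add: Pi_def tm_closed T_component[OF t] T_component[OF s] a)
    finally show "(t \<otimes>\<^bsub>T\<^esub> (a \<odot>\<^bsub>T\<^esub> s)) n = (a \<odot>\<^bsub>T\<^esub> (t \<otimes>\<^bsub>T\<^esub> s)) n"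
      by (simp add: T_simps(4))
  qed
qed (rule T_mult_closed[OF t])

lemma pure_mult:
  assumes "set xs \<subseteq> carrier M" "set ys \<subseteq> carrier M"
  shows "pure xs \<otimes>\<^bsub>T\<^esub> pure ys = pure (xs @ ys)"
proof
  fix n
  let ?i = "length xs" and ?j = "length ys"
  let ?m = "\<lambda>i. tensor_mult R M i (n - i) (pure xs i) (pure ys (n - i))"
  have t: "xs \<in> tuples M ?i" "ys \<in> tuples M ?j" using assms by (auto simp: tuples_def)
  have c: "pure xs i \<in> carrier (TP i)" "pure ys i \<in> carrier (TP i)" for i
    using pure_closed assms T_component by blast+
  have mc: "?m i \<in> carrier (TP n)" if "i \<le> n" for i
    using that c by (intro tm_closed)
  \<comment> \<open>Only the summand that splits exactly after \<open>xs\<close> can survive, and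
    only in degree \<open>?i + ?j\<close>.\<close>
  have z: "?m i = \<zero>\<^bsub>TP n\<^esub>" if "i \<le> n" "\<not> (i = ?i \<and> n = ?i + ?j)" for i
  proof (cases "i = ?i")
    case True
    then have "pure ys (n - i) = \<zero>\<^bsub>TP (n - i)\<^esub>" using that by (auto simp: pure_def tensor_incl_def)
    then show ?thesis using that c tm_zero_right by simp
  next
    case False
    then have "pure xs i = \<zero>\<^bsub>TP i\<^esub>" by (simp add: pure_def tensor_incl_def)
    then show ?thesis using that c tm_zero_left by simp
  qed
  show "(pure xs \<otimes>\<^bsub>T\<^esub> pure ys) n = pure (xs @ ys) n"
  proof (cases "n = ?i + ?j")
    case True
    have "(pure xs \<otimes>\<^bsub>T\<^esub> pure ys) n = ?m ?i"
      unfolding T_mult_component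
      by (rule TP.M.finsum_single) (use True z mc[of ?i] in auto)
    also have "\<dots> = pt (xs @ ys)"
      using True tensor_mult_pt[OF t] by (simp add: pure_def tensor_incl_def)
    finally show ?thesis using True by (simp add: pure_def tensor_incl_def)
  next
    case False
    have "(pure xs \<otimes>\<^bsub>T\<^esub> pure ys) n = \<zero>\<^bsub>TP n\<^esub>"
      unfolding T_mult_component
      by (rule TP.M.add.finprod_one_eqI) (use False z in auto)
    then show ?thesis using False by (simp add: pure_def tensor_incl_def)
  qed
qed

lemma T_one: "\<one>\<^bsub>T\<^esub> = pure []"
  by (auto simp: tensor_algebra_def pure_def tensor_incl_def)

text \<open>On words the product is concatenation, so the unit laws and associativity are those of
  lists. Associativity is extended to \<open>T\<close> one factor at a time, from the right:
  \<open>1\<close> frees \<open>u\<close>, \<open>2\<close> frees \<open>t\<close>, and the goal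
  frees \<open>s\<close>.\<close>

lemma T_ring: "ring T"
proof (rule ringI)
  show "abelian_group T" by (rule DS.X.M.abelian_group_axioms)
  note left = T_mult_linmap_left and right = T_mult_linmap_right
  show "monoid T"
  proof (rule monoidI)
    show one: "\<one>\<^bsub>T\<^esub> \<in> carrier T" by (simp add: T_one pure_closed)
    have id: "(\<lambda>t. t) \<in> linmap R T T" by (simp add: linmap_def)
    show "\<one>\<^bsub>T\<^esub> \<otimes>\<^bsub>T\<^esub> t = t" if "t \<in> carrier T" for t
      by (rule T_linmap_eq[OF T_module right[OF one] id _ that]) (simp add: T_one pure_mult)
    show "t \<otimes>\<^bsub>T\<^esub> \<one>\<^bsub>T\<^esub> = t" if "t \<in> carrier T" for t
      by (rule T_linmap_eq[OF T_module left[OF one] id _ that]) (simp add: T_one pure_mult)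
    fix s t u assume stu: "s \<in> carrier T" "t \<in> carrier T" "u \<in> carrier T"
    have 1: "pure xs \<otimes>\<^bsub>T\<^esub> pure ys \<otimes>\<^bsub>T\<^esub> u = pure xs \<otimes>\<^bsub>T\<^esub> (pure ys \<otimes>\<^bsub>T\<^esub> u)"
      if "set xs \<subseteq> carrier M" "set ys \<subseteq> carrier M" for xs ys
    proof (rule T_linmap_eq[OF T_module _ _ _ stu(3)])
      show "(\<lambda>u. pure xs \<otimes>\<^bsub>T\<^esub> pure ys \<otimes>\<^bsub>T\<^esub> u) \<in> linmap R T T"
        by (rule right) (use that pure_closed T_mult_closed in auto)
      show "(\<lambda>u. pure xs \<otimes>\<^bsub>T\<^esub> (pure ys \<otimes>\<^bsub>T\<^esub> u)) \<in> linmap R T T"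
        by (rule linmap_comp[OF right right]) (use that pure_closed in auto)
    qed (use that in \<open>auto simp: pure_mult\<close>)
    have 2: "pure xs \<otimes>\<^bsub>T\<^esub> t \<otimes>\<^bsub>T\<^esub> u = pure xs \<otimes>\<^bsub>T\<^esub> (t \<otimes>\<^bsub>T\<^esub> u)"
      if "set xs \<subseteq> carrier M" for xs
    proof (rule T_linmap_eq[OF T_module _ _ _ stu(2)])
      show "(\<lambda>t. pure xs \<otimes>\<^bsub>T\<^esub> t \<otimes>\<^bsub>T\<^esub> u) \<in> linmap R T T"
        by (rule linmap_comp[OF right left]) (use that pure_closed stu in auto)
      show "(\<lambda>t. pure xs \<otimes>\<^bsub>T\<^esub> (t \<otimes>\<^bsub>T\<^esub> u)) \<in> linmap R T T"
        by (rule linmap_comp[OF left right]) (use that pure_closed stu in auto)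
    qed (use that 1 in auto)
    show "s \<otimes>\<^bsub>T\<^esub> t \<otimes>\<^bsub>T\<^esub> u = s \<otimes>\<^bsub>T\<^esub> (t \<otimes>\<^bsub>T\<^esub> u)"
    proof (rule T_linmap_eq[OF T_module _ _ _ stu(1)])
      show "(\<lambda>s. s \<otimes>\<^bsub>T\<^esub> t \<otimes>\<^bsub>T\<^esub> u) \<in> linmap R T T"
        by (rule linmap_comp[OF left left]) (use stu in auto)
      show "(\<lambda>s. s \<otimes>\<^bsub>T\<^esub> (t \<otimes>\<^bsub>T\<^esub> u)) \<in> linmap R T T"
        by (rule left) (use stu T_mult_closed in auto)
    qed (use 2 in auto)
  qed (rule T_mult_closed)
qed (simp_all add: linmap_add[OF T_mult_linmap_left] linmap_add[OF T_mult_linmap_right])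

text \<open>A ring ideal is not by definition closed under scalars, but the scalar \<open>a\<close>
  acts as multiplication by \<open>a\<close> times the unit.\<close>

lemma ideal_submodule:
  assumes "ideal I T"
  shows "submodule I R T"
proof -
  interpret ideal I T by fact
  show ?thesis
  proof (rule DS.X.submoduleI')
    fix a t assume a: "a \<in> carrier R" and t: "t \<in> I"
    have "a \<odot>\<^bsub>T\<^esub> t = (a \<odot>\<^bsub>T\<^esub> \<one>\<^bsub>T\<^esub>) \<otimes>\<^bsub>T\<^esub> t"
      using a t Icarr[of t] by (simp add: linmap_smult[OF T_mult_linmap_left])
    then show "a \<odot>\<^bsub>T\<^esub> t \<in> I"
      using I_l_closed[OF t, of "a \<odot>\<^bsub>T\<^esub> \<one>\<^bsub>T\<^esub>"] a by simp
  qed auto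
qed

end

section \<open>The action on symmetric polynomials in a basis\<close>

text \<open>The order lives on the whole type, which spares side conditions. Totality yields least
  elements because monomials are finite multisets.\<close>

locale lie_basis = lie_algebra K g br
  for K :: "('k, 'm) ring_scheme" (structure) and g :: "('k, 'a, 'c) module_scheme" (structure) and br +
  fixes B :: "'a set" and le :: "'a \<Rightarrow> 'a \<Rightarrow> bool"
  assumes basis: "is_basis K g B"
    and le_refl: "le x x"
    and le_trans: "\<lbrakk>le x y; le y z\<rbrakk> \<Longrightarrow> le x z"
    and le_antisym: "\<lbrakk>le x y; le y x\<rbrakk> \<Longrightarrow> x = y"
    and le_total: "le x y \<or> le y x"
begin

abbreviation "FB \<equiv> free_module K B"

lemma FB_module: "module K FB"
  by (rule free_is_module)

lemma B_closed: "b \<in> B \<Longrightarrow> b \<in> carrier g"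
  using basis by (auto simp: is_basis_def)

lemma g_module: "module K g"
  by (rule module_axioms)

lemma lext_basis_linmap: "lext K g (\<lambda>b. b) \<in> linmap K FB g"
  by (rule lext_linmap[OF g_module B_closed])

lemma ex1_coord: "x \<in> carrier g \<Longrightarrow> \<exists>!c. c \<in> carrier FB \<and> x = lext K g (\<lambda>b. b) c"
proof -
  assume x: "x \<in> carrier g"
  \<comment> \<open>Coefficients vanish off \<open>B\<close>, so the sum in \<open>is_basis\<close>
    runs over the entire support, as in \<open>lext\<close>.\<close>
  have "{b \<in> B. c b \<noteq> \<zero>} = {b. c b \<noteq> \<zero>}" if "c \<in> carrier FB" for c
    using that by (auto simp: free_module_carrier)
  then have eq: "(c \<in> carrier FB \<and> x = (\<Oplus>\<^bsub>g\<^esub>b\<in>{b \<in> B. c b \<noteq> \<zero>}. c b \<odot>\<^bsub>g\<^esub> b))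
      \<longleftrightarrow> (c \<in> carrier FB \<and> x = lext K g (\<lambda>b. b) c)" for c
    by (auto simp: lext_def)
  have "\<exists>!c. c \<in> carrier FB \<and> x = (\<Oplus>\<^bsub>g\<^esub>b\<in>{b \<in> B. c b \<noteq> \<zero>}. c b \<odot>\<^bsub>g\<^esub> b)"
    using basis x unfolding is_basis_def by blast
  then show ?thesis unfolding eq .
qed

definition coord :: "'a \<Rightarrow> 'a \<Rightarrow> 'k"
  where "coord x = (THE c. c \<in> carrier FB \<and> x = lext K g (\<lambda>b. b) c)"

lemma coord_closed: "x \<in> carrier g \<Longrightarrow> coord x \<in> carrier FB"
  and lext_coord: "x \<in> carrier g \<Longrightarrow> lext K g (\<lambda>b. b) (coord x) = x"
  using theI'[OF ex1_coord, folded coord_def] by auto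

text \<open>Uniqueness of coordinates. Together with \<open>lext_coord\<close> it makes
  \<open>coord\<close> the inverse of a linear bijection, and therefore linear.\<close>

lemma coord_lext:
  assumes "c \<in> carrier FB" shows "coord (lext K g (\<lambda>b. b) c) = c"
  using ex1_coord[OF linmap_closed[OF lext_basis_linmap assms]] assms
    coord_closed[OF linmap_closed[OF lext_basis_linmap assms]]
    lext_coord[OF linmap_closed[OF lext_basis_linmap assms]] by metis

lemma coord_linmap: "coord \<in> linmap K g FB"
proof -
  interpret FB: module K FB by (rule FB_module)
  note l = lext_basis_linmap
  show ?thesis
  proof (rule linmapI)
    fix x y assume xy: "x \<in> carrier g" "y \<in> carrier g"
    have "coord (lext K g (\<lambda>b. b) (coord x \<oplus>\<^bsub>FB\<^esub> coord y)) = coord x \<oplus>\<^bsub>FB\<^esub> coord y"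
      using xy by (simp add: coord_lext coord_closed)
    then show "coord (x \<oplus>\<^bsub>g\<^esub> y) = coord x \<oplus>\<^bsub>FB\<^esub> coord y"
      using xy by (simp add: linmap_add[OF l] coord_closed lext_coord)
  next
    fix a x assume ax: "a \<in> carrier K" "x \<in> carrier g"
    have "coord (lext K g (\<lambda>b. b) (a \<odot>\<^bsub>FB\<^esub> coord x)) = a \<odot>\<^bsub>FB\<^esub> coord x"
      using ax by (simp add: coord_lext coord_closed)
    then show "coord (a \<odot>\<^bsub>g\<^esub> x) = a \<odot>\<^bsub>FB\<^esub> coord x"
      using ax by (simp add: linmap_smult[OF l] coord_closed lext_coord)
  qed (rule coord_closed)
qed

lemma coord_basis: "b \<in> B \<Longrightarrow> coord b = delta K b"
  using coord_lext[OF delta_closed, of b] lext_delta[OF g_module, of "\<lambda>b. b" b] B_closed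
  by simp

lemma g_linmap_eq:
  assumes "module K L" "h \<in> linmap K g L" "k \<in> linmap K g L" "\<And>b. b \<in> B \<Longrightarrow> h b = k b"
    and x: "x \<in> carrier g"
  shows "h x = k x"
proof -
  have "h (lext K g (\<lambda>b. b) (coord x)) = k (lext K g (\<lambda>b. b) (coord x))"
  proof (rule free_linmap_eq[OF assms(1) _ _ _ coord_closed[OF x]])
    fix b assume b: "b \<in> B"
    then show "h (lext K g (\<lambda>b. b) (delta K b)) = k (lext K g (\<lambda>b. b) (delta K b))"
      using assms(4) by (simp add: lext_delta[OF g_module] B_closed)
  qed (use linmap_comp[OF lext_basis_linmap] assms(2,3) in auto)
  then show ?thesis using x by (simp add: lext_coord)
qed

lemma g_subset_submodule:
  assumes "submodule N K g" "B \<subseteq> N"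
  shows "carrier g \<subseteq> N"
proof
  fix x assume x: "x \<in> carrier g"
  have "lext K g (\<lambda>b. b) (coord x) \<in> N"
    by (rule lext_in_submodule[OF g_module assms(1) _ coord_closed[OF x]]) (use assms(2) in auto)
  then show "x \<in> N" using x by (simp add: lext_coord)
qed

section \<open>Monomials and the degree filtration\<close>

definition mons :: "'a multiset set"
  where "mons = {S. set_mset S \<subseteq> B}"

abbreviation "P \<equiv> free_module K mons"
text \<open>The bound is strict: \<open>PL n\<close> holds the polynomials of degree below
  \<open>n\<close>. Hence \<open>PL (Suc (size S))\<close> admits degrees up to that of
  \<open>S\<close>, and \<open>PL n\<close> corresponds to \<open>low n\<close> in the tensor
  algebra.\<close>

abbreviation "PL n \<equiv> free_module K {S \<in> mons. size S < n}"

lemma P_module: "module K P"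
  by (rule free_is_module)

sublocale P: module K P
  by (rule P_module)

lemma PL_submodule: "submodule (carrier (PL n)) K P"
  by (rule free_submodule) auto

lemmas PL_facts = P.submodule_facts[OF PL_submodule]

lemma PL_mono: "n \<le> m \<Longrightarrow> v \<in> carrier (PL n) \<Longrightarrow> v \<in> carrier (PL m)"
  using free_mono[of "{S \<in> mons. size S < n}" "{S \<in> mons. size S < m}"] by force

lemma delta_PL: "S \<in> mons \<Longrightarrow> size S < n \<Longrightarrow> delta K S \<in> carrier (PL n)"
  by (rule delta_closed) simp

lemma add_mset_mons: "\<lbrakk>x \<in> B; S \<in> mons\<rbrakk> \<Longrightarrow> add_mset x S \<in> mons"
  by (simp add: mons_def)

definition below :: "'a \<Rightarrow> 'a multiset \<Rightarrow> bool"
  where "below x S \<longleftrightarrow> (\<forall>y\<in>#S. le x y)"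

definition least :: "'a multiset \<Rightarrow> 'a"
  where "least S = (SOME y. y \<in># S \<and> below y S)"

lemma least_exists: "S \<noteq> {#} \<Longrightarrow> \<exists>y. y \<in># S \<and> below y S"
proof (induction S)
  case (add x S)
  show ?case
  proof (cases "S = {#}")
    case True
    then show ?thesis using le_refl by (auto simp: below_def)
  next
    case False
    then obtain y where "y \<in># S" "below y S" using add by blast
    then show ?thesis using le_total[of x y] le_refl[of x] le_trans[of x y] unfolding below_def
      by (metis add_mset_remove_trivial insert_iff set_mset_add_mset_insert)
  qed
qed simp

lemma least: "S \<noteq> {#} \<Longrightarrow> least S \<in># S" "S \<noteq> {#} \<Longrightarrow> below (least S) S"
  unfolding least_def using someI_ex[OF least_exists] by auto

text \<open>Antisymmetry makes the least element unique; \<open>rho_swap\<close> relies on this to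
  know which factor the recursion peels off.\<close>

lemma least_eq: "below y S \<Longrightarrow> least (add_mset y S) = y"
proof -
  assume y: "below y S"
  have "least (add_mset y S) \<in># add_mset y S" "below (least (add_mset y S)) (add_mset y S)"
    by (rule least; simp)+
  then show ?thesis using y le_antisym by (auto simp: below_def)
qed

text \<open>For \<open>y\<close> minimal in \<open>S = y + T\<close> and \<open>y < x\<close>, the relation \<open>x y = y x + [x, y]\<close> forces
  \<open>x \<cdot> z\<^sub>S = y \<cdot> (x \<cdot> z\<^sub>T) + [x, y] \<cdot> z\<^sub>T\<close>; the leading term of \<open>y \<cdot> (x \<cdot> z\<^sub>T)\<close> is split off so that only
  products with monomials of size less than that of \<open>S\<close> remain. The first argument is fuel.\<close>

primrec act_fuel :: "nat \<Rightarrow> 'a \<Rightarrow> 'a multiset \<Rightarrow> 'a multiset \<Rightarrow> 'k"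
  where
    "act_fuel 0 x S = delta K (add_mset x S)"
  | "act_fuel (Suc n) x S =
      (if below x S then delta K (add_mset x S)
       else (let y = least S; T = S - {#y#} in
         delta K (add_mset x S)
         \<oplus>\<^bsub>P\<^esub> lext K P (act_fuel n y) (act_fuel n x T \<ominus>\<^bsub>P\<^esub> delta K (add_mset x T))
         \<oplus>\<^bsub>P\<^esub> lext K P (\<lambda>d. act_fuel n d T) (coord (br x y))))"

lemma not_below_split:
  assumes "\<not> below x S" "S \<in> mons"
  shows "least S \<in> B" "S - {#least S#} \<in> mons" "size S = Suc (size (S - {#least S#}))"
proof -
  have "S \<noteq> {#}" using assms by (auto simp: below_def)
  then have l: "least S \<in># S" by (rule least)
  then show "least S \<in> B" "S - {#least S#} \<in> mons" using assms
    by (auto simp: mons_def dest: in_diffD)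
  show "size S = Suc (size (S - {#least S#}))"
    using l by (metis insert_DiffM size_add_mset)
qed

text \<open>The bound holds for every amount of fuel because the default value at fuel 0 is the
  leading monomial itself. In the recursive case the product of \<open>x\<close> with
  \<open>T\<close>, freed of its leading term, has degree at most \<open>size T\<close>, so acting
  with \<open>y\<close> gives degree at most \<open>size S\<close>; the same bound holds for
  \<open>br x y\<close> acting on \<open>T\<close>.\<close>

lemma act_fuel_leading:
  assumes "x \<in> B" "S \<in> mons"
  shows "act_fuel n x S \<in> carrier P \<and>
    act_fuel n x S \<ominus>\<^bsub>P\<^esub> delta K (add_mset x S) \<in> carrier (PL (Suc (size S)))"
  using assms
proof (induction n arbitrary: x S)
  case 0
  then show ?case using delta_closed[OF add_mset_mons] PL_facts(1)
    by (simp add: P.M.diff_self)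
next
  case (Suc n)
  have d: "delta K (add_mset x S) \<in> carrier P"
    using Suc.prems by (intro delta_closed add_mset_mons)
  show ?case
  proof (cases "below x S")
    case True
    then show ?thesis using d PL_facts(1) by (simp add: P.M.diff_self)
  next
    case False
    define y where "y = least S"
    define T where "T = S - {#y#}"
    have y: "y \<in> B" and T: "T \<in> mons" and size: "size S = Suc (size T)"
      using not_below_split[OF False Suc.prems(2)] by (simp_all add: y_def T_def)
    \<comment> \<open>Acting on a monomial smaller than \<open>S\<close> raises its degree by at
      most one, hence to at most \<open>size S\<close>.\<close>
    have top: "act_fuel n u U \<in> carrier (PL (Suc (size S)))" if "u \<in> B" "U \<in> mons" "size U < size S" for u U
    proof -
      have "act_fuel n u U \<ominus>\<^bsub>P\<^esub> delta K (add_mset u U) \<in> carrier (PL (Suc (size S)))"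
        using Suc.IH[OF that(1,2)] that(3) PL_mono[of "Suc (size U)" "Suc (size S)"] by simp
      moreover have "delta K (add_mset u U) \<in> carrier (PL (Suc (size S)))"
        using that by (intro delta_PL add_mset_mons) auto
      ultimately have "act_fuel n u U \<ominus>\<^bsub>P\<^esub> delta K (add_mset u U) \<oplus>\<^bsub>P\<^esub> delta K (add_mset u U)
          \<in> carrier (PL (Suc (size S)))"
        by (rule PL_facts(3))
      then show ?thesis
        using Suc.IH[OF that(1,2)] delta_closed[OF add_mset_mons[OF that(1,2)]]
        by (simp add: a_minus_def P.M.a_assoc P.M.l_neg)
    qed
    have 1: "lext K P (act_fuel n y) (act_fuel n x T \<ominus>\<^bsub>P\<^esub> delta K (add_mset x T))
        \<in> carrier (PL (Suc (size S)))" (is "?a \<in> _")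
      by (rule lext_in_submodule[OF P_module PL_submodule, of "{S \<in> mons. size S < Suc (size T)}"])
        (use top y T Suc.IH[OF Suc.prems(1) T] size in auto)
    have 2: "lext K P (\<lambda>d. act_fuel n d T) (coord (br x y)) \<in> carrier (PL (Suc (size S)))" (is "?b \<in> _")
      by (rule lext_in_submodule[OF P_module PL_submodule _ coord_closed[OF br_closed[OF B_closed B_closed]]])
        (use top T size Suc.prems(1) y in auto)
    have "act_fuel (Suc n) x S = delta K (add_mset x S) \<oplus>\<^bsub>P\<^esub> ?a \<oplus>\<^bsub>P\<^esub> ?b"
      using False by (simp add: Let_def y_def T_def)
    moreover have "delta K (add_mset x S) \<oplus>\<^bsub>P\<^esub> ?a \<oplus>\<^bsub>P\<^esub> ?b \<ominus>\<^bsub>P\<^esub> delta K (add_mset x S) = ?a \<oplus>\<^bsub>P\<^esub> ?b"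
      using d PL_facts(2)[OF 1] PL_facts(2)[OF 2]
      by (simp add: a_minus_def P.M.a_ac P.M.r_neg P.M.r_neg1 P.M.r_neg2)
    ultimately show ?thesis
      using 1 2 d by (simp add: PL_facts)
  qed
qed

lemma act_fuel_closed: "\<lbrakk>x \<in> B; S \<in> mons\<rbrakk> \<Longrightarrow> act_fuel n x S \<in> carrier P"
  using act_fuel_leading by blast

text \<open>Every recursive call concerns a monomial smaller than \<open>S\<close>, so fuel
  \<open>size S\<close> is sufficient and more changes nothing. For the outer action of
  \<open>y\<close> this depends on the leading monomial having been subtracted, which leaves only
  monomials no larger than \<open>T\<close>.\<close>

lemma act_fuel_Suc:
  assumes "x \<in> B" "S \<in> mons" "size S \<le> n"
  shows "act_fuel (Suc n) x S = act_fuel n x S"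
  using assms
proof (induction n arbitrary: x S)
  case 0
  then show ?case by (simp add: below_def)
next
  case (Suc n)
  show ?case
  proof (cases "below x S")
    case True
    then show ?thesis by simp
  next
    case False
    define y where "y = least S"
    define T where "T = S - {#y#}"
    have y: "y \<in> B" and T: "T \<in> mons" and size: "size S = Suc (size T)"
      using not_below_split[OF False Suc.prems(2)] by (simp_all add: y_def T_def)
    have IH: "act_fuel (Suc n) u U = act_fuel n u U" if "u \<in> B" "U \<in> mons" "size U < size S" for u U
      using Suc.IH[of u U] that Suc.prems(3) by simp
    have a: "lext K P (act_fuel (Suc n) y) (act_fuel n x T \<ominus>\<^bsub>P\<^esub> delta K (add_mset x T))
        = lext K P (act_fuel n y) (act_fuel n x T \<ominus>\<^bsub>P\<^esub> delta K (add_mset x T))"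
      by (rule lext_cong[OF P_module, of "{S \<in> mons. size S < Suc (size T)}"])
        (use act_fuel_closed y T Suc.prems IH size act_fuel_leading[OF Suc.prems(1) T] in
          \<open>auto simp del: act_fuel.simps\<close>)
    have b: "lext K P (\<lambda>d. act_fuel (Suc n) d T) (coord (br x y)) = lext K P (\<lambda>d. act_fuel n d T) (coord (br x y))"
      by (rule lext_cong[OF P_module _ _ coord_closed[OF br_closed[OF B_closed B_closed]]])
        (use act_fuel_closed y T Suc.prems IH size in \<open>auto simp del: act_fuel.simps\<close>)
    have c: "act_fuel (Suc n) x T = act_fuel n x T"
      using IH[OF Suc.prems(1) T] size by simp
    have step: "act_fuel (Suc m) x S = delta K (add_mset x S)
         \<oplus>\<^bsub>P\<^esub> lext K P (act_fuel m y) (act_fuel m x T \<ominus>\<^bsub>P\<^esub> delta K (add_mset x T))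
         \<oplus>\<^bsub>P\<^esub> lext K P (\<lambda>d. act_fuel m d T) (coord (br x y))" for m
      using False by (simp add: Let_def y_def T_def)
    show ?thesis unfolding step[of "Suc n"] step[of n] c a b ..
  qed
qed

definition act :: "'a \<Rightarrow> 'a multiset \<Rightarrow> 'a multiset \<Rightarrow> 'k"
  where "act x S = act_fuel (size S) x S"

lemma act_fuel_eq_act: "\<lbrakk>x \<in> B; S \<in> mons; size S \<le> n\<rbrakk> \<Longrightarrow> act_fuel n x S = act x S"
proof (induction n)
  case (Suc n)
  then show ?case by (cases "size S = Suc n") (simp_all add: act_def act_fuel_Suc del: act_fuel.simps)
qed (simp add: act_def)

lemma act_closed: "\<lbrakk>x \<in> B; S \<in> mons\<rbrakk> \<Longrightarrow> act x S \<in> carrier P"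
  unfolding act_def by (rule act_fuel_closed)

lemma act_leading: "\<lbrakk>x \<in> B; S \<in> mons\<rbrakk>
    \<Longrightarrow> act x S \<ominus>\<^bsub>P\<^esub> delta K (add_mset x S) \<in> carrier (PL (Suc (size S)))"
  unfolding act_def using act_fuel_leading by blast

lemma act_below: "below x S \<Longrightarrow> act x S = delta K (add_mset x S)"
  unfolding act_def by (cases "size S") simp_all

section \<open>Bilinear extension of the action to all of \<open>g\<close> and
  \<open>P\<close>\<close>

definition rho :: "'a \<Rightarrow> ('a multiset \<Rightarrow> 'k) \<Rightarrow> 'a multiset \<Rightarrow> 'k"
  where "rho x v = lext K P (\<lambda>d. lext K P (act d) v) (coord x)"

lemma lext_act_linmap: "d \<in> B \<Longrightarrow> lext K P (act d) \<in> linmap K P P"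
  by (rule lext_linmap[OF P_module]) (rule act_closed)

lemma lext_act_closed: "\<lbrakk>d \<in> B; v \<in> carrier P\<rbrakk> \<Longrightarrow> lext K P (act d) v \<in> carrier P"
  by (rule linmap_closed[OF lext_act_linmap])

lemma rho_linmap_left: "v \<in> carrier P \<Longrightarrow> (\<lambda>x. rho x v) \<in> linmap K g P"
  unfolding rho_def
  by (rule linmap_comp[OF coord_linmap lext_linmap[OF P_module]]) (rule lext_act_closed)

lemma rho_basis: "\<lbrakk>x \<in> B; v \<in> carrier P\<rbrakk> \<Longrightarrow> rho x v = lext K P (act x) v"
  unfolding rho_def by (simp add: coord_basis lext_delta[OF P_module] lext_act_closed)

lemma rho_closed: "\<lbrakk>x \<in> carrier g; v \<in> carrier P\<rbrakk> \<Longrightarrow> rho x v \<in> carrier P"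
  by (rule linmap_closed[OF rho_linmap_left])

text \<open>Linearity in the Lie algebra element is already known, so the identities in
  \<open>v\<close> need only be checked for basis elements, where \<open>rho\<close> is a
  \<open>lext\<close>.\<close>

lemma rho_linmap_right:
  assumes x: "x \<in> carrier g"
  shows "rho x \<in> linmap K P P"
proof (rule linmapI)
  fix v w assume v: "v \<in> carrier P" and w: "w \<in> carrier P"
  show "rho x (v \<oplus>\<^bsub>P\<^esub> w) = rho x v \<oplus>\<^bsub>P\<^esub> rho x w"
  proof (rule g_linmap_eq[OF P_module _ _ _ x])
    show "(\<lambda>x. rho x (v \<oplus>\<^bsub>P\<^esub> w)) \<in> linmap K g P" using v w by (simp add: rho_linmap_left)
    show "(\<lambda>x. rho x v \<oplus>\<^bsub>P\<^esub> rho x w) \<in> linmap K g P"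
      using v w by (intro linmap_plus g_module P_module rho_linmap_left)
    show "rho b (v \<oplus>\<^bsub>P\<^esub> w) = rho b v \<oplus>\<^bsub>P\<^esub> rho b w" if "b \<in> B" for b
      using that v w by (simp add: rho_basis linmap_add[OF lext_act_linmap])
  qed
next
  fix a v assume a: "a \<in> carrier K" and v: "v \<in> carrier P"
  show "rho x (a \<odot>\<^bsub>P\<^esub> v) = a \<odot>\<^bsub>P\<^esub> rho x v"
  proof (rule g_linmap_eq[OF P_module _ _ _ x])
    show "(\<lambda>x. rho x (a \<odot>\<^bsub>P\<^esub> v)) \<in> linmap K g P" using v a by (simp add: rho_linmap_left)
    show "(\<lambda>x. a \<odot>\<^bsub>P\<^esub> rho x v) \<in> linmap K g P"
      using v a by (intro linmap_scale P_module rho_linmap_left)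
    show "rho b (a \<odot>\<^bsub>P\<^esub> v) = a \<odot>\<^bsub>P\<^esub> rho b v" if "b \<in> B" for b
      using that a v by (simp add: rho_basis linmap_smult[OF lext_act_linmap])
  qed
qed (use x rho_closed in auto)

lemma rho_delta: "\<lbrakk>x \<in> B; S \<in> mons\<rbrakk> \<Longrightarrow> rho x (delta K S) = act x S"
  by (simp add: rho_basis delta_closed lext_delta[OF P_module] act_closed)

lemma rho_below: "\<lbrakk>x \<in> B; S \<in> mons; below x S\<rbrakk> \<Longrightarrow> rho x (delta K S) = delta K (add_mset x S)"
  by (simp add: rho_delta act_below)

lemma rho_leading:
  assumes "x \<in> B" "S \<in> mons"
  obtains q where "q \<in> carrier (PL (Suc (size S)))" "rho x (delta K S) = delta K (add_mset x S) \<oplus>\<^bsub>P\<^esub> q"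
proof
  let ?d = "delta K (add_mset x S)"
  show "act x S \<ominus>\<^bsub>P\<^esub> ?d \<in> carrier (PL (Suc (size S)))" using assms by (rule act_leading)
  show "rho x (delta K S) = ?d \<oplus>\<^bsub>P\<^esub> (act x S \<ominus>\<^bsub>P\<^esub> ?d)"
    using assms act_closed[OF assms] delta_closed[OF add_mset_mons[OF assms]]
    by (simp add: rho_delta P.M.add_diff_self)
qed

lemma rho_PL:
  assumes "x \<in> carrier g" "v \<in> carrier (PL n)"
  shows "rho x v \<in> carrier (PL (Suc n))"
  unfolding rho_def
proof (rule lext_in_submodule[OF P_module PL_submodule _ coord_closed[OF assms(1)]])
  fix d assume d: "d \<in> B"
  show "lext K P (act d) v \<in> carrier (PL (Suc n))"
  proof (rule lext_in_submodule[OF P_module PL_submodule _ assms(2)])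
    fix S assume S: "S \<in> {S \<in> mons. size S < n}"
    obtain q where q: "q \<in> carrier (PL (Suc (size S)))"
        "rho d (delta K S) = delta K (add_mset d S) \<oplus>\<^bsub>P\<^esub> q"
      by (rule rho_leading[OF d]) (use S in auto)
    have "q \<in> carrier (PL (Suc n))" using PL_mono[OF _ q(1)] S by simp
    moreover have "delta K (add_mset d S) \<in> carrier (PL (Suc n))"
      using S d by (intro delta_PL add_mset_mons) auto
    ultimately show "act d S \<in> carrier (PL (Suc n))"
      using q(2) S d by (simp add: rho_delta PL_facts(3))
  qed
qed

text \<open>This is the recursive clause of the action for the monomial \<open>add_mset y S\<close>,
  whose least element is \<open>y\<close>, with the split-off leading term put back.\<close>

lemma rho_swap:
  assumes x: "x \<in> B" and y: "y \<in> B" and S: "S \<in> mons" and yx: "le y x" "x \<noteq> y" and yS: "below y S"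
  shows "rho x (rho y (delta K S)) = rho y (rho x (delta K S)) \<oplus>\<^bsub>P\<^esub> rho (br x y) (delta K S)"
proof -
  define U where "U = add_mset y S"
  have U: "U \<in> mons" using y S by (simp add: U_def add_mset_mons)
  have nb: "\<not> below x U" using yx le_antisym by (auto simp: U_def below_def)
  have least: "least U = y" "U - {#y#} = S" using least_eq[OF yS] by (simp_all add: U_def)
  have size: "size U = Suc (size S)" by (simp add: U_def)
  have br: "br x y \<in> carrier g" using x y B_closed br_closed by blast
  let ?d = "delta K (add_mset x S)"
  have d: "?d \<in> carrier P" using x S by (intro delta_closed add_mset_mons)
  have S': "delta K S \<in> carrier P" using S by (rule delta_closed)
  \<comment> \<open>As \<open>y\<close> is at most \<open>x\<close> and every element of
    \<open>S\<close>, the leading monomial of the product of \<open>x\<close> with \<open>U\<close>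
    is exactly \<open>y\<close> acting on \<open>add_mset x S\<close>.\<close>
  have xy: "delta K (add_mset x U) = rho y ?d"
  proof -
    have "below y (add_mset x S)" using yS yx by (simp add: below_def)
    then show ?thesis
      using rho_below[OF y add_mset_mons[OF x S]] by (simp add: U_def add_mset_commute)
  qed
  have fS: "act_fuel (size S) x S = act x S" by (simp add: act_def)
  \<comment> \<open>The corrected product contains only monomials of size at most
    \<open>size S\<close>, for which this fuel is sufficient.\<close>
  have a: "lext K P (act_fuel (size S) y) (act x S \<ominus>\<^bsub>P\<^esub> ?d) = rho y (act x S \<ominus>\<^bsub>P\<^esub> ?d)"
    unfolding rho_basis[OF y PL_facts(2)[OF act_leading[OF x S]]]
    by (rule lext_cong[OF P_module _ _ act_leading[OF x S]])
      (use y act_fuel_closed act_fuel_eq_act act_closed in auto)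
  have b: "lext K P (\<lambda>d. act_fuel (size S) d S) (coord (br x y)) = rho (br x y) (delta K S)"
    unfolding rho_def
  proof (rule lext_cong[OF P_module _ _ coord_closed[OF br]])
    fix d assume "d \<in> B"
    then show "act_fuel (size S) d S \<in> carrier P"
        "act_fuel (size S) d S = lext K P (act d) (delta K S)"
      using S by (simp_all add: act_fuel_closed act_fuel_eq_act lext_delta[OF P_module] act_closed)
  qed
  have "rho x (rho y (delta K S)) = act_fuel (Suc (size S)) x U"
    using rho_below[OF y S yS] rho_delta[OF x U] by (simp add: U_def act_def del: act_fuel.simps)
  also have "\<dots> = delta K (add_mset x U) \<oplus>\<^bsub>P\<^esub> rho y (act x S \<ominus>\<^bsub>P\<^esub> ?d) \<oplus>\<^bsub>P\<^esub> rho (br x y) (delta K S)"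
    using nb by (simp add: Let_def least fS a b)
  also have "\<dots> = rho y (?d \<oplus>\<^bsub>P\<^esub> (act x S \<ominus>\<^bsub>P\<^esub> ?d)) \<oplus>\<^bsub>P\<^esub> rho (br x y) (delta K S)"
    unfolding xy using d act_closed[OF x S] linmap_add[OF rho_linmap_right[OF B_closed[OF y]]] by simp
  also have "?d \<oplus>\<^bsub>P\<^esub> (act x S \<ominus>\<^bsub>P\<^esub> ?d) = rho x (delta K S)"
    using d act_closed[OF x S] rho_delta[OF x S]
    by (simp add: P.M.add_diff_self)
  finally show ?thesis .
qed

end

section \<open>The action is a representation\<close>

context lie_algebra
begin

lemma br_linmap_left: "y \<in> carrier g \<Longrightarrow> (\<lambda>x. br x y) \<in> linmap K g g"
  by (rule linmapI) (simp_all add: br_closed br_add_left br_smult_left)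

lemma br_linmap_right: "x \<in> carrier g \<Longrightarrow> br x \<in> linmap K g g"
  by (rule linmapI) (simp_all add: br_closed br_add_right br_smult_right)

lemma br_anti:
  assumes x: "x \<in> carrier g" and y: "y \<in> carrier g"
  shows "br y x = \<ominus>\<^bsub>g\<^esub> br x y"
proof -
  have "br (y \<oplus>\<^bsub>g\<^esub> x) (y \<oplus>\<^bsub>g\<^esub> x) = br y (y \<oplus>\<^bsub>g\<^esub> x) \<oplus>\<^bsub>g\<^esub> br x (y \<oplus>\<^bsub>g\<^esub> x)"
    using x y by (intro br_add_left) auto
  also have "\<dots> = br y x \<oplus>\<^bsub>g\<^esub> br x y"
    using x y br_closed by (simp add: br_add_right br_self)
  finally have "br y x \<oplus>\<^bsub>g\<^esub> br x y = \<zero>\<^bsub>g\<^esub>"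
    using x y br_self[of "y \<oplus>\<^bsub>g\<^esub> x"] by simp
  then show ?thesis
    using x y br_closed by (simp add: M.minus_equality)
qed

text \<open>The Jacobi identity in the form that bracketing with \<open>w\<close> on the right is a
  derivation, as required when \<open>w\<close> is moved past both \<open>x\<close> and
  \<open>y\<close>.\<close>

lemma jacobi':
  assumes x: "x \<in> carrier g" and y: "y \<in> carrier g" and w: "w \<in> carrier g"
  shows "br (br x y) w = br (br x w) y \<oplus>\<^bsub>g\<^esub> br x (br y w)"
proof -
  note c = br_closed x y w
  have *: "br x (br y w) \<oplus>\<^bsub>g\<^esub> br y (br w x) \<oplus>\<^bsub>g\<^esub> br w (br x y) = \<zero>\<^bsub>g\<^esub>"
    by (rule jacobi[OF x y w])
  have 1: "br w (br x y) = \<ominus>\<^bsub>g\<^esub> br (br x y) w" using c by (intro br_anti) auto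
  have "br y (br w x) = \<ominus>\<^bsub>g\<^esub> br y (br x w)"
    using c linmap_neg[OF module_axioms module_axioms br_linmap_right[OF y]] br_anti[OF x w] by simp
  also have "\<dots> = br (br x w) y" using c br_anti[of y "br x w"] by simp
  finally have 2: "br y (br w x) = br (br x w) y" .
  have "(br x (br y w) \<oplus>\<^bsub>g\<^esub> br (br x w) y) \<ominus>\<^bsub>g\<^esub> br (br x y) w = \<zero>\<^bsub>g\<^esub>"
    using * unfolding 1 2 by (simp add: a_minus_def)
  then have "br x (br y w) \<oplus>\<^bsub>g\<^esub> br (br x w) y = br (br x y) w"
    using c by (subst (asm) M.diff_eq_zero_iff) auto
  then show ?thesis using c by (simp add: M.a_comm)
qed

end

context lie_basis
begin

text \<open>The representation property at a single vector, so that it can be proved by induction on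
  the degree of that vector.\<close>

definition comm :: "'a \<Rightarrow> 'a \<Rightarrow> ('a multiset \<Rightarrow> 'k) \<Rightarrow> bool"
  where "comm x y v \<longleftrightarrow> rho x (rho y v) = rho y (rho x v) \<oplus>\<^bsub>P\<^esub> rho (br x y) v"

lemma comm_self:
  assumes "x \<in> carrier g" "v \<in> carrier P"
  shows "comm x x v"
  using assms linmap_zero[OF g_module P_module rho_linmap_left[OF assms(2)]]
  by (simp add: comm_def br_self rho_closed)

lemma comm_sym:
  assumes x: "x \<in> carrier g" and y: "y \<in> carrier g" and v: "v \<in> carrier P" and c: "comm x y v"
  shows "comm y x v"
proof -
  have "rho (br y x) v = \<ominus>\<^bsub>P\<^esub> rho (br x y) v"
    using linmap_neg[OF g_module P_module rho_linmap_left[OF v]] x y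
    by (simp add: br_anti[OF x y] br_closed)
  then show ?thesis
    using c x y v by (simp add: comm_def rho_closed br_closed P.M.a_assoc P.M.r_neg)
qed

text \<open>Both sides are linear in each of \<open>x\<close> and \<open>y\<close> while the other
  is fixed, so the arguments are freed one at a time, first \<open>x\<close> against a basis element
  and then \<open>y\<close>.\<close>

lemma comm_basis:
  assumes v: "v \<in> carrier P" and c: "\<And>a b. \<lbrakk>a \<in> B; b \<in> B\<rbrakk> \<Longrightarrow> comm a b v"
    and x: "x \<in> carrier g" and y: "y \<in> carrier g"
  shows "comm x y v"
proof -
  have *: "comm x b v" if b: "b \<in> B" for b
    unfolding comm_def
  proof (rule g_linmap_eq[OF P_module _ _ _ x])
    note bg = B_closed[OF b]
    show "(\<lambda>x. rho x (rho b v)) \<in> linmap K g P"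
      using bg v by (intro rho_linmap_left rho_closed)
    show "(\<lambda>x. rho b (rho x v) \<oplus>\<^bsub>P\<^esub> rho (br x b) v) \<in> linmap K g P"
      by (intro linmap_plus g_module P_module linmap_comp[OF rho_linmap_left[OF v] rho_linmap_right[OF bg]]
          linmap_comp[OF br_linmap_left[OF bg] rho_linmap_left[OF v]])
    show "rho a (rho b v) = rho b (rho a v) \<oplus>\<^bsub>P\<^esub> rho (br a b) v" if "a \<in> B" for a
      using c[OF that b] by (simp add: comm_def)
  qed
  show ?thesis
    unfolding comm_def
  proof (rule g_linmap_eq[OF P_module _ _ _ y])
    show "(\<lambda>y. rho x (rho y v)) \<in> linmap K g P"
      by (rule linmap_comp[OF rho_linmap_left[OF v] rho_linmap_right[OF x]])
    show "(\<lambda>y. rho y (rho x v) \<oplus>\<^bsub>P\<^esub> rho (br x y) v) \<in> linmap K g P"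
      using x v by (intro linmap_plus g_module P_module rho_linmap_left rho_closed
          linmap_comp[OF br_linmap_right[OF x] rho_linmap_left[OF v]])
    show "rho x (rho b v) = rho b (rho x v) \<oplus>\<^bsub>P\<^esub> rho (br x b) v" if "b \<in> B" for b
      using *[OF that] by (simp add: comm_def)
  qed
qed

lemma comm_linmaps:
  assumes x: "x \<in> carrier g" and y: "y \<in> carrier g"
  shows "(\<lambda>v. rho x (rho y v)) \<in> linmap K P P"
    and "(\<lambda>v. rho y (rho x v) \<oplus>\<^bsub>P\<^esub> rho (br x y) v) \<in> linmap K P P"
  by (intro linmap_plus P_module linmap_comp[OF rho_linmap_right rho_linmap_right] rho_linmap_right
      br_closed x y)+

text \<open>Both sides are linear in \<open>v\<close>. With \<open>Q\<close> a set of small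
  monomials, an induction hypothesis about monomials becomes one about all polynomials of low
  degree.\<close>

lemma comm_free:
  assumes x: "x \<in> carrier g" and y: "y \<in> carrier g" and Q: "Q \<subseteq> mons"
    and c: "\<And>S. S \<in> Q \<Longrightarrow> comm x y (delta K S)" and v: "v \<in> carrier (free_module K Q)"
  shows "comm x y v"
  unfolding comm_def
  by (rule free_linmap_eq[OF P_module linmap_free_mono[OF comm_linmaps(1)[OF x y] Q]
      linmap_free_mono[OF comm_linmaps(2)[OF x y] Q] _ v])
    (use c in \<open>simp add: comm_def\<close>)

lemma comm_delta:
  assumes "S \<in> mons" "x \<in> carrier g" "y \<in> carrier g"
  shows "comm x y (delta K S)"
  using assms
proof (induction "size S" arbitrary: S x y rule: less_induct)
  case less
  have S: "S \<in> mons" by fact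
  have dS: "delta K S \<in> carrier P" using S by (rule delta_closed)
  have IH: "comm p q v" if "p \<in> carrier g" "q \<in> carrier g" "v \<in> carrier (PL (size S))" for p q v
    using less.hyps that by (intro comm_free[OF _ _ _ _ that(3)]) auto
  \<comment> \<open>Basis elements with \<open>y\<close> smaller than \<open>x\<close> suffice: the
    remaining pairs follow at the end by antisymmetry, the case of equality and bilinearity.\<close>
  have *: "comm x y (delta K S)" if x: "x \<in> B" and y: "y \<in> B" and yx: "le y x" "x \<noteq> y" for x y
  proof (cases "below y S")
    case True
    then show ?thesis using rho_swap[OF x y S yx] by (simp add: comm_def)
  next
    case False
    define w where "w = least S"
    define T where "T = S - {#w#}"
    note split = not_below_split[OF False S, folded w_def, folded T_def]
    have w: "w \<in> B" and T: "T \<in> mons" and size: "size S = Suc (size T)" by (rule split)+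
    have "S \<noteq> {#}" using size by auto
    then have wS: "below w S" and ST: "S = add_mset w T" using least[of S] by (auto simp: w_def T_def)
    then have wT: "below w T" by (simp add: below_def)
    have wy: "le w y" "y \<noteq> w"
      using False wS le_total[of w y] le_trans[of y w] by (auto simp: below_def)
    have wx: "le w x" "x \<noteq> w" using wy yx le_trans le_antisym by blast+
    note g = B_closed[OF x] B_closed[OF y] B_closed[OF w]
    define u where "u = delta K T"
    have uL: "u \<in> carrier (PL (size S))" unfolding u_def using T size by (intro delta_PL) auto
    have u: "u \<in> carrier P" by (rule PL_facts(2)[OF uL])
    have Su: "delta K S = rho w u" unfolding u_def ST using rho_below[OF w T wT] by simp
    \<comment> \<open>The vector \<open>rho q u\<close> may have degree \<open>size S\<close>, out
      of reach of \<open>IH\<close>. In its leading monomial \<open>w\<close> is still at most every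
      factor, so \<open>rho_swap\<close> applies there, and the remainder \<open>r\<close> has
      degree less than \<open>size S\<close>.\<close>
    have swap: "comm p w (rho q u)"
      if p: "p \<in> B" and q: "q \<in> B" and wp: "le w p" "p \<noteq> w" and wq: "le w q" for p q
    proof -
      obtain r where r: "r \<in> carrier (PL (Suc (size T)))" "rho q u = delta K (add_mset q T) \<oplus>\<^bsub>P\<^esub> r"
        unfolding u_def by (rule rho_leading[OF q T])
      have bq: "below w (add_mset q T)" using wq wT by (simp add: below_def)
      have 1: "comm p w (delta K (add_mset q T))"
        using rho_swap[OF p w add_mset_mons[OF q T] wp bq] by (simp add: comm_def)
      have 2: "comm p w r" using IH[OF B_closed[OF p] B_closed[OF w]] r(1) size by simp
      have rP: "r \<in> carrier P" by (rule PL_facts(2)[OF r(1)])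
      have dP: "delta K (add_mset q T) \<in> carrier P" using q T by (intro delta_closed add_mset_mons)
      note lin = comm_linmaps[OF B_closed[OF p] B_closed[OF w]]
      show ?thesis
        using 1 2 linmap_add[OF lin(1) dP rP] linmap_add[OF lin(2) dP rP]
        unfolding comm_def r(2) by simp
    qed
    note E1 = IH[OF g(2,3) uL, unfolded comm_def]
    note E1' = IH[OF g(1,3) uL, unfolded comm_def]
    note E2 = swap[OF x y wx wy(1), unfolded comm_def]
    note E2' = swap[OF y x wy wx(1), unfolded comm_def]
    note E3 = IH[OF br_closed[OF g(1,3)] g(2) uL, unfolded comm_def]
    note E4 = IH[OF g(1) br_closed[OF g(2,3)] uL, unfolded comm_def]
    note E5 = IH[OF g(1,2) uL, unfolded comm_def]
    note E6 = IH[OF br_closed[OF g(1,2)] g(3) uL, unfolded comm_def]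
    note cl = rho_closed br_closed g u P.M.add.m_closed
    note add = linmap_add[OF rho_linmap_right]
    have J: "rho (br (br x y) w) u = rho (br (br x w) y) u \<oplus>\<^bsub>P\<^esub> rho (br x (br y w)) u"
      unfolding jacobi'[OF g] by (rule linmap_add[OF rho_linmap_left[OF u]]) (intro cl)+
    \<comment> \<open>With these terms kept opaque, the claim reduces to regrouping:
      \<open>a + b + c + d + e + f\<close> against \<open>a + e + c\<close> plus
      \<open>b + d + f\<close>.\<close>
    define a b c d e f where "a = rho w (rho y (rho x u))" and "b = rho w (rho (br x y) u)"
      and "c = rho y (rho (br x w) u)" and "d = rho (br (br x w) y) u"
      and "e = rho (br y w) (rho x u)" and "f = rho (br x (br y w)) u"
    note defs = a_def b_def c_def d_def e_def f_def
    have abc: "a \<in> carrier P" "b \<in> carrier P" "c \<in> carrier P" "d \<in> carrier P" "e \<in> carrier P" "f \<in> carrier P"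
      unfolding defs by (intro cl)+
    have "rho x (rho y (delta K S)) = rho x (rho w (rho y u)) \<oplus>\<^bsub>P\<^esub> rho x (rho (br y w) u)"
      unfolding Su E1 by (rule add) (intro cl)+
    also have "rho x (rho w (rho y u)) = rho w (rho y (rho x u) \<oplus>\<^bsub>P\<^esub> rho (br x y) u) \<oplus>\<^bsub>P\<^esub> (c \<oplus>\<^bsub>P\<^esub> d)"
      unfolding E2 E3 E5 c_def d_def ..
    also have "rho w (rho y (rho x u) \<oplus>\<^bsub>P\<^esub> rho (br x y) u) = a \<oplus>\<^bsub>P\<^esub> b"
      unfolding a_def b_def by (rule add) (intro cl)+
    also have "rho x (rho (br y w) u) = e \<oplus>\<^bsub>P\<^esub> f"
      unfolding E4 e_def f_def ..
    finally have XY: "rho x (rho y (delta K S)) = a \<oplus>\<^bsub>P\<^esub> b \<oplus>\<^bsub>P\<^esub> (c \<oplus>\<^bsub>P\<^esub> d) \<oplus>\<^bsub>P\<^esub> (e \<oplus>\<^bsub>P\<^esub> f)" .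
    have "rho y (rho x (delta K S)) = rho y (rho w (rho x u)) \<oplus>\<^bsub>P\<^esub> rho y (rho (br x w) u)"
      unfolding Su E1' by (rule add) (intro cl)+
    also have "\<dots> = a \<oplus>\<^bsub>P\<^esub> e \<oplus>\<^bsub>P\<^esub> c"
      unfolding E2' a_def e_def c_def ..
    finally have YX: "rho y (rho x (delta K S)) = a \<oplus>\<^bsub>P\<^esub> e \<oplus>\<^bsub>P\<^esub> c" .
    have Z: "rho (br x y) (delta K S) = b \<oplus>\<^bsub>P\<^esub> (d \<oplus>\<^bsub>P\<^esub> f)"
      unfolding Su E6 J b_def d_def f_def ..
    show ?thesis
      unfolding comm_def XY YX Z using abc by (simp add: P.M.a_ac)
  qed
  have "comm x y (delta K S)" if x: "x \<in> B" and y: "y \<in> B" for x y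
    using le_total[of x y] *[OF x y] *[OF y x] comm_self[OF B_closed[OF x] dS]
      comm_sym[OF B_closed[OF y] B_closed[OF x] dS] by blast
  then show ?case using comm_basis[OF dS] less.prems by blast
qed

theorem rho_commutator:
  assumes "x \<in> carrier g" "y \<in> carrier g" "v \<in> carrier P"
  shows "rho x (rho y v) = rho y (rho x v) \<oplus>\<^bsub>P\<^esub> rho (br x y) v"
  using comm_free[OF assms(1,2) subset_refl _ assms(3)] comm_delta assms unfolding comm_def by blast

section \<open>The action of the tensor algebra\<close>

lemma foldr_rho_closed: "\<lbrakk>set xs \<subseteq> carrier g; v \<in> carrier P\<rbrakk> \<Longrightarrow> foldr rho xs v \<in> carrier P"
  by (induction xs) (auto simp: rho_closed)

lemma foldr_rho_linmap: "set xs \<subseteq> carrier g \<Longrightarrow> foldr rho xs \<in> linmap K P P"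
proof (induction xs)
  case (Cons x xs)
  then show ?case
    using linmap_comp[OF Cons.IH rho_linmap_right[of x]] by (simp add: comp_def)
qed (simp add: linmap_def)

lemma foldr_rho_multilinear:
  assumes v: "v \<in> carrier P"
  shows "multilinear P n (\<lambda>xs. foldr rho xs v)"
  unfolding multilinear_def
proof (intro conjI allI ballI impI)
  fix xs assume "xs \<in> tuples g n"
  then show "foldr rho xs v \<in> carrier P" using v by (intro foldr_rho_closed) (auto simp: tuples_def)
next
  fix us x y vs assume a: "us @ x # vs \<in> tuples g n" "y \<in> carrier g"
  then have t: "set us \<subseteq> carrier g" "x \<in> carrier g" "set vs \<subseteq> carrier g" by (auto simp: tuples_def)
  note w = foldr_rho_closed[OF t(3) v]
  show "foldr rho (us @ (x \<oplus>\<^bsub>g\<^esub> y) # vs) v = foldr rho (us @ x # vs) v \<oplus>\<^bsub>P\<^esub> foldr rho (us @ y # vs) v"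
    using t w a(2) by (simp add: linmap_add[OF rho_linmap_left[OF w]] linmap_add[OF foldr_rho_linmap] rho_closed)
next
  fix us a x vs assume a: "us @ x # vs \<in> tuples g n" "a \<in> carrier K"
  then have t: "set us \<subseteq> carrier g" "x \<in> carrier g" "set vs \<subseteq> carrier g" by (auto simp: tuples_def)
  note w = foldr_rho_closed[OF t(3) v]
  show "foldr rho (us @ (a \<odot>\<^bsub>g\<^esub> x) # vs) v = a \<odot>\<^bsub>P\<^esub> foldr rho (us @ x # vs) v"
    using t w a(2) by (simp add: linmap_smult[OF rho_linmap_left[OF w]] linmap_smult[OF foldr_rho_linmap] rho_closed)
qed

text \<open>\<open>Phi v t\<close> is \<open>t\<close> acting on \<open>v\<close>. The vector comes
  first because the universal property of \<open>T\<close> is applied to one fixed \<open>v\<close>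
  at a time.\<close>

definition Phi :: "('a multiset \<Rightarrow> 'k) \<Rightarrow> (nat \<Rightarrow> ('a list \<Rightarrow> 'k) set) \<Rightarrow> 'a multiset \<Rightarrow> 'k"
  where "Phi v = (SOME h. h \<in> linmap K T P \<and> (\<forall>xs. set xs \<subseteq> carrier g \<longrightarrow> h (pure xs) = foldr rho xs v))"

lemma Phi_linmap: "v \<in> carrier P \<Longrightarrow> Phi v \<in> linmap K T P"
  and Phi_pure: "\<lbrakk>v \<in> carrier P; set xs \<subseteq> carrier g\<rbrakk> \<Longrightarrow> Phi v (pure xs) = foldr rho xs v"
proof -
  assume v: "v \<in> carrier P"
  have "\<exists>h. h \<in> linmap K T P \<and> (\<forall>xs. set xs \<subseteq> carrier g \<longrightarrow> h (pure xs) = foldr rho xs v)"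
    by (rule T_lift[OF P_module foldr_rho_multilinear[OF v]]) blast
  note * = someI_ex[OF this, folded Phi_def]
  from * show "Phi v \<in> linmap K T P" by blast
  from * show "set xs \<subseteq> carrier g \<Longrightarrow> Phi v (pure xs) = foldr rho xs v" by blast
qed

lemma Phi_closed: "\<lbrakk>v \<in> carrier P; t \<in> carrier T\<rbrakk> \<Longrightarrow> Phi v t \<in> carrier P"
  by (rule linmap_closed[OF Phi_linmap])

text \<open>On words this is \<open>foldr\<close> over an appended list; linearity extends it first
  to arbitrary \<open>t\<close>, then to arbitrary \<open>s\<close>.\<close>

lemma Phi_mult:
  assumes v: "v \<in> carrier P" and s: "s \<in> carrier T" and t: "t \<in> carrier T"
  shows "Phi v (s \<otimes>\<^bsub>T\<^esub> t) = Phi (Phi v t) s"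
proof (rule T_linmap_eq[OF P_module _ _ _ s])
  show "(\<lambda>s. Phi v (s \<otimes>\<^bsub>T\<^esub> t)) \<in> linmap K T P"
    by (rule linmap_comp[OF T_mult_linmap_left[OF t] Phi_linmap[OF v]])
  show "Phi (Phi v t) \<in> linmap K T P"
    using v t by (intro Phi_linmap Phi_closed)
  fix xs assume xs: "set xs \<subseteq> carrier g"
  have "Phi v (pure xs \<otimes>\<^bsub>T\<^esub> t) = foldr rho xs (Phi v t)"
  proof (rule T_linmap_eq[OF P_module _ _ _ t])
    show "(\<lambda>t. Phi v (pure xs \<otimes>\<^bsub>T\<^esub> t)) \<in> linmap K T P"
      by (rule linmap_comp[OF T_mult_linmap_right[OF pure_closed[OF xs]] Phi_linmap[OF v]])
    show "(\<lambda>t. foldr rho xs (Phi v t)) \<in> linmap K T P"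
      by (rule linmap_comp[OF Phi_linmap[OF v] foldr_rho_linmap[OF xs]])
    fix ys assume ys: "set ys \<subseteq> carrier g"
    show "Phi v (pure xs \<otimes>\<^bsub>T\<^esub> pure ys) = foldr rho xs (Phi v (pure ys))"
      using xs ys v by (simp add: pure_mult Phi_pure)
  qed
  also have "\<dots> = Phi (Phi v t) (pure xs)"
    using xs v t by (simp add: Phi_pure Phi_closed)
  finally show "Phi v (pure xs \<otimes>\<^bsub>T\<^esub> t) = Phi (Phi v t) (pure xs)" .
qed

lemma Phi_zero_left:
  assumes t: "t \<in> carrier T" shows "Phi \<zero>\<^bsub>P\<^esub> t = \<zero>\<^bsub>P\<^esub>"
proof (rule T_linmap_eq[OF P_module Phi_linmap[OF P.M.zero_closed] _ _ t])
  show "(\<lambda>t. \<zero>\<^bsub>P\<^esub>) \<in> linmap K T P" by (rule linmapI) auto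
  show "Phi \<zero>\<^bsub>P\<^esub> (pure xs) = \<zero>\<^bsub>P\<^esub>" if "set xs \<subseteq> carrier g" for xs
    using that linmap_zero[OF P_module P_module foldr_rho_linmap] by (simp add: Phi_pure)
qed

text \<open>The annihilator of \<open>P\<close>. Quantifying over all vectors gives closure under
  multiplication by \<open>s\<close> on the right, where \<open>s\<close> first moves
  \<open>v\<close> to another vector.\<close>

lemma Phi_kernel_ideal: "ideal {t \<in> carrier T. \<forall>v\<in>carrier P. Phi v t = \<zero>\<^bsub>P\<^esub>} T"
proof (rule idealI[OF T_ring])
  interpret T: module K T by (rule T_module)
  let ?I = "{t \<in> carrier T. \<forall>v\<in>carrier P. Phi v t = \<zero>\<^bsub>P\<^esub>}"
  have "submodule ?I K T"
    by (rule T.submoduleI')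
      (auto simp: linmap_zero[OF T_module P_module Phi_linmap] linmap_add[OF Phi_linmap]
        linmap_smult[OF Phi_linmap])
  then show "subgroup ?I (add_monoid T)" by (rule submodule.axioms)
  show "s \<otimes>\<^bsub>T\<^esub> t \<in> ?I" if "t \<in> ?I" "s \<in> carrier T" for t s
    using that by (simp add: T_mult_closed Phi_mult Phi_zero_left)
  show "t \<otimes>\<^bsub>T\<^esub> s \<in> ?I" if "t \<in> ?I" "s \<in> carrier T" for t s
    using that by (simp add: T_mult_closed Phi_mult Phi_closed)
qed

end

section \<open>The enveloping algebra and its filtration\<close>

context lie_algebra
begin

abbreviation "J \<equiv> lie_ideal K g br"
abbreviation "U \<equiv> env_algebra K g br"
abbreviation "proj \<equiv> env_proj K g br"

interpretation T: module K T by (rule T_module)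
interpretation TR: ring T by (rule T_ring)
interpretation TP: module K "TP n" for n by (rule TP_module)

lemma lie_gen_pure: "lie_gen K g x = pure [x]"
  by (simp add: lie_gen_def pure_def)

lemma J_eq: "J = Idl\<^bsub>T\<^esub> {pure [x, y] \<ominus>\<^bsub>T\<^esub> pure [y, x] \<ominus>\<^bsub>T\<^esub> pure [br x y] | x y.
    x \<in> carrier g \<and> y \<in> carrier g}" (is "_ = Idl\<^bsub>T\<^esub> ?G")
proof -
  have "lie_gen K g x \<otimes>\<^bsub>T\<^esub> lie_gen K g y \<ominus>\<^bsub>T\<^esub> lie_gen K g y \<otimes>\<^bsub>T\<^esub> lie_gen K g x \<ominus>\<^bsub>T\<^esub> lie_gen K g (br x y)
      = pure [x, y] \<ominus>\<^bsub>T\<^esub> pure [y, x] \<ominus>\<^bsub>T\<^esub> pure [br x y]" if "x \<in> carrier g" "y \<in> carrier g" for x y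
    using that by (simp add: lie_gen_pure pure_mult)
  then have "{lie_gen K g x \<otimes>\<^bsub>T\<^esub> lie_gen K g y \<ominus>\<^bsub>T\<^esub> lie_gen K g y \<otimes>\<^bsub>T\<^esub> lie_gen K g x \<ominus>\<^bsub>T\<^esub> lie_gen K g (br x y)
      | x y. x \<in> carrier g \<and> y \<in> carrier g} = ?G"
    by (intro Collect_cong ex_cong1) auto
  then show ?thesis by (simp add: lie_ideal_def Let_def)
qed

lemma gens_closed: "{pure [x, y] \<ominus>\<^bsub>T\<^esub> pure [y, x] \<ominus>\<^bsub>T\<^esub> pure [br x y] | x y.
    x \<in> carrier g \<and> y \<in> carrier g} \<subseteq> carrier T"
  by (auto intro!: T.M.minus_closed pure_closed br_closed)

lemma J_ideal: "ideal J T"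
  unfolding J_eq by (rule TR.genideal_ideal[OF gens_closed])

lemma J_gen:
  assumes "x \<in> carrier g" "y \<in> carrier g"
  shows "pure [x, y] \<ominus>\<^bsub>T\<^esub> pure [y, x] \<ominus>\<^bsub>T\<^esub> pure [br x y] \<in> J"
  unfolding J_eq using TR.genideal_self[OF gens_closed] assms by blast

lemma J_minimal:
  assumes "ideal I T"
    and "\<And>x y. \<lbrakk>x \<in> carrier g; y \<in> carrier g\<rbrakk>
      \<Longrightarrow> pure [x, y] \<ominus>\<^bsub>T\<^esub> pure [y, x] \<ominus>\<^bsub>T\<^esub> pure [br x y] \<in> I"
  shows "J \<subseteq> I"
  unfolding J_eq by (rule TR.genideal_minimal[OF assms(1)]) (use assms(2) in blast)

lemma J_submodule: "submodule J K T"
  by (rule ideal_submodule[OF J_ideal])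

text \<open>The generator is multiplied by a word on either side, so that adjacent letters can be
  exchanged anywhere inside a tensor.\<close>

lemma J_swap:
  assumes us: "set us \<subseteq> carrier g" and vs: "set vs \<subseteq> carrier g" and x: "x \<in> carrier g" and y: "y \<in> carrier g"
  shows "pure (us @ x # y # vs) \<ominus>\<^bsub>T\<^esub> pure (us @ y # x # vs) \<ominus>\<^bsub>T\<^esub> pure (us @ br x y # vs) \<in> J"
proof -
  interpret J: ideal J T by (rule J_ideal)
  note left = T_mult_linmap_left[OF pure_closed[OF vs]]
  note right = T_mult_linmap_right[OF pure_closed[OF us]]
  note d = linmap_diff[OF T_module T_module]
  have c: "pure [x, y] \<in> carrier T" "pure [y, x] \<in> carrier T" "pure [br x y] \<in> carrier T"
    using x y br_closed by (auto intro!: pure_closed)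
  have c': "pure ([x, y] @ vs) \<in> carrier T" "pure ([y, x] @ vs) \<in> carrier T" "pure ([br x y] @ vs) \<in> carrier T"
    using x y br_closed vs by (auto intro!: pure_closed)
  have "(pure [x, y] \<ominus>\<^bsub>T\<^esub> pure [y, x] \<ominus>\<^bsub>T\<^esub> pure [br x y]) \<otimes>\<^bsub>T\<^esub> pure vs
      = pure ([x, y] @ vs) \<ominus>\<^bsub>T\<^esub> pure ([y, x] @ vs) \<ominus>\<^bsub>T\<^esub> pure ([br x y] @ vs)"
    using c x y vs br_closed by (simp add: d[OF left] pure_mult)
  then have "pure us \<otimes>\<^bsub>T\<^esub> ((pure [x, y] \<ominus>\<^bsub>T\<^esub> pure [y, x] \<ominus>\<^bsub>T\<^esub> pure [br x y]) \<otimes>\<^bsub>T\<^esub> pure vs)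
      = pure (us @ [x, y] @ vs) \<ominus>\<^bsub>T\<^esub> pure (us @ [y, x] @ vs) \<ominus>\<^bsub>T\<^esub> pure (us @ [br x y] @ vs)"
    using c' x y vs us br_closed by (simp only: d[OF right] T.M.minus_closed) (simp add: pure_mult)
  moreover have "pure us \<otimes>\<^bsub>T\<^esub> ((pure [x, y] \<ominus>\<^bsub>T\<^esub> pure [y, x] \<ominus>\<^bsub>T\<^esub> pure [br x y]) \<otimes>\<^bsub>T\<^esub> pure vs) \<in> J"
    by (intro J.I_l_closed J.I_r_closed J_gen x y pure_closed us vs)
  ultimately show ?thesis by simp
qed

lemma U_module: "module K U"
  unfolding env_algebra_def by (rule T.quot_is_module[OF J_submodule])

interpretation U: module K U by (rule U_module)

lemma proj_linmap: "proj \<in> linmap K T U"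
  using T.proj_linmap[OF J_submodule] by (simp add: env_algebra_def env_proj_def[abs_def])

lemma proj_eq_iff: "\<lbrakk>s \<in> carrier T; t \<in> carrier T\<rbrakk> \<Longrightarrow> proj s = proj t \<longleftrightarrow> s \<ominus>\<^bsub>T\<^esub> t \<in> J"
  unfolding env_proj_def by (rule T.coset_eq_iff[OF J_submodule])

section \<open>Tensors of low degree and congruence modulo them\<close>

definition low :: "nat \<Rightarrow> (nat \<Rightarrow> ('b list \<Rightarrow> 'a) set) set"
  where "low n = {t \<in> carrier T. \<forall>j\<ge>n. t j = \<zero>\<^bsub>TP j\<^esub>}"

lemma low_submodule: "submodule (low n) K T"
  by (rule T.submoduleI')
    (auto simp: low_def intro: T.M.add.m_closed T.smult_closed, auto simp: T_simps)

lemma env_filt_eq: "env_filt K g br (int n) = proj ` low (Suc n)"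
  and env_filt_pred_eq: "env_filt K g br (int n - 1) = proj ` low n"
proof -
  have "{t \<in> carrier T. \<forall>j. int j > int n \<longrightarrow> t j = \<zero>\<^bsub>TP j\<^esub>} = low (Suc n)"
    by (auto simp: low_def)
  then show "env_filt K g br (int n) = proj ` low (Suc n)" by (simp add: env_filt_def)
  have "{t \<in> carrier T. \<forall>j. int j > int n - 1 \<longrightarrow> t j = \<zero>\<^bsub>TP j\<^esub>} = low n"
    by (auto simp: low_def)
  then show "env_filt K g br (int n - 1) = proj ` low n" by (simp add: env_filt_def)
qed

lemma filt_submodule: "submodule (proj ` low n) K U"
  by (rule submodule_image[OF T_module U_module proj_linmap low_submodule])

text \<open>This is the sum of \<open>J\<close> and \<open>low n\<close>, written as the preimage of
  a filtration step; conditions on classes in \<open>env_gr\<close> thereby become membership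
  conditions in \<open>T\<close>.\<close>

definition JL :: "nat \<Rightarrow> (nat \<Rightarrow> ('b list \<Rightarrow> 'a) set) set"
  where "JL n = {t \<in> carrier T. proj t \<in> proj ` low n}"

lemma JL_submodule: "submodule (JL n) K T"
  unfolding JL_def by (rule submodule_vimage[OF T_module U_module proj_linmap filt_submodule])

lemmas JL_facts = T.submodule_facts[OF JL_submodule]
lemmas low_facts = T.submodule_facts[OF low_submodule]

lemma JL_iff: "t \<in> JL n \<longleftrightarrow> t \<in> carrier T \<and> (\<exists>s\<in>low n. t \<ominus>\<^bsub>T\<^esub> s \<in> J)"
  unfolding JL_def using low_facts(2) by (auto simp: proj_eq_iff image_iff)

lemma incl_low: "A \<in> carrier (TP m) \<Longrightarrow> m < n \<Longrightarrow> incl m A \<in> low n"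
  using linmap_closed[OF incl_linmap] by (auto simp: low_def tensor_incl_def)

lemma pure_low: "set xs \<subseteq> carrier g \<Longrightarrow> length xs < n \<Longrightarrow> pure xs \<in> low n"
  unfolding pure_def by (rule incl_low) (auto intro: pt_closed simp: tuples_def)

text \<open>The bracket term is a word of length \<open>n - 1\<close> and is therefore absorbed by
  \<open>low n\<close>.\<close>

lemma pure_swap_JL:
  assumes "set us \<subseteq> carrier g" "set vs \<subseteq> carrier g" "x \<in> carrier g" "y \<in> carrier g"
    and "n = length us + length vs + 2"
  shows "pure (us @ x # y # vs) \<ominus>\<^bsub>T\<^esub> pure (us @ y # x # vs) \<in> JL n"
proof -
  have "pure (us @ br x y # vs) \<in> low n"
    using assms br_closed by (intro pure_low) auto
  moreover have "pure (us @ x # y # vs) \<ominus>\<^bsub>T\<^esub> pure (us @ y # x # vs) \<in> carrier T"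
    using assms by (intro T.M.minus_closed pure_closed) auto
  ultimately show ?thesis using J_swap[OF assms(1-4)] unfolding JL_iff by blast
qed

lemma diff_JL_trans:
  assumes "a \<in> carrier T" "b \<in> carrier T" "c \<in> carrier T" "a \<ominus>\<^bsub>T\<^esub> b \<in> JL n" "b \<ominus>\<^bsub>T\<^esub> c \<in> JL n"
  shows "a \<ominus>\<^bsub>T\<^esub> c \<in> JL n"
proof -
  have "a \<ominus>\<^bsub>T\<^esub> c = (a \<ominus>\<^bsub>T\<^esub> b) \<oplus>\<^bsub>T\<^esub> (b \<ominus>\<^bsub>T\<^esub> c)"
    using assms(1-3) by (simp add: a_minus_def T.M.a_assoc T.M.r_neg1 T.M.r_neg2)
  then show ?thesis using assms(4,5) JL_facts(3) by simp
qed

lemma pure_shift_JL: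
  assumes "set (us @ x # as @ bs) \<subseteq> carrier g" "n = length (us @ x # as @ bs)"
  shows "pure (us @ x # as @ bs) \<ominus>\<^bsub>T\<^esub> pure (us @ as @ x # bs) \<in> JL n"
  using assms
proof (induction as arbitrary: us)
  case Nil
  then show ?case using pure_closed[of "us @ x # bs"] JL_facts(1) by (simp add: T.M.diff_self)
next
  case (Cons a as)
  have 1: "pure (us @ x # a # as @ bs) \<ominus>\<^bsub>T\<^esub> pure (us @ a # x # as @ bs) \<in> JL n"
    using Cons.prems by (intro pure_swap_JL) auto
  have 2: "pure (us @ a # x # as @ bs) \<ominus>\<^bsub>T\<^esub> pure (us @ a # as @ x # bs) \<in> JL n"
    using Cons.IH[of "us @ [a]"] Cons.prems by simp
  show ?case
    using diff_JL_trans[OF _ _ _ 1 2] Cons.prems by (simp add: pure_closed)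
qed

text \<open>The tail is first rearranged with \<open>x\<close> added to the prefix, and then
  \<open>x\<close> is shifted to its place in \<open>ys\<close>. The variable prefix
  \<open>us\<close> is what makes this induction go through.\<close>

lemma pure_perm_JL:
  assumes "set (us @ xs) \<subseteq> carrier g" "n = length (us @ xs)" "mset ys = mset xs"
  shows "pure (us @ xs) \<ominus>\<^bsub>T\<^esub> pure (us @ ys) \<in> JL n"
  using assms
proof (induction xs arbitrary: us ys)
  case Nil
  then show ?case using pure_closed[of us] JL_facts(1) by (simp add: T.M.diff_self)
next
  case (Cons x xs)
  have "x \<in> set ys" using Cons.prems(3) by (metis list.set_intros(1) set_mset_mset)
  then obtain as bs where ys: "ys = as @ x # bs" by (meson split_list)
  then have m: "mset (as @ bs) = mset xs" using Cons.prems(3) by simp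
  then have s: "set (as @ bs) = set xs" "length (as @ bs) = length xs"
    by (metis set_mset_mset, metis size_mset)
  have 1: "pure (us @ x # xs) \<ominus>\<^bsub>T\<^esub> pure (us @ x # as @ bs) \<in> JL n"
    using Cons.IH[of "us @ [x]" "as @ bs"] Cons.prems m by simp
  have 2: "pure (us @ x # as @ bs) \<ominus>\<^bsub>T\<^esub> pure (us @ as @ x # bs) \<in> JL n"
    by (rule pure_shift_JL) (use Cons.prems s in auto)
  have "set as \<union> set bs \<subseteq> carrier g" using s(1) Cons.prems(1) by simp
  then show ?case
    unfolding ys using diff_JL_trans[OF _ _ _ 1 2] Cons.prems by (simp add: pure_closed)
qed

section \<open>The symmetric relations\<close>

abbreviation "Sym n \<equiv> sym_submodule K g n"

lemma sym_gens: "{pt xs \<ominus>\<^bsub>TP n\<^esub> pt ys | xs ys. xs \<in> tuples g n \<and> mset ys = mset xs} \<subseteq> carrier (TP n)"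
proof -
  have "ys \<in> tuples g n" if "xs \<in> tuples g n" "mset ys = mset xs" for xs ys :: "'b list"
    using that by (auto simp: tuples_def dest: mset_eq_setD mset_eq_length)
  then show ?thesis by (auto intro!: TP.M.minus_closed pt_closed)
qed

lemma Sym_submodule: "submodule (Sym n) K (TP n)"
  unfolding sym_submodule_def by (rule TP.gen_submodule_submodule[OF sym_gens])

lemma Sym_gen: "\<lbrakk>xs \<in> tuples g n; mset ys = mset xs\<rbrakk> \<Longrightarrow> pt xs \<ominus>\<^bsub>TP n\<^esub> pt ys \<in> Sym n"
  unfolding sym_submodule_def by (rule gen_submodule_incl) blast

text \<open>The half of the kernel computation that makes \<open>pbw_map\<close> well defined; the
  converse is \<open>JL_Sym\<close>.\<close>

lemma Sym_JL: "A \<in> Sym n \<Longrightarrow> incl n A \<in> JL n"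
proof -
  have "Sym n \<subseteq> {A \<in> carrier (TP n). incl n A \<in> JL n}"
    unfolding sym_submodule_def
  proof (rule gen_submodule_minimal)
    show "submodule {A \<in> carrier (TP n). incl n A \<in> JL n} K (TP n)"
      by (rule submodule_vimage[OF TP_module T_module incl_linmap JL_submodule])
    show "{pt xs \<ominus>\<^bsub>TP n\<^esub> pt ys | xs ys. xs \<in> tuples g n \<and> mset ys = mset xs}
        \<subseteq> {A \<in> carrier (TP n). incl n A \<in> JL n}"
    proof
      fix A assume A: "A \<in> {pt xs \<ominus>\<^bsub>TP n\<^esub> pt ys | xs ys. xs \<in> tuples g n \<and> mset ys = mset xs}"
      then obtain xs ys where xs: "xs \<in> tuples g n" "mset ys = mset xs" "A = pt xs \<ominus>\<^bsub>TP n\<^esub> pt ys" by blast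
      then have ys: "ys \<in> tuples g n" by (auto simp: tuples_def dest: mset_eq_setD mset_eq_length)
      have "incl n A = pure xs \<ominus>\<^bsub>T\<^esub> pure ys"
        using xs ys by (simp add: linmap_diff[OF TP_module T_module incl_linmap] pt_closed pure_def tuples_length)
      moreover have "pure ([] @ xs) \<ominus>\<^bsub>T\<^esub> pure ([] @ ys) \<in> JL n"
        using xs by (intro pure_perm_JL) (auto simp: tuples_def)
      ultimately show "A \<in> {A \<in> carrier (TP n). incl n A \<in> JL n}"
        using A sym_gens by auto
    qed
  qed
  then show "A \<in> Sym n \<Longrightarrow> incl n A \<in> JL n" by blast
qed

end

section \<open>Linear independence of ordered monomials\<close>

context lie_basis
begin

interpretation T: module K T by (rule T_module)
interpretation TP: module K "TP n" for n by (rule TP_module)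

lemma Phi_J:
  assumes t: "t \<in> J" and v: "v \<in> carrier P"
  shows "Phi v t = \<zero>\<^bsub>P\<^esub>"
proof -
  have "J \<subseteq> {t \<in> carrier T. \<forall>v\<in>carrier P. Phi v t = \<zero>\<^bsub>P\<^esub>}"
  proof (rule J_minimal[OF Phi_kernel_ideal])
    fix x y assume x: "x \<in> carrier g" and y: "y \<in> carrier g"
    have c: "pure [x, y] \<in> carrier T" "pure [y, x] \<in> carrier T" "pure [br x y] \<in> carrier T"
      using x y by (simp_all add: pure_closed br_closed)
    have "Phi v (pure [x, y] \<ominus>\<^bsub>T\<^esub> pure [y, x] \<ominus>\<^bsub>T\<^esub> pure [br x y]) = \<zero>\<^bsub>P\<^esub>" if v: "v \<in> carrier P" for v
    proof -
      have "Phi v (pure [x, y] \<ominus>\<^bsub>T\<^esub> pure [y, x] \<ominus>\<^bsub>T\<^esub> pure [br x y])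
          = rho x (rho y v) \<ominus>\<^bsub>P\<^esub> rho y (rho x v) \<ominus>\<^bsub>P\<^esub> rho (br x y) v"
        using c x y v br_closed by (simp add: linmap_diff[OF T_module P_module Phi_linmap[OF v]] Phi_pure)
      also have "\<dots> = \<zero>\<^bsub>P\<^esub>"
        unfolding rho_commutator[OF x y v] using x y v br_closed
        by (intro P.M.add_diff_diff rho_closed) auto
      finally show ?thesis .
    qed
    with c show "pure [x, y] \<ominus>\<^bsub>T\<^esub> pure [y, x] \<ominus>\<^bsub>T\<^esub> pure [br x y]
        \<in> {t \<in> carrier T. \<forall>v\<in>carrier P. Phi v t = \<zero>\<^bsub>P\<^esub>}"
      by (auto intro!: T.M.minus_closed)
  qed
  with t v show ?thesis by blast
qed

abbreviation "vac \<equiv> delta K ({#} :: 'a multiset)"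

lemma vac_closed: "vac \<in> carrier P"
  by (rule delta_closed) (simp add: mons_def)

lemma foldr_rho_PL: "set xs \<subseteq> carrier g \<Longrightarrow> foldr rho xs vac \<in> carrier (PL (Suc (length xs)))"
proof (induction xs)
  case Nil
  have "vac \<in> carrier (PL 1)" by (rule delta_PL) (simp_all add: mons_def)
  then show ?case by simp
next
  case (Cons x xs)
  then show ?case using rho_PL[of x "foldr rho xs vac" "Suc (length xs)"] by simp
qed

text \<open>A word of length \<open>k\<close> takes \<open>vac\<close> to degree at most
  \<open>k\<close>, and only lengths at which \<open>t\<close> is nonzero occur in the
  induction.\<close>

lemma Phi_low:
  assumes t: "t \<in> low n"
  shows "Phi vac t \<in> carrier (PL n)"
proof -
  note lin = Phi_linmap[OF vac_closed]
  have tT: "t \<in> carrier T" using t by (simp add: low_def)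
  then show ?thesis
  proof (induction rule: T_induct)
    case zero
    show ?case using linmap_zero[OF T_module P_module lin] PL_facts(1) by simp
  next
    case (add s t)
    then show ?case by (simp add: linmap_add[OF lin] PL_facts(3))
  next
    case (smult a t)
    then show ?case by (simp add: linmap_smult[OF lin] PL_facts(6))
  next
    case (pure xs)
    then have "length xs < n" using t by (auto simp: low_def not_le[symmetric])
    then show ?case
      using PL_mono[OF _ foldr_rho_PL[OF pure(1)]] pure(1) by (simp add: Phi_pure vac_closed)
  qed
qed

text \<open>When letters are prepended in the order in which least elements are removed, every
  action falls under \<open>rho_below\<close>, so no terms of lower degree arise.\<close>

lemma exists_sorted:
  "S \<in> mons \<Longrightarrow> \<exists>xs. mset xs = S \<and> foldr rho xs vac = delta K S"
proof (induction "size S" arbitrary: S)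
  case 0
  then show ?case by (intro exI[of _ "[]"]) simp
next
  case (Suc n)
  then have "S \<noteq> {#}" by auto
  note l = least[OF this]
  define T where "T = S - {#least S#}"
  have S: "S = add_mset (least S) T" using l by (simp add: T_def)
  have "set_mset S = insert (least S) (set_mset T)" "size S = Suc (size T)"
    by (subst S, simp)+
  then have T: "T \<in> mons" "least S \<in> B" "size T = n"
    using Suc.prems Suc.hyps(2) by (simp_all add: mons_def)
  then obtain xs where xs: "mset xs = T" "foldr rho xs vac = delta K T" using Suc.hyps(1) by blast
  have "below (least S) T" using l(2) by (auto simp: below_def T_def dest: in_diffD)
  then have "rho (least S) (delta K T) = delta K S"
    using rho_below[OF T(2,1)] by (simp only: S[symmetric])
  moreover have "mset (least S # xs) = S"
    by (simp only: mset.simps xs(1) S[symmetric])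
  ultimately show ?case using xs(2) by (intro exI[of _ "least S # xs"]) simp
qed

text \<open>Any arrangement of \<open>S\<close> with the right effect on \<open>vac\<close> will
  serve, so the list is specified by that effect rather than by an explicit sorting
  function.\<close>

definition srt :: "'a multiset \<Rightarrow> 'a list"
  where "srt S = (SOME xs. mset xs = S \<and> foldr rho xs vac = delta K S)"

lemma srt: "S \<in> mons \<Longrightarrow> mset (srt S) = S" "S \<in> mons \<Longrightarrow> foldr rho (srt S) vac = delta K S"
  unfolding srt_def using someI_ex[OF exists_sorted] by auto

abbreviation "PH n \<equiv> free_module K {S \<in> mons. size S = n}"

lemma srt_tuples: "\<lbrakk>S \<in> mons; size S = n\<rbrakk> \<Longrightarrow> srt S \<in> tuples g n"
  using srt(1)[of S] B_closed by (auto simp: tuples_def mons_def simp flip: set_mset_mset size_mset)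

text \<open>A linear lift of homogeneous polynomials to tensors. By \<open>Phi_sigma\<close> it can
  be undone by acting on \<open>vac\<close>, and by \<open>sorted_representative\<close> its image
  is everything modulo \<open>Sym n\<close>.\<close>

definition sigma :: "nat \<Rightarrow> ('a multiset \<Rightarrow> 'k) \<Rightarrow> ('a list \<Rightarrow> 'k) set"
  where "sigma n = lext K (TP n) (\<lambda>S. pt (srt S))"

lemma sigma_linmap: "sigma n \<in> linmap K (PH n) (TP n)"
  unfolding sigma_def by (rule lext_linmap[OF TP_module]) (auto intro: pt_closed srt_tuples)

lemma sigma_delta: "\<lbrakk>S \<in> mons; size S = n\<rbrakk> \<Longrightarrow> sigma n (delta K S) = pt (srt S)"
  unfolding sigma_def by (intro lext_delta[OF TP_module] pt_closed srt_tuples)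

lemma Phi_sigma:
  assumes c: "c \<in> carrier (PH n)"
  shows "Phi vac (incl n (sigma n c)) = c"
proof (rule free_linmap_eq[OF P_module _ _ _ c])
  show "(\<lambda>c. Phi vac (incl n (sigma n c))) \<in> linmap K (PH n) P"
    by (rule linmap_comp[OF linmap_comp[OF sigma_linmap incl_linmap] Phi_linmap[OF vac_closed]])
  have "(\<lambda>c. c) \<in> linmap K P P" by (simp add: linmap_def)
  then show "(\<lambda>c. c) \<in> linmap K (PH n) P" by (rule linmap_free_mono) auto
  fix S assume "S \<in> {S \<in> mons. size S = n}"
  then have S: "S \<in> mons" "size S = n" by auto
  have t: "srt S \<in> tuples g n" using S by (rule srt_tuples)
  have "incl n (sigma n (delta K S)) = pure (srt S)"
    using S by (simp add: sigma_delta pure_def tuples_length[OF t])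
  then show "Phi vac (incl n (sigma n (delta K S))) = delta K S"
    using S t by (simp add: Phi_pure vac_closed srt(2) tuples_def)
qed

text \<open>The slots are expanded in the basis from left to right; \<open>us\<close> holds those
  already expanded.\<close>

lemma TP_subset_basis:
  assumes N: "submodule N K (TP n)" and b: "\<And>xs. \<lbrakk>set xs \<subseteq> B; length xs = n\<rbrakk> \<Longrightarrow> pt xs \<in> N"
  shows "carrier (TP n) \<subseteq> N"
proof (rule TP_subset_submodule[OF N])
  have "pt (us @ vs) \<in> N"
    if "set us \<subseteq> B" "set vs \<subseteq> carrier g" "length (us @ vs) = n" for us vs
    using that
  proof (induction vs arbitrary: us)
    case Nil
    then show ?case using b by simp
  next
    case (Cons x vs)
    have t: "us @ y # vs \<in> tuples g n" if "y \<in> carrier g" for y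
      using Cons.prems B_closed that by (auto simp: tuples_def)
    have lin: "(\<lambda>y. pt (us @ y # vs)) \<in> linmap K g (TP n)"
      by (rule linmapI) (use t pt_closed pt_add pt_smult in auto)
    have "carrier g \<subseteq> {y \<in> carrier g. pt (us @ y # vs) \<in> N}"
    proof (rule g_subset_submodule[OF submodule_vimage[OF g_module TP_module lin N]])
      show "B \<subseteq> {y \<in> carrier g. pt (us @ y # vs) \<in> N}"
      proof
        fix y assume y: "y \<in> B"
        have "pt ((us @ [y]) @ vs) \<in> N" using y Cons.prems by (intro Cons.IH) auto
        then show "y \<in> {y \<in> carrier g. pt (us @ y # vs) \<in> N}" using y B_closed by simp
      qed
    qed
    then show ?case using Cons.prems by auto
  qed
  from this[of "[]"] show "pt xs \<in> N" if "xs \<in> tuples g n" for xs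
    using that by (auto simp: tuples_def)
qed

lemma sorted_representative:
  assumes A: "A \<in> carrier (TP n)"
  obtains c where "c \<in> carrier (PH n)" "A \<ominus>\<^bsub>TP n\<^esub> sigma n c \<in> Sym n"
proof -
  let ?Q = "quot_module (TP n) (Sym n)" and ?q = "\<lambda>A. Sym n +>\<^bsub>TP n\<^esub> A"
  have Q: "module K ?Q" by (rule TP.quot_is_module[OF Sym_submodule])
  have q: "?q \<in> linmap K (TP n) ?Q" by (rule TP.proj_linmap[OF Sym_submodule])
  have PH: "module K (PH n)" by (rule free_is_module)
  interpret PH: module K "PH n" by (rule PH)
  \<comment> \<open>Spanning is proved in the quotient by \<open>Sym n\<close>, where the image of
    \<open>sigma n\<close> is a submodule; it then suffices that this image contains the classes of
    all basis tensors.\<close>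
  let ?I = "(\<lambda>c. ?q (sigma n c)) ` carrier (PH n)"
  have I: "submodule ?I K ?Q"
    by (rule submodule_image[OF PH Q linmap_comp[OF sigma_linmap q] PH.carrier_is_submodule])
  have "carrier (TP n) \<subseteq> {A \<in> carrier (TP n). ?q A \<in> ?I}"
  proof (rule TP_subset_basis[OF submodule_vimage[OF TP_module Q q I]])
    fix xs assume xs: "set xs \<subseteq> B" "length xs = n"
    have S: "mset xs \<in> mons" "size (mset xs) = n" using xs by (simp_all add: mons_def)
    have t: "xs \<in> tuples g n" using xs B_closed by (auto simp: tuples_def)
    have "pt xs \<ominus>\<^bsub>TP n\<^esub> pt (srt (mset xs)) \<in> Sym n" using t srt(1)[OF S(1)] by (rule Sym_gen)
    then have "?q (pt xs) = ?q (sigma n (delta K (mset xs)))"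
      using S t by (simp add: TP.coset_eq_iff[OF Sym_submodule] pt_closed srt_tuples sigma_delta)
    moreover have "delta K (mset xs) \<in> carrier (PH n)" using S by (intro delta_closed) simp
    ultimately show "pt xs \<in> {A \<in> carrier (TP n). ?q A \<in> ?I}" using t pt_closed by blast
  qed
  then obtain c where "c \<in> carrier (PH n)" "?q A = ?q (sigma n c)" using A by blast
  then show thesis
    using that A linmap_closed[OF sigma_linmap] by (simp add: TP.coset_eq_iff[OF Sym_submodule])
qed

lemma JL_Sym:
  assumes A: "A \<in> carrier (TP n)" and AJ: "incl n A \<in> JL n"
  shows "A \<in> Sym n"
proof -
  obtain c where c: "c \<in> carrier (PH n)" "A \<ominus>\<^bsub>TP n\<^esub> sigma n c \<in> Sym n"
    by (rule sorted_representative[OF A])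
  have s: "sigma n c \<in> carrier (TP n)" by (rule linmap_closed[OF sigma_linmap c(1)])
  have iA: "incl n A \<in> carrier T" and iS: "incl n (sigma n c) \<in> carrier T"
    using A s by (simp_all add: linmap_closed[OF incl_linmap])
  have "incl n A \<ominus>\<^bsub>T\<^esub> incl n (sigma n c) \<in> JL n"
    using Sym_JL[OF c(2)] A s by (simp add: linmap_diff[OF TP_module T_module incl_linmap])
  \<comment> \<open>Since \<open>A\<close> and its sorted representative differ by an element of
    \<open>JL n\<close>, the representative lies in \<open>JL n\<close> too.\<close>
  then have "incl n A \<ominus>\<^bsub>T\<^esub> (incl n A \<ominus>\<^bsub>T\<^esub> incl n (sigma n c)) \<in> JL n"
    using AJ JL_facts(4) by blast
  then have "incl n (sigma n c) \<in> JL n"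
    using iA iS by (simp add: a_minus_def T.M.minus_add T.M.r_neg1 T.M.r_neg2)
  then obtain r where r: "r \<in> low n" "incl n (sigma n c) \<ominus>\<^bsub>T\<^esub> r \<in> J"
    by (auto simp: JL_iff)
  have rT: "r \<in> carrier T" using r(1) low_facts(2) by blast
  have "Phi vac (incl n (sigma n c)) \<ominus>\<^bsub>P\<^esub> Phi vac r = \<zero>\<^bsub>P\<^esub>"
    using Phi_J[OF r(2) vac_closed] iS rT
    by (simp add: linmap_diff[OF T_module P_module Phi_linmap[OF vac_closed]])
  then have "c = Phi vac r"
    using iS rT by (simp add: P.M.diff_eq_zero_iff Phi_closed vac_closed Phi_sigma[OF c(1)] Phi_closed[OF vac_closed iS, unfolded Phi_sigma[OF c(1)]])
  then have "c \<in> carrier (PL n)" using Phi_low[OF r(1)] by simp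
  then have "c S = \<zero>" for S using c(1) by (cases "size S = n") (auto simp: free_module_carrier)
  then have "c = \<zero>\<^bsub>PH n\<^esub>" by (auto simp: free_module_ops)
  then have "sigma n c = \<zero>\<^bsub>TP n\<^esub>"
    using linmap_zero[OF free_is_module TP_module sigma_linmap] by simp
  with c(2) A show ?thesis by (simp add: TP.M.diff_zero)
qed

end

section \<open>The isomorphism\<close>

context lie_basis
begin

interpretation T: module K T by (rule T_module)
interpretation TP: module K "TP n" for n by (rule TP_module)
interpretation U: module K U by (rule U_module)

lemma pbw_iso: "pbw_map K g br n \<in> module_iso K (sym_power K g n) (env_gr K g br n)"
proof -
  define W where "W = U\<lparr>carrier := proj ` low (Suc n)\<rparr>"
  define V where "V = proj ` low n"
  have W: "module K W"
    unfolding W_def by (rule submodule.submodule_is_module[OF filt_submodule U_module])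
  interpret W: module K W by (rule W)
  have lowle: "low n \<subseteq> low (Suc n)" by (auto simp: low_def)
  have W_ops: "carrier W = proj ` low (Suc n)" "x \<oplus>\<^bsub>W\<^esub> y = x \<oplus>\<^bsub>U\<^esub> y" "a \<odot>\<^bsub>W\<^esub> x = a \<odot>\<^bsub>U\<^esub> x"
      "\<zero>\<^bsub>W\<^esub> = \<zero>\<^bsub>U\<^esub>" for a x y
    by (simp_all add: W_def)
  have V: "submodule V K W"
  proof (rule W.submoduleI')
    note V_facts = U.submodule_facts[OF filt_submodule[of n], folded V_def]
    show "V \<subseteq> carrier W" unfolding V_def W_ops using lowle by (rule image_mono)
    show "\<zero>\<^bsub>W\<^esub> \<in> V" unfolding W_ops by (rule V_facts(1))
    show "x \<oplus>\<^bsub>W\<^esub> y \<in> V" if "x \<in> V" "y \<in> V" for x y unfolding W_ops using that by (rule V_facts(3))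
    show "a \<odot>\<^bsub>W\<^esub> x \<in> V" if "a \<in> carrier K" "x \<in> V" for a x unfolding W_ops using that by (rule V_facts(6))
  qed
  have gr: "env_gr K g br n = quot_module W V"
    by (simp add: env_gr_def env_filt_eq env_filt_pred_eq W_def V_def)
  \<comment> \<open>A coset depends only on the addition, so \<open>env_gr\<close>, formed inside
    \<open>W\<close>, and \<open>pbw_map\<close>, formed inside \<open>U\<close>, speak of the same
    cosets.\<close>
  have coset: "V +>\<^bsub>U\<^esub> x = V +>\<^bsub>W\<^esub> x" for x
    by (simp add: a_r_coset_def' W_ops)
  have inclW: "proj (incl n A) \<in> carrier W" if "A \<in> carrier (TP n)" for A
    using that incl_low by (simp add: W_ops)
  have pi: "(\<lambda>A. proj (incl n A)) \<in> linmap K (TP n) W"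
    using linmap_comp[OF incl_linmap proj_linmap] inclW by (simp add: linmap_def W_ops)
  define h where "h A = V +>\<^bsub>W\<^esub> proj (incl n A)" for A
  have h: "h \<in> linmap K (TP n) (quot_module W V)"
    using linmap_comp[OF pi W.proj_linmap[OF V]] by (simp add: h_def[abs_def])
  have Q: "module K (quot_module W V)" by (rule W.quot_is_module[OF V])
  \<comment> \<open>One direction gives well-definedness of the induced map, the other its
    injectivity.\<close>
  have ker: "h A = \<zero>\<^bsub>quot_module W V\<^esub> \<longleftrightarrow> A \<in> Sym n" if A: "A \<in> carrier (TP n)" for A
  proof -
    have "h A = \<zero>\<^bsub>quot_module W V\<^esub> \<longleftrightarrow> incl n A \<in> JL n"
      unfolding h_def using W.coset_zero_iff[OF V inclW[OF A]] linmap_closed[OF incl_linmap A]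
      by (simp add: JL_def V_def)
    then show ?thesis using JL_Sym[OF A] Sym_JL by blast
  qed
  have surj: "h ` carrier (TP n) = carrier (quot_module W V)"
  proof
    show "h ` carrier (TP n) \<subseteq> carrier (quot_module W V)" using linmap_closed[OF h] by blast
    show "carrier (quot_module W V) \<subseteq> h ` carrier (TP n)"
    proof
      fix X assume "X \<in> carrier (quot_module W V)"
      then obtain w where w: "w \<in> carrier W" "X = V +>\<^bsub>W\<^esub> w" by (rule W.quot_carrierE[OF V])
      then obtain t where t: "t \<in> low (Suc n)" "w = proj t" by (auto simp: W_ops)
      have tT: "t \<in> carrier T" using t low_facts(2) by blast
      have tn: "t n \<in> carrier (TP n)" by (rule T_component[OF tT])
      have it: "incl n (t n) \<in> carrier T" by (rule linmap_closed[OF incl_linmap tn])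
      \<comment> \<open>Modulo \<open>low n\<close>, an element of \<open>low (Suc n)\<close> is its
        component of degree \<open>n\<close>, which supplies the preimage.\<close>
      have "(t \<ominus>\<^bsub>T\<^esub> incl n (t n)) j = \<zero>\<^bsub>TP j\<^esub>" if "j \<ge> n" for j
      proof -
        have eq: "t j = incl n (t n) j"
          using that t(1) by (cases "j = n") (auto simp: low_def tensor_incl_def)
        have "(t \<ominus>\<^bsub>T\<^esub> incl n (t n)) j = t j \<ominus>\<^bsub>TP j\<^esub> incl n (t n) j"
          using tT it by (rule linmap_diff[OF T_module TP_module component_linmap])
        also have "\<dots> = \<zero>\<^bsub>TP j\<^esub>"
          by (subst eq) (rule TP.M.diff_self[OF T_component[OF it]])
        finally show ?thesis .
      qed
      then have "t \<ominus>\<^bsub>T\<^esub> incl n (t n) \<in> low n"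
        using T.M.minus_closed[OF tT it] by (simp add: low_def)
      then have "proj (t \<ominus>\<^bsub>T\<^esub> incl n (t n)) \<in> V" by (simp add: V_def)
      moreover have "w \<ominus>\<^bsub>W\<^esub> proj (incl n (t n)) = proj (t \<ominus>\<^bsub>T\<^esub> incl n (t n))"
      proof -
        \<comment> \<open>Additive inverses are defined relative to the carrier, so the one in
          \<open>W\<close> is compared with the one in \<open>U\<close> through the scalar
          -1.\<close>
        have "\<ominus>\<^bsub>W\<^esub> proj (incl n (t n)) = \<ominus>\<^bsub>U\<^esub> proj (incl n (t n))"
          using inclW[OF tn] linmap_closed[OF proj_linmap it]
          by (simp add: W.neg_eq_smult U.neg_eq_smult W_ops(3))
        then show ?thesis
          unfolding t(2) linmap_diff[OF T_module U_module proj_linmap tT it]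
          by (simp add: a_minus_def W_ops(2))
      qed
      ultimately have "X = h (t n)"
        using w inclW[OF tn] by (simp add: h_def W.coset_eq_iff[OF V])
      then show "X \<in> h ` carrier (TP n)" using tn by blast
    qed
  qed
  have k: "pbw_map K g br n (Sym n +>\<^bsub>TP n\<^esub> A) = h A" if A: "A \<in> carrier (TP n)" for A
  proof -
    \<comment> \<open>All members of the coset have the same image, so the union defining
      \<open>pbw_map\<close> collapses to one coset.\<close>
    have *: "h A' = h A" if "A' \<in> Sym n +>\<^bsub>TP n\<^esub> A" for A'
    proof -
      from that have A': "A' \<in> carrier (TP n)" "A' \<ominus>\<^bsub>TP n\<^esub> A \<in> Sym n"
        using TP.mem_coset_iff[OF Sym_submodule A] TP.coset_eq_iff[OF Sym_submodule _ A] by blast+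
      then have "h A' \<ominus>\<^bsub>quot_module W V\<^esub> h A = \<zero>\<^bsub>quot_module W V\<^esub>"
        using A ker[of "A' \<ominus>\<^bsub>TP n\<^esub> A"] by (simp add: linmap_diff[OF TP_module Q h])
      then show ?thesis
        using A A' linmap_closed[OF h] abelian_group.diff_eq_zero_iff[OF module.axioms(2)[OF Q]] by blast
    qed
    have ne: "Sym n +>\<^bsub>TP n\<^esub> A \<noteq> {}" using TP.coset_self[OF Sym_submodule A] by blast
    have "pbw_map K g br n (Sym n +>\<^bsub>TP n\<^esub> A) = (\<Union>A'\<in>Sym n +>\<^bsub>TP n\<^esub> A. h A')"
      by (simp add: pbw_map_def env_filt_pred_eq V_def[symmetric] coset h_def)
    also have "\<dots> = h A" by (rule SUP_eq_const[OF ne *])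
    finally show ?thesis .
  qed
  show ?thesis
    unfolding gr sym_power_def
    by (rule first_isomorphism[OF TP_module Q Sym_submodule h ker surj k])
qed

end

theorem proposition6p1:
  fixes K :: "('k, 'm) ring_scheme"
    and g :: "('k, 'a, 'c) module_scheme"
    and br :: "'a \<Rightarrow> 'a \<Rightarrow> 'a"
  assumes "cring K"
    and "lie_algebra K g br"
    and "is_free K g"
  shows "\<forall>n::nat. pbw_map K g br n \<in> module_iso K (sym_power K g n) (env_gr K g br n)"
proof
  fix n
  obtain B where B: "is_basis K g B" using assms(3) by (auto simp: is_free_def)
  \<comment> \<open>The well-ordering theorem provides a total order on the whole type.\<close>
  obtain r :: "'a rel" where "well_order_on UNIV r" using well_order_on by blast
  then have r: "refl r" "trans r" "antisym r" "total r"
    by (auto simp: well_order_on_def linear_order_on_def partial_order_on_def preorder_on_def)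
  interpret lie_basis K g br B "\<lambda>x y. (x, y) \<in> r"
  proof (rule lie_basis.intro[OF assms(2)], rule lie_basis_axioms.intro[OF B])
    show "(x, x) \<in> r" for x using r(1) by (simp add: refl_on_def)
    show "(x, z) \<in> r" if "(x, y) \<in> r" "(y, z) \<in> r" for x y z using r(2) that by (rule transD)
    show "x = y" if "(x, y) \<in> r" "(y, x) \<in> r" for x y using r(3) that by (rule antisymD)
    show "(x, y) \<in> r \<or> (y, x) \<in> r" for x y
      using r(1,4) by (cases "x = y") (auto simp: total_on_def refl_on_def)
  qed
  show "pbw_map K g br n \<in> module_iso K (sym_power K g n) (env_gr K g br n)"
    by (rule pbw_iso)
qed

end
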